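(* Let $X$ be a smooth irreducible variety over $\mathbb{C}$, $Y\subset X$ a smooth hypersurface, $n\geq 1$ an integer, and $P$ a closed point of $Y$. Let $Y_n$ be the hypersurface of multiplicity $n$ associated with $Y$, and $\mathcal{O}_n$ its structure sheaf. Then there exists a morphism of $\mathbb{C}$-algebras $\mathcal{O}_{Y,P}\to\mathcal{O}_{n,P}$ which is a section of the restriction morphism $\mathcal{O}_{n,P}\to\mathcal{O}_{Y,P}$. Consequently there is an isomorphism of $\mathbb{C}$-algebras $$\mathcal{O}_{n,P}\simeq\mathcal{O}_{Y,P}\otimes_{\mathbb{C}}\mathbb{C}[t]/(t^n).$$
   Context: The hypersurface $Y_n$ of multiplicity $n$ associated with $Y$ is the closed subscheme of $X$ whose ideal sheaf is $\mathcal{I}_Y^n$, where $\mathcal{I}_Y$ is the ideal sheaf of $Y$ in $X$. So, if $f$ is a local equation of $Y$ at $P$, then $\mathcal{O}_{n,P}=\mathcal{O}_{X,P}/(f^n)$ and $\mathcal{O}_{Y,P}=\mathcal{O}_{X,P}/(f)$. *)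

theory Defs
  imports
    "HOL-Analysis.Analysis"
    "HOL-Algebra.QuotRing"
    "HOL-Algebra.Ideal_Product"
    "HOL-Algebra.UnivPoly"
begin

section \<open>Commutative algebras over the complex numbers\<close>

text \<open>
  A \<open>\<complex>\<close>-algebra is a \<open>module\<close> record of HOL-Algebra with scalars in \<^typ>\<open>complex\<close>;
  the algebra axioms are those of the locale \<^locale>\<open>algebra\<close> over \<open>complex_field\<close>.
\<close>

definition complex_field :: "complex ring" where
  "complex_field = \<lparr>carrier = UNIV, mult = (*), one = 1, zero = 0, add = (+)\<rparr>"

definition calg_hom ::
    "(complex, 'a, 'm) module_scheme \<Rightarrow> (complex, 'b, 'n) module_scheme \<Rightarrow> ('a \<Rightarrow> 'b) set" where
  "calg_hom A B = {\<phi> \<in> ring_hom A B.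
     \<forall>c. \<forall>a \<in> carrier A. \<phi> (c \<odot>\<^bsub>A\<^esub> a) = c \<odot>\<^bsub>B\<^esub> \<phi> a}"

definition calg_iso ::
    "(complex, 'a, 'm) module_scheme \<Rightarrow> (complex, 'b, 'n) module_scheme \<Rightarrow> ('a \<Rightarrow> 'b) set" where
  "calg_iso A B = {\<phi> \<in> calg_hom A B. bij_betw \<phi> (carrier A) (carrier B)}"

text \<open>The quotient ring \<open>A Quot I\<close> with the scalar action \<open>c \<cdot> (I + a) = I + c \<cdot> a\<close>.\<close>

definition alg_quot ::
    "(complex, 'a, 'm) module_scheme \<Rightarrow> 'a set \<Rightarrow> (complex, 'a set) module" where
  "alg_quot A I = ring.extend (A Quot I)
     (module.fields (\<lambda>c C. \<Union>a\<in>C. I +>\<^bsub>A\<^esub> (c \<odot>\<^bsub>A\<^esub> a)))"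

primrec ideal_pow :: "('a, 'm) ring_scheme \<Rightarrow> 'a set \<Rightarrow> nat \<Rightarrow> 'a set" where
  "ideal_pow R I 0 = carrier R"
| "ideal_pow R I (Suc n) = I \<cdot>\<^bsub>R\<^esub> ideal_pow R I n"

text \<open>\<open>\<complex>[t]/(t\<^sup>n)\<close>\<close>

definition truncated_poly :: "nat \<Rightarrow> (complex, (nat \<Rightarrow> complex) set) module" where
  "truncated_poly n =
     (let Q = UP complex_field in alg_quot Q (PIdl\<^bsub>Q\<^esub> (monom Q 1 n)))"

text \<open>
  The tensor product \<open>A \<otimes> B\<close> over \<open>\<complex>\<close>: the free \<open>\<complex>\<close>-module on the set \<open>A \<times> B\<close> (finitely supported
  functions), multiplied by \<open>(a, b)(a', b') = (aa', bb')\<close>, modulo the bilinearity relations.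
  The span of these relations is stable under multiplication by basis elements, so it
  coincides with the ideal they generate.
\<close>

definition pure_tensor :: "'a \<Rightarrow> 'b \<Rightarrow> ('a \<times> 'b \<Rightarrow> complex)" where
  "pure_tensor a b = (\<lambda>z. if z = (a, b) then 1 else 0)"

definition free_product_alg ::
    "(complex, 'a, 'm) module_scheme \<Rightarrow> (complex, 'b, 'n) module_scheme
      \<Rightarrow> (complex, 'a \<times> 'b \<Rightarrow> complex) module" where
  "free_product_alg A B =
     \<lparr>carrier = {F. finite {z. F z \<noteq> 0} \<and> {z. F z \<noteq> 0} \<subseteq> carrier A \<times> carrier B},
      mult = (\<lambda>F G z. \<Sum>(a, b) \<in> {u. F u \<noteq> 0}. \<Sum>(a', b') \<in> {u. G u \<noteq> 0}.
                if (a \<otimes>\<^bsub>A\<^esub> a', b \<otimes>\<^bsub>B\<^esub> b') = z then F (a, b) * G (a', b') else 0),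
      one = pure_tensor \<one>\<^bsub>A\<^esub> \<one>\<^bsub>B\<^esub>,
      zero = (\<lambda>_. 0),
      add = (\<lambda>F G z. F z + G z),
      smult = (\<lambda>c F z. c * F z)\<rparr>"

definition tensor_relations ::
    "(complex, 'a, 'm) module_scheme \<Rightarrow> (complex, 'b, 'n) module_scheme
      \<Rightarrow> ('a \<times> 'b \<Rightarrow> complex) set" where
  "tensor_relations A B =
     {(\<lambda>z. pure_tensor (a \<oplus>\<^bsub>A\<^esub> a') b z - pure_tensor a b z - pure_tensor a' b z)
        | a a' b. a \<in> carrier A \<and> a' \<in> carrier A \<and> b \<in> carrier B}
   \<union> {(\<lambda>z. pure_tensor a (b \<oplus>\<^bsub>B\<^esub> b') z - pure_tensor a b z - pure_tensor a b' z)
        | a b b'. a \<in> carrier A \<and> b \<in> carrier B \<and> b' \<in> carrier B}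
   \<union> {(\<lambda>z. pure_tensor (c \<odot>\<^bsub>A\<^esub> a) b z - c * pure_tensor a b z)
        | c a b. a \<in> carrier A \<and> b \<in> carrier B}
   \<union> {(\<lambda>z. pure_tensor a (c \<odot>\<^bsub>B\<^esub> b) z - c * pure_tensor a b z)
        | c a b. a \<in> carrier A \<and> b \<in> carrier B}"

definition tensor_alg ::
    "(complex, 'a, 'm) module_scheme \<Rightarrow> (complex, 'b, 'n) module_scheme
      \<Rightarrow> (complex, ('a \<times> 'b \<Rightarrow> complex) set) module" where
  "tensor_alg A B =
     (let F = free_product_alg A B in alg_quot F (genideal F (tensor_relations A B)))"


section \<open>Spaces with functions\<close>

text \<open>
  Varieties over \<open>\<complex>\<close> are taken in the classical sense: topological spaces with a sheaf of
  \<open>\<complex>\<close>-valued functions that are locally isomorphic to affine algebraic sets. As \<open>\<complex>\<close> is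
  algebraically closed, this is the category of reduced separated schemes of finite type
  over \<open>\<complex>\<close>, and the points of the space are the closed points of the scheme.
  A section over \<open>U\<close> is a function that is \<^const>\<open>undefined\<close> outside \<open>U\<close>.
\<close>

record 'p fun_space =
  top_of :: "'p topology"
  reg :: "'p set \<Rightarrow> ('p \<Rightarrow> complex) set"

definition space_with_functions :: "'p fun_space \<Rightarrow> bool" where
  "space_with_functions X \<longleftrightarrow>
     (\<forall>U. openin (top_of X) U \<longrightarrow>
        reg X U \<subseteq> extensional U
      \<and> (\<forall>c. (\<lambda>x\<in>U. c) \<in> reg X U)
      \<and> (\<forall>f \<in> reg X U. \<forall>g \<in> reg X U. (\<lambda>x\<in>U. f x + g x) \<in> reg X U)
      \<and> (\<forall>f \<in> reg X U. \<forall>g \<in> reg X U. (\<lambda>x\<in>U. f x * g x) \<in> reg X U)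
      \<and> (\<forall>V f. openin (top_of X) V \<and> V \<subseteq> U \<and> f \<in> reg X U \<longrightarrow> restrict f V \<in> reg X V)
      \<and> (\<forall>f \<in> extensional U.
           (\<forall>x \<in> U. \<exists>V. openin (top_of X) V \<and> x \<in> V \<and> V \<subseteq> U \<and> restrict f V \<in> reg X V)
             \<longrightarrow> f \<in> reg X U))"

definition fs_morphism :: "'p fun_space \<Rightarrow> 'q fun_space \<Rightarrow> ('p \<Rightarrow> 'q) \<Rightarrow> bool" where
  "fs_morphism X Z \<phi> \<longleftrightarrow>
     continuous_map (top_of X) (top_of Z) \<phi>
   \<and> (\<forall>V f. openin (top_of Z) V \<and> f \<in> reg Z V \<longrightarrow>
        (\<lambda>x \<in> {x \<in> topspace (top_of X). \<phi> x \<in> V}. f (\<phi> x))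
          \<in> reg X {x \<in> topspace (top_of X). \<phi> x \<in> V})"

definition fs_isomorphism :: "'p fun_space \<Rightarrow> 'q fun_space \<Rightarrow> ('p \<Rightarrow> 'q) \<Rightarrow> bool" where
  "fs_isomorphism X Z \<phi> \<longleftrightarrow>
     fs_morphism X Z \<phi>
   \<and> (\<exists>\<psi>. fs_morphism Z X \<psi>
        \<and> (\<forall>x \<in> topspace (top_of X). \<psi> (\<phi> x) = x)
        \<and> (\<forall>z \<in> topspace (top_of Z). \<phi> (\<psi> z) = z))"

text \<open>
  The structure induced on a subset: sections are locally restrictions of sections of \<open>X\<close>.
  For open \<open>S\<close> this is the restricted sheaf, for closed \<open>S\<close> the reduced closed subvariety.
\<close>

definition induced :: "'p fun_space \<Rightarrow> 'p set \<Rightarrow> 'p fun_space" where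
  "induced X S =
     \<lparr>top_of = subtopology (top_of X) S,
      reg = (\<lambda>V. {f \<in> extensional V. \<forall>x \<in> V. \<exists>U. openin (top_of X) U \<and> x \<in> U \<and> U \<inter> S \<subseteq> V
                   \<and> (\<exists>g \<in> reg X U. \<forall>y \<in> U \<inter> S. f y = g y)})\<rparr>"


section \<open>Affine algebraic sets\<close>

definition affine_points :: "nat \<Rightarrow> (nat \<Rightarrow> complex) set" where
  "affine_points N = {..<N} \<rightarrow>\<^sub>E UNIV"

text \<open>The ring \<open>\<complex>[x\<^sub>0, \<dots>, x\<^bsub>N-1\<^esub>]\<close>, as the ring of polynomial functions.\<close>

inductive_set poly_fun :: "nat \<Rightarrow> ((nat \<Rightarrow> complex) \<Rightarrow> complex) set" for N :: nat where
  const: "(\<lambda>_. c) \<in> poly_fun N"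
| coord: "i < N \<Longrightarrow> (\<lambda>x. x i) \<in> poly_fun N"
| add: "p \<in> poly_fun N \<Longrightarrow> q \<in> poly_fun N \<Longrightarrow> (\<lambda>x. p x + q x) \<in> poly_fun N"
| mult: "p \<in> poly_fun N \<Longrightarrow> q \<in> poly_fun N \<Longrightarrow> (\<lambda>x. p x * q x) \<in> poly_fun N"

definition partial_deriv ::
    "nat \<Rightarrow> ((nat \<Rightarrow> complex) \<Rightarrow> complex) \<Rightarrow> (nat \<Rightarrow> complex) \<Rightarrow> complex" where
  "partial_deriv i p x = deriv (\<lambda>z. p (x(i := z))) (x i)"

definition zeros :: "nat \<Rightarrow> ((nat \<Rightarrow> complex) \<Rightarrow> complex) set \<Rightarrow> (nat \<Rightarrow> complex) set" where
  "zeros N S = {x \<in> affine_points N. \<forall>p \<in> S. p x = 0}"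

definition algebraic_set :: "nat \<Rightarrow> (nat \<Rightarrow> complex) set \<Rightarrow> bool" where
  "algebraic_set N Z \<longleftrightarrow> (\<exists>S \<subseteq> poly_fun N. Z = zeros N S)"

definition vanishing_ideal ::
    "nat \<Rightarrow> (nat \<Rightarrow> complex) set \<Rightarrow> ((nat \<Rightarrow> complex) \<Rightarrow> complex) set" where
  "vanishing_ideal N Z = {p \<in> poly_fun N. \<forall>x \<in> Z. p x = 0}"

definition zariski :: "nat \<Rightarrow> (nat \<Rightarrow> complex) topology" where
  "zariski N = topology (\<lambda>U. \<exists>Z. algebraic_set N Z \<and> U = affine_points N - Z)"

lemma openin_zariski:
  "openin (zariski N) U \<longleftrightarrow> (\<exists>Z. algebraic_set N Z \<and> U = affine_points N - Z)"
proof -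
  have inter: "\<exists>Z. algebraic_set N Z \<and> (affine_points N - A) \<inter> (affine_points N - B) = affine_points N - Z"
    if A: "algebraic_set N A" and B: "algebraic_set N B" for A B
  proof -
    obtain S where S: "S \<subseteq> poly_fun N" "A = zeros N S"
      using A unfolding algebraic_set_def by blast
    obtain T where T: "T \<subseteq> poly_fun N" "B = zeros N T"
      using B unfolding algebraic_set_def by blast
    define W where "W = (\<lambda>(p, q) x. p x * q x) ` (S \<times> T)"
    have "W \<subseteq> poly_fun N" using S(1) T(1) by (auto simp: W_def intro!: poly_fun.mult)
    then have alg: "algebraic_set N (zeros N W)" unfolding algebraic_set_def by blast
    have "(\<forall>w\<in>W. w x = 0) \<longleftrightarrow> (\<forall>p\<in>S. p x = 0) \<or> (\<forall>q\<in>T. q x = 0)" for x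
      unfolding W_def by auto
    then have eq: "zeros N W = A \<union> B" unfolding S(2) T(2) zeros_def by blast
    show ?thesis using alg unfolding eq by (intro exI[of _ "A \<union> B"] conjI) blast+
  qed
  have union: "\<exists>Z. algebraic_set N Z \<and> \<Union>K = affine_points N - Z"
    if H: "\<forall>U\<in>K. \<exists>Z. algebraic_set N Z \<and> U = affine_points N - Z" for K
  proof -
    have "\<forall>U\<in>K. \<exists>S. S \<subseteq> poly_fun N \<and> U = affine_points N - zeros N S"
      using H unfolding algebraic_set_def by blast
    then obtain S where S: "\<And>U. U \<in> K \<Longrightarrow> S U \<subseteq> poly_fun N"
        "\<And>U. U \<in> K \<Longrightarrow> U = affine_points N - zeros N (S U)"
      by (auto dest!: bchoice)
    have "x \<in> \<Union>K \<longleftrightarrow> x \<in> affine_points N - zeros N (\<Union>U\<in>K. S U)" for x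
    proof -
      have "x \<in> \<Union>K \<longleftrightarrow> (\<exists>U\<in>K. x \<in> affine_points N - zeros N (S U))"
        using S(2) by blast
      also have "\<dots> \<longleftrightarrow> x \<in> affine_points N - zeros N (\<Union>U\<in>K. S U)"
        unfolding zeros_def by auto
      finally show ?thesis .
    qed
    then have "\<Union>K = affine_points N - zeros N (\<Union>U\<in>K. S U)" by blast
    moreover have "algebraic_set N (zeros N (\<Union>U\<in>K. S U))"
      unfolding algebraic_set_def by (intro exI[of _ "\<Union>U\<in>K. S U"] conjI refl UN_least S(1))
    ultimately show ?thesis by (intro exI conjI)
  qed
  have "istopology (\<lambda>U. \<exists>Z. algebraic_set N Z \<and> U = affine_points N - Z)"
    unfolding istopology_def
  proof (intro conjI allI impI)
    fix K assume "\<forall>U\<in>K. \<exists>Z. algebraic_set N Z \<and> U = affine_points N - Z"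
    then show "\<exists>Z. algebraic_set N Z \<and> \<Union>K = affine_points N - Z" by (rule union)
  next
    fix U V
    assume "\<exists>Z. algebraic_set N Z \<and> U = affine_points N - Z"
      and "\<exists>Z. algebraic_set N Z \<and> V = affine_points N - Z"
    then show "\<exists>Z. algebraic_set N Z \<and> U \<inter> V = affine_points N - Z"
      by (elim exE conjE) (simp only: inter)
  qed
  then show ?thesis unfolding zariski_def by (simp add: topology_inverse')
qed

definition affine_variety :: "nat \<Rightarrow> (nat \<Rightarrow> complex) set \<Rightarrow> (nat \<Rightarrow> complex) fun_space" where
  "affine_variety N Z =
     \<lparr>top_of = subtopology (zariski N) Z,
      reg = (\<lambda>U. {f \<in> extensional U. \<forall>x \<in> U. \<exists>V. openin (subtopology (zariski N) Z) V
                   \<and> x \<in> V \<and> V \<subseteq> U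
                   \<and> (\<exists>p \<in> poly_fun N. \<exists>q \<in> poly_fun N. \<forall>y \<in> V. q y \<noteq> 0 \<and> f y = p y / q y)})\<rparr>"


section \<open>Varieties\<close>

definition affine_chart ::
    "'p fun_space \<Rightarrow> 'p set \<Rightarrow> nat \<Rightarrow> (nat \<Rightarrow> complex) set \<Rightarrow> ('p \<Rightarrow> nat \<Rightarrow> complex) \<Rightarrow> bool" where
  "affine_chart X U N Z \<phi> \<longleftrightarrow>
     openin (top_of X) U \<and> algebraic_set N Z
   \<and> fs_isomorphism (induced X U) (affine_variety N Z) \<phi>"

definition prevariety :: "'p fun_space \<Rightarrow> bool" where
  "prevariety X \<longleftrightarrow>
     space_with_functions X
   \<and> (\<exists>\<U>. finite \<U> \<and> \<Union>\<U> = topspace (top_of X) \<and> (\<forall>U \<in> \<U>. \<exists>N Z \<phi>. affine_chart X U N Z \<phi>))"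

text \<open>
  Separatedness: two morphisms into \<open>X\<close> agree on a closed set. Closedness being local on the
  source, it suffices to test affine sources.
\<close>

definition separated :: "'p fun_space \<Rightarrow> bool" where
  "separated X \<longleftrightarrow>
     (\<forall>N Z \<phi> \<psi>. algebraic_set N Z
        \<and> fs_morphism (affine_variety N Z) X \<phi> \<and> fs_morphism (affine_variety N Z) X \<psi>
        \<longrightarrow> closedin (top_of (affine_variety N Z)) {z \<in> Z. \<phi> z = \<psi> z})"

definition variety :: "'p fun_space \<Rightarrow> bool" where
  "variety X \<longleftrightarrow> prevariety X \<and> separated X"

definition irreducible_variety :: "'p fun_space \<Rightarrow> bool" where
  "irreducible_variety X \<longleftrightarrow>
     variety X \<and> topspace (top_of X) \<noteq> {}
   \<and> (\<forall>A B. closedin (top_of X) A \<and> closedin (top_of X) B \<and> A \<union> B = topspace (top_of X)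
        \<longrightarrow> A = topspace (top_of X) \<or> B = topspace (top_of X))"

text \<open>
  Smoothness over \<open>\<complex>\<close> in its Jacobian form (Mumford, Red Book, III.10; Bosch, Luetkebohmert,
  Raynaud, Neron Models, 2.2): near the image of \<open>P\<close> in an affine chart \<open>Z \<subseteq> \<complex>\<^sup>N\<close> the ideal of
  \<open>Z\<close> is generated by polynomials \<open>g\<^sub>0, \<dots>, g\<^bsub>c-1\<^esub>\<close> whose differentials at that point are linearly
  independent; \<open>h\<close> below is the denominator in \<open>p = \<Sum>\<^sub>k (a\<^sub>k / h) g\<^sub>k\<close>.
\<close>

definition smooth_at :: "'p fun_space \<Rightarrow> 'p \<Rightarrow> bool" where
  "smooth_at X P \<longleftrightarrow>
     (\<exists>U N Z \<phi> (c::nat) g. affine_chart X U N Z \<phi> \<and> P \<in> U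
      \<and> (\<forall>k<c. g k \<in> vanishing_ideal N Z)
      \<and> (\<forall>p \<in> vanishing_ideal N Z. \<exists>h \<in> poly_fun N. h (\<phi> P) \<noteq> 0
           \<and> (\<exists>a. (\<forall>k<c. a k \<in> poly_fun N) \<and> (\<forall>x. h x * p x = (\<Sum>k<c. a k x * g k x))))
      \<and> (\<forall>l. (\<forall>i<N. (\<Sum>k<c. l k * partial_deriv i (g k) (\<phi> P)) = 0) \<longrightarrow> (\<forall>k<c. l k = 0)))"

definition smooth :: "'p fun_space \<Rightarrow> bool" where
  "smooth X \<longleftrightarrow> (\<forall>P \<in> topspace (top_of X). smooth_at X P)"


section \<open>Local rings, hypersurfaces and multiple structures\<close>

definition germ :: "'p fun_space \<Rightarrow> 'p \<Rightarrow> 'p set \<Rightarrow> ('p \<Rightarrow> complex) \<Rightarrow> ('p set \<times> ('p \<Rightarrow> complex)) set"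
  where
  "germ X P U f =
     {(V, g). openin (top_of X) V \<and> P \<in> V \<and> g \<in> reg X V
        \<and> (\<exists>W. openin (top_of X) W \<and> P \<in> W \<and> W \<subseteq> U \<inter> V \<and> (\<forall>x \<in> W. f x = g x))}"

definition stalk ::
    "'p fun_space \<Rightarrow> 'p \<Rightarrow> (complex, ('p set \<times> ('p \<Rightarrow> complex)) set) module" where
  "stalk X P =
     \<lparr>carrier = {germ X P U f | U f. openin (top_of X) U \<and> P \<in> U \<and> f \<in> reg X U},
      mult = (\<lambda>a b. \<Union>(U, f)\<in>a. \<Union>(V, g)\<in>b. germ X P (U \<inter> V) (\<lambda>x\<in>U \<inter> V. f x * g x)),
      one = germ X P (topspace (top_of X)) (\<lambda>x\<in>topspace (top_of X). 1),
      zero = germ X P (topspace (top_of X)) (\<lambda>x\<in>topspace (top_of X). 0),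
      add = (\<lambda>a b. \<Union>(U, f)\<in>a. \<Union>(V, g)\<in>b. germ X P (U \<inter> V) (\<lambda>x\<in>U \<inter> V. f x + g x)),
      smult = (\<lambda>c a. \<Union>(U, f)\<in>a. germ X P U (\<lambda>x\<in>U. c * f x))\<rparr>"

definition ideal_sheaf :: "'p fun_space \<Rightarrow> 'p set \<Rightarrow> 'p set \<Rightarrow> ('p \<Rightarrow> complex) set" where
  "ideal_sheaf X Y U = {f \<in> reg X U. \<forall>x \<in> U \<inter> Y. f x = 0}"

definition ideal_stalk ::
    "'p fun_space \<Rightarrow> 'p set \<Rightarrow> 'p \<Rightarrow> ('p set \<times> ('p \<Rightarrow> complex)) set set" where
  "ideal_stalk X Y P =
     {germ X P U f | U f. openin (top_of X) U \<and> P \<in> U \<and> f \<in> ideal_sheaf X Y U}"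

text \<open>
  A hypersurface of the irreducible variety \<open>X\<close> is a closed subset whose ideal sheaf is generated,
  at each of its points, by a nonzero germ (a local equation). Since \<open>X\<close> is irreducible, its
  local rings are integral domains, so this is an effective Cartier divisor with reduced
  structure; on smooth \<open>X\<close> these are the closed subsets of pure codimension one.
\<close>

definition hypersurface :: "'p fun_space \<Rightarrow> 'p set \<Rightarrow> bool" where
  "hypersurface X Y \<longleftrightarrow>
     closedin (top_of X) Y
   \<and> (\<forall>Q \<in> Y. \<exists>f \<in> carrier (stalk X Q). f \<noteq> \<zero>\<^bsub>stalk X Q\<^esub>
                 \<and> ideal_stalk X Y Q = PIdl\<^bsub>stalk X Q\<^esub> f)"

definition smooth_hypersurface :: "'p fun_space \<Rightarrow> 'p set \<Rightarrow> bool" where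
  "smooth_hypersurface X Y \<longleftrightarrow> hypersurface X Y \<and> smooth (induced X Y)"

text \<open>
  The structure sheaf of \<open>Y\<^sub>n\<close> is the quotient of that of \<open>X\<close> by the \<open>n\<close>-th power of the ideal
  sheaf of \<open>Y\<close>; forming stalks commutes with quotients and with powers of ideals. The local ring
  of \<open>Y\<close> itself is likewise the quotient by the stalk of its ideal sheaf.
\<close>

definition multiple_stalk ::
    "'p fun_space \<Rightarrow> 'p set \<Rightarrow> nat \<Rightarrow> 'p \<Rightarrow> (complex, ('p set \<times> ('p \<Rightarrow> complex)) set set) module"
  where
  "multiple_stalk X Y n P = alg_quot (stalk X P) (ideal_pow (stalk X P) (ideal_stalk X Y P) n)"

definition hypersurface_stalk ::
    "'p fun_space \<Rightarrow> 'p set \<Rightarrow> 'p \<Rightarrow> (complex, ('p set \<times> ('p \<Rightarrow> complex)) set set) module"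
  where
  "hypersurface_stalk X Y P = alg_quot (stalk X P) (ideal_stalk X Y P)"

text \<open>Sends the class of a germ modulo \<open>I\<^sup>n\<close> to its class modulo \<open>I\<close>.\<close>

definition restriction_map ::
    "'p fun_space \<Rightarrow> 'p set \<Rightarrow> 'p \<Rightarrow> ('p set \<times> ('p \<Rightarrow> complex)) set set
      \<Rightarrow> ('p set \<times> ('p \<Rightarrow> complex)) set set" where
  "restriction_map X Y P C = ideal_stalk X Y P <+>\<^bsub>stalk X P\<^esub> C"

end

theory Submission
  imports Defs
begin

text \<open>
  Choose an affine chart of \<open>Y\<close> in which \<open>Y\<close> is cut out near \<open>P\<close> by polynomials \<open>g\<^sub>k\<close> with
  independent differentials, and extend its coordinates to functions \<open>u\<^sub>i\<close> regular on \<open>X\<close> near \<open>P\<close>.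
  Then \<open>g\<^sub>k(u)\<close> vanishes on \<open>Y\<close>, hence is divisible by the local equation \<open>e\<close>, and Newton
  iteration modifies \<open>u\<close> by multiples of \<open>e\<close> until \<open>g\<^sub>k(u)\<close> is divisible by \<open>e\<^sup>n\<close>. The fractions
  \<open>p(u) / q(u)\<close> with \<open>q(u(P)) \<noteq> 0\<close> form a subalgebra \<open>S\<close> of the local ring \<open>A\<close> of \<open>X\<close> at \<open>P\<close> with
  \<open>S + eA = A\<close> and \<open>S \<inter> eA \<subseteq> e\<^sup>nA\<close>, so that \<open>S\<close> maps onto a copy of \<open>A/eA\<close> inside \<open>A/e\<^sup>nA\<close>. As
  \<open>e\<close> is not a zero divisor, each element of \<open>A/e\<^sup>nA\<close> is a sum \<open>\<Sum>i<n. s\<^sub>i e\<^sup>i\<close> with \<open>s\<^sub>i \<in> S\<close> unique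
  modulo \<open>e\<close>, which is the tensor decomposition.
\<close>

section \<open>Polynomial functions\<close>

text \<open>The subalgebra \<open>S\<close> has to depend on \<open>n\<close>. A section of the map
  from the local ring of \<open>X\<close> at \<open>P\<close> to that of \<open>Y\<close> would be a
  rational retraction of \<open>X\<close> onto \<open>Y\<close>, and for an elliptic curve in the
  projective plane there is none, every rational map from the plane to it being constant. So
  \<open>S\<close> cannot be asked to meet the ideal of \<open>Y\<close> in zero, only in multiples
  of \<open>e^n\<close>, and the functions \<open>u\<close> do not map into the affine model
  \<open>Z\<close> of \<open>Y\<close>. That a polynomial \<open>p\<close> vanishes on
  \<open>Z\<close> therefore says nothing directly about \<open>p(u)\<close>. What can be
  transported are identities between polynomials on the whole of affine space: the Jacobian form of
  smoothness writes \<open>h p\<close> as a combination of the \<open>g_k\<close> with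
  \<open>h\<close> nonzero at the point, and substituting \<open>u\<close> makes \<open>p(u)\<close>
  a multiple of \<open>e^n\<close>. The same independent differentials supply the right inverse that
  Newton's method requires. That \<open>e\<close> is not a zero divisor comes from the
  irreducibility of \<open>X\<close>.\<close>

locale function_algebra =
  fixes A :: "('p \<Rightarrow> complex) set"
  assumes const [simp, intro]: "(\<lambda>_. c) \<in> A"
    and add [intro]: "f \<in> A \<Longrightarrow> g \<in> A \<Longrightarrow> (\<lambda>x. f x + g x) \<in> A"
    and mult [intro]: "f \<in> A \<Longrightarrow> g \<in> A \<Longrightarrow> (\<lambda>x. f x * g x) \<in> A"
begin

lemma uminus [intro]: "f \<in> A \<Longrightarrow> (\<lambda>x. - f x) \<in> A"
  using mult[OF const[of "-1"]] by simp

lemma diff [intro]: "f \<in> A \<Longrightarrow> g \<in> A \<Longrightarrow> (\<lambda>x. f x - g x) \<in> A"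
  using add[OF _ uminus, of f g] by simp

lemma power [intro]: "f \<in> A \<Longrightarrow> (\<lambda>x. f x ^ n) \<in> A"
  by (induction n) auto

lemma sum [intro]: "(\<And>i. i \<in> I \<Longrightarrow> f i \<in> A) \<Longrightarrow> (\<lambda>x. \<Sum>i\<in>I. f i x) \<in> A"
  by (induction I rule: infinite_finite_induct) auto

text \<open>Substitution and the Taylor formula below are wanted for the functions regular near
  \<open>P\<close>, the closure rules also for the polynomials; hence the common locale. A
  point-valued map \<open>s\<close> is given by its coordinates below \<open>N\<close>, the only
  ones that a member of \<open>poly_fun N\<close> reads.\<close>

lemma poly_fun_comp:
  assumes "p \<in> poly_fun N" and "\<And>i. i < N \<Longrightarrow> (\<lambda>x. s x i) \<in> A"
  shows "(\<lambda>x. p (s x)) \<in> A"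
  using assms(1) by induction (auto intro: assms(2))

end

interpretation poly_functions: function_algebra "poly_fun N"
  by unfold_locales (auto intro: poly_fun.intros)

lemma poly_fun_cong:
  assumes "p \<in> poly_fun N" and "\<And>i. i < N \<Longrightarrow> x i = y i"
  shows "p x = p y"
  using assms(1) by induction (auto simp: assms(2))

text \<open>The sum and product rules for \<open>deriv\<close> presuppose differentiability, so it
  is established once for all coordinate lines. The coordinate case splits because along such a line
  the other coordinates are constant.\<close>

lemma poly_fun_field_differentiable:
  assumes "p \<in> poly_fun N"
  shows "(\<lambda>z. p (x(i := z))) field_differentiable (at z)"
  using assms
proof induction
  case (coord j)
  then show ?case by (cases "j = i") auto
qed (auto intro: field_differentiable_add field_differentiable_mult)

section \<open>Partial derivatives and the second-order Taylor formula\<close>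

lemma partial_deriv_const: "partial_deriv i (\<lambda>_. c) = (\<lambda>_. 0)"
  by (simp add: partial_deriv_def fun_eq_iff)

lemma partial_deriv_coord: "partial_deriv i (\<lambda>x. x j) = (\<lambda>_. if i = j then 1 else 0)"
  by (auto simp: partial_deriv_def fun_eq_iff)

lemma partial_deriv_add:
  assumes "p \<in> poly_fun N" "q \<in> poly_fun N"
  shows "partial_deriv i (\<lambda>x. p x + q x) = (\<lambda>x. partial_deriv i p x + partial_deriv i q x)"
  unfolding partial_deriv_def
  by (intro ext deriv_add poly_fun_field_differentiable[OF assms(1)]
        poly_fun_field_differentiable[OF assms(2)])

lemma partial_deriv_mult:
  assumes "p \<in> poly_fun N" "q \<in> poly_fun N"
  shows "partial_deriv i (\<lambda>x. p x * q x) =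
    (\<lambda>x. p x * partial_deriv i q x + partial_deriv i p x * q x)"
  unfolding partial_deriv_def
  by (intro ext, subst deriv_mult[OF poly_fun_field_differentiable[OF assms(1)]
        poly_fun_field_differentiable[OF assms(2)]]) simp

lemma partial_deriv_poly_fun:
  assumes "p \<in> poly_fun N"
  shows "partial_deriv i p \<in> poly_fun N"
  using assms
  by induction (auto simp: partial_deriv_const partial_deriv_coord partial_deriv_add
      partial_deriv_mult)

text \<open>Structural induction on \<open>p\<close> replaces analysis because the remainder has to
  be an element of \<open>A\<close> again, and \<open>A\<close> admits no division by the square of
  \<open>\<epsilon>\<close>.\<close>

lemma (in function_algebra) poly_fun_taylor:
  assumes "p \<in> poly_fun N"
    and s: "\<And>i. i < N \<Longrightarrow> (\<lambda>x. s x i) \<in> A"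
    and r: "\<And>i. i < N \<Longrightarrow> (\<lambda>x. r x i) \<in> A"
    and \<epsilon>: "\<epsilon> \<in> A"
  shows "\<exists>R\<in>A. \<forall>x. p (\<lambda>i. s x i + \<epsilon> x * r x i) =
    p (s x) + \<epsilon> x * (\<Sum>i<N. partial_deriv i p (s x) * r x i) + (\<epsilon> x)\<^sup>2 * R x"
  using assms(1)
proof induction
  case (const c)
  show ?case by (rule bexI[of _ "\<lambda>_. 0"]) (auto simp: partial_deriv_const)
next
  case (coord j)
  have "(\<Sum>i<N. (if i = j then 1 else 0) * r x i) = r x j" for x
    using coord by (subst sum.remove[of _ j]) auto
  then show ?case by (intro bexI[of _ "\<lambda>_. 0"]) (auto simp: partial_deriv_coord)
next
  case (add p q)
  then obtain R S where "R \<in> A" "S \<in> A"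
    "\<And>x. p (\<lambda>i. s x i + \<epsilon> x * r x i) =
      p (s x) + \<epsilon> x * (\<Sum>i<N. partial_deriv i p (s x) * r x i) + (\<epsilon> x)\<^sup>2 * R x"
    "\<And>x. q (\<lambda>i. s x i + \<epsilon> x * r x i) =
      q (s x) + \<epsilon> x * (\<Sum>i<N. partial_deriv i q (s x) * r x i) + (\<epsilon> x)\<^sup>2 * S x"
    by auto
  then show ?case
    using add.hyps
    by (intro bexI[of _ "\<lambda>x. R x + S x"])
      (auto simp: partial_deriv_add algebra_simps sum.distrib)
next
  case (mult p q)
  then obtain R S where RS: "R \<in> A" "S \<in> A"
    and p: "\<And>x. p (\<lambda>i. s x i + \<epsilon> x * r x i) =
      p (s x) + \<epsilon> x * (\<Sum>i<N. partial_deriv i p (s x) * r x i) + (\<epsilon> x)\<^sup>2 * R x"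
    and q: "\<And>x. q (\<lambda>i. s x i + \<epsilon> x * r x i) =
      q (s x) + \<epsilon> x * (\<Sum>i<N. partial_deriv i q (s x) * r x i) + (\<epsilon> x)\<^sup>2 * S x"
    by auto
  define D where "D p x = (\<Sum>i<N. partial_deriv i p (s x) * r x i)" for p x
  have D: "D p \<in> A" if "p \<in> poly_fun N" for p
    unfolding D_def
    by (intro sum function_algebra.mult[OF function_algebra_axioms]
        poly_fun_comp[OF partial_deriv_poly_fun[OF that] s]) (auto intro: r)
  have Dmult: "D (\<lambda>x. p x * q x) x = p (s x) * D q x + D p x * q (s x)" for x
    using mult.hyps
    by (simp add: D_def partial_deriv_mult sum.distrib sum_distrib_left sum_distrib_right
        algebra_simps)
  have ps: "(\<lambda>x. p (s x)) \<in> A" "(\<lambda>x. q (s x)) \<in> A"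
    by (rule poly_fun_comp[OF mult.hyps(1) s] poly_fun_comp[OF mult.hyps(2) s]; assumption)+
  \<comment> \<open>The witness is what remains of the product of the two expansions beyond first
    order, divided by the square of \<open>\<epsilon>\<close>: the terms of order three and four
    stay inside it with one and two factors \<open>\<epsilon>\<close>.\<close>
  show ?case
    unfolding p q D_def[symmetric] Dmult
  proof (rule bexI[of _ "\<lambda>x. D p x * D q x + p (s x) * S x + q (s x) * R x
        + \<epsilon> x * (D p x * S x + D q x * R x) + \<epsilon> x * \<epsilon> x * (R x * S x)"])
    show "(\<lambda>x. D p x * D q x + p (s x) * S x + q (s x) * R x
        + \<epsilon> x * (D p x * S x + D q x * R x) + \<epsilon> x * \<epsilon> x * (R x * S x)) \<in> A"
      by (intro add function_algebra.mult[OF function_algebra_axioms] D RS \<epsilon> ps mult.hyps)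
  qed (simp add: algebra_simps power2_eq_square)
qed

text \<open>
  Induction on the number of rows: \<open>w\<close> is the new row made orthogonal to the columns found so far,
  and \<open>u\<close> is a unit vector made orthogonal to the old rows; denominators are collected in \<open>d\<close>.
\<close>

lemma poly_fun_right_inverse:
  fixes v :: "nat \<Rightarrow> nat \<Rightarrow> (nat \<Rightarrow> complex) \<Rightarrow> complex"
  assumes "\<And>k i. k < c \<Longrightarrow> i < N \<Longrightarrow> v k i \<in> poly_fun N"
    and "\<And>l. \<forall>i<N. (\<Sum>k<c. l k * v k i z) = 0 \<Longrightarrow> \<forall>k<c. l k = 0"
  shows "\<exists>M d. d \<in> poly_fun N \<and> d z \<noteq> 0 \<and> (\<forall>i<N. \<forall>l<c. M i l \<in> poly_fun N)
    \<and> (\<forall>x. \<forall>k<c. \<forall>l<c. (\<Sum>i<N. v k i x * M i l x) = (if k = l then d x else 0))"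
  using assms
proof (induction c)
  case 0
  show ?case by (rule exI, rule exI[of _ "\<lambda>_. 1"]) auto
next
  case (Suc c)
  \<comment> \<open>A relation among the old rows is a relation among all rows with coefficient 0 at
    the new one.\<close>
  have indep: "\<forall>k<c. l k = 0" if "\<forall>i<N. (\<Sum>k<c. l k * v k i z) = 0" for l
    using Suc.prems(2)[of "l(c := 0)"] that
    by (auto simp: less_Suc_eq split: if_splits)
  have "\<exists>M d. d \<in> poly_fun N \<and> d z \<noteq> 0 \<and> (\<forall>i<N. \<forall>l<c. M i l \<in> poly_fun N)
    \<and> (\<forall>x. \<forall>k<c. \<forall>l<c. (\<Sum>i<N. v k i x * M i l x) = (if k = l then d x else 0))"
  proof (rule Suc.IH)
    show "v k i \<in> poly_fun N" if "k < c" "i < N" for k i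
      using Suc.prems(1) that by simp
    show "\<forall>k<c. l k = 0" if "\<forall>i<N. (\<Sum>k<c. l k * v k i z) = 0" for l
      using indep that by simp
  qed
  then obtain M d where Md:
    "d \<in> poly_fun N \<and> d z \<noteq> 0 \<and> (\<forall>i<N. \<forall>l<c. M i l \<in> poly_fun N)
    \<and> (\<forall>x. \<forall>k<c. \<forall>l<c. (\<Sum>i<N. v k i x * M i l x) = (if k = l then d x else 0))"
    by (elim exE)
  then have d: "d \<in> poly_fun N" "d z \<noteq> 0"
    and M: "\<And>i l. i < N \<Longrightarrow> l < c \<Longrightarrow> M i l \<in> poly_fun N"
    by blast+
  have inv: "(\<Sum>i<N. v k i x * M i l x) = (if k = l then d x else 0)"
    if "k < c" "l < c" for x k l
    using Md that by simp
  define t where "t l x = (\<Sum>i<N. v c i x * M i l x)" for l x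
  define w where "w i x = d x * v c i x - (\<Sum>l<c. t l x * v l i x)" for i x
  have t: "t l \<in> poly_fun N" if "l < c" for l
    unfolding t_def using that
    by (intro poly_functions.sum poly_functions.mult Suc.prems(1) M) auto
  have w: "w i \<in> poly_fun N" if "i < N" for i
    unfolding w_def using that
    by (intro poly_functions.diff poly_functions.sum poly_functions.mult Suc.prems(1) t d) auto
  \<comment> \<open>If \<open>w\<close> vanished at \<open>z\<close>, its definition would be a
    relation among the rows at \<open>z\<close> with coefficient \<open>d z\<close> at the new row,
    contradicting independence because \<open>d z\<close> is nonzero.\<close>
  have "\<exists>i<N. w i z \<noteq> 0"
  proof (rule ccontr)
    assume "\<not> ?thesis"
    then have "\<forall>i<N. (\<Sum>k<Suc c. ((\<lambda>k. - t k z)(c := d z)) k * v k i z) = 0"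
      by (auto simp: w_def sum_negf)
    from Suc.prems(2)[OF this] d show False by auto
  qed
  then obtain j where j: "j < N" "w j z \<noteq> 0" by auto
  define u where "u i x = (if i = j then d x else 0) - (\<Sum>l<c. v l j x * M i l x)" for i x
  have u: "u i \<in> poly_fun N" if "i < N" for i
  proof -
    have "(\<lambda>x. if i = j then d x else 0) \<in> poly_fun N"
      using d by (cases "i = j") auto
    then show ?thesis
      unfolding u_def using that j
      by (intro poly_functions.diff poly_functions.sum poly_functions.mult Suc.prems(1) M) auto
  qed
  have dot_u: "(\<Sum>i<N. v k i x * u i x) =
      v k j x * d x - (\<Sum>l<c. v l j x * (\<Sum>i<N. v k i x * M i l x))" for k x
  proof -
    have "(\<Sum>i<N. v k i x * (if i = j then d x else 0)) = v k j x * d x"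
      using j by (subst sum.remove[of _ j]) auto
    moreover have "(\<Sum>i<N. v k i x * (\<Sum>l<c. v l j x * M i l x)) =
        (\<Sum>l<c. v l j x * (\<Sum>i<N. v k i x * M i l x))"
      unfolding sum_distrib_left by (subst sum.swap) (simp add: algebra_simps)
    ultimately show ?thesis
      by (simp add: u_def right_diff_distrib sum_subtractf)
  qed
  have dot_u0: "(\<Sum>i<N. v k i x * u i x) = 0" if "k < c" for k x
  proof -
    have "(\<Sum>l<c. v l j x * (\<Sum>i<N. v k i x * M i l x)) =
        (\<Sum>l<c. if l = k then v l j x * d x else 0)"
      by (rule sum.cong) (use inv that in auto)
    then show ?thesis unfolding dot_u using that by simp
  qed
  have dot_uc: "(\<Sum>i<N. v c i x * u i x) = w j x" for x
    unfolding dot_u w_def t_def[symmetric] by (simp add: mult.commute)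
  \<comment> \<open>Column \<open>c\<close> is \<open>d\<close> times \<open>u\<close>; the old
    columns are scaled by \<open>w j\<close> and lose \<open>t l\<close> times \<open>u\<close>,
    which cancels their product with the new row. All diagonal products become \<open>d\<close>
    times \<open>w j\<close>, the new denominator.\<close>
  define M' where "M' i l = (\<lambda>x. if l = c then d x * u i x else w j x * M i l x - t l x * u i x)"
    for i l
  have "(\<Sum>i<N. v k i x * M' i l x) = (if k = l then d x * w j x else 0)"
    if "k < Suc c" "l < Suc c" for x k l
  proof (cases "l = c")
    case True
    have "(\<Sum>i<N. v k i x * M' i l x) = d x * (\<Sum>i<N. v k i x * u i x)"
      by (simp add: M'_def True sum_distrib_left algebra_simps)
    then show ?thesis using that True by (cases "k = c") (auto simp: dot_u0 dot_uc)
  next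
    case False
    have "(\<Sum>i<N. v k i x * M' i l x) =
        w j x * (\<Sum>i<N. v k i x * M i l x) - t l x * (\<Sum>i<N. v k i x * u i x)"
      by (simp add: M'_def False sum_distrib_left sum_subtractf algebra_simps)
    then show ?thesis using that False
      by (cases "k = c") (auto simp: dot_u0 dot_uc inv t_def[symmetric])
  qed
  moreover have "M' i l \<in> poly_fun N" if "i < N" "l < Suc c" for i l
  proof (cases "l = c")
    case True
    then show ?thesis
      unfolding M'_def using that d u by auto
  next
    case False
    then have "l < c" using that by simp
    then have "(\<lambda>x. w j x * M i l x - t l x * u i x) \<in> poly_fun N"
      using that j by (intro poly_functions.diff poly_functions.mult w M t u)
    then show ?thesis using False by (simp add: M'_def)
  qed
  moreover have "(\<lambda>x. d x * w j x) \<in> poly_fun N"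
    by (intro poly_functions.mult d w j)
  ultimately show ?case
    using d(2) j(2) by (intro exI[of _ M'] exI[of _ "\<lambda>x. d x * w j x"]) simp
qed

section \<open>Regular functions near a point and affine charts\<close>

text \<open>
  Functions on the whole space, regular only near \<open>P\<close> and arbitrary elsewhere, represent germs
  without tracking domains; they are compared by eventual equality near \<open>P\<close>.
\<close>

definition regular_at :: "'p fun_space \<Rightarrow> 'p \<Rightarrow> ('p \<Rightarrow> complex) set" where
  "regular_at X P = {f. \<exists>U. openin (top_of X) U \<and> P \<in> U \<and> restrict f U \<in> reg X U}"

abbreviation near :: "'p fun_space \<Rightarrow> 'p \<Rightarrow> 'p filter" where
  "near X P \<equiv> nhdsin (top_of X) P"

lemma eventually_nearI:
  "openin (top_of X) W \<Longrightarrow> P \<in> W \<Longrightarrow> (\<And>x. x \<in> W \<Longrightarrow> R x) \<Longrightarrow> eventually R (near X P)"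
  by (auto simp: eventually_nhdsin)

lemma eventually_nearE:
  assumes "eventually R (near X P)" and "P \<in> topspace (top_of X)"
  obtains W where "openin (top_of X) W" "P \<in> W" "\<And>x. x \<in> W \<Longrightarrow> R x"
  using assms by (auto simp: eventually_nhdsin)

lemma eventually_near_at:
  "eventually R (near X P) \<Longrightarrow> P \<in> topspace (top_of X) \<Longrightarrow> R P"
  by (auto simp: eventually_nhdsin)

lemma regular_at_topspace: "f \<in> regular_at X P \<Longrightarrow> P \<in> topspace (top_of X)"
  by (auto simp: regular_at_def dest: openin_subset)

text \<open>The restriction axiom is isolated because it passes at once from \<open>X\<close> to
  \<open>induced X S\<close>, so that one treatment of charts serves both \<open>X\<close> and the
  hypersurface \<open>Y\<close>.\<close>

definition presheaf :: "'p fun_space \<Rightarrow> bool" where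
  "presheaf X \<longleftrightarrow> (\<forall>U V f. openin (top_of X) U \<and> openin (top_of X) V \<and> V \<subseteq> U \<and> f \<in> reg X U
     \<longrightarrow> restrict f V \<in> reg X V)"

lemma presheafD:
  assumes "presheaf X" "openin (top_of X) U" "openin (top_of X) V" "V \<subseteq> U" "restrict f U \<in> reg X U"
  shows "restrict f V \<in> reg X V"
proof -
  have "restrict (restrict f U) V \<in> reg X V"
    using assms unfolding presheaf_def by blast
  moreover have "restrict (restrict f U) V = restrict f V"
    using assms(4) by (auto simp: restrict_def fun_eq_iff)
  ultimately show ?thesis by simp
qed

lemma space_with_functions_presheaf: "space_with_functions X \<Longrightarrow> presheaf X"
  by (auto simp: space_with_functions_def presheaf_def)

lemma regular_at_cong:
  assumes "presheaf X" and f: "f \<in> regular_at X P" and "\<forall>\<^sub>F x in near X P. f x = g x"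
  shows "g \<in> regular_at X P"
proof -
  obtain W where W: "openin (top_of X) W" "P \<in> W" "\<And>x. x \<in> W \<Longrightarrow> f x = g x"
    using eventually_nearE[OF assms(3) regular_at_topspace[OF f]] by metis
  obtain U where U: "openin (top_of X) U" "P \<in> U" "restrict f U \<in> reg X U"
    using f by (auto simp: regular_at_def)
  have "restrict f (U \<inter> W) \<in> reg X (U \<inter> W)"
    by (rule presheafD[OF assms(1) U(1) _ _ U(3)]) (use U W in auto)
  moreover have "restrict f (U \<inter> W) = restrict g (U \<inter> W)"
    using W(3) by (auto simp: restrict_def fun_eq_iff)
  ultimately show ?thesis
    using U W by (auto simp: regular_at_def intro!: exI[of _ "U \<inter> W"])
qed

lemma function_algebra_regular_at:
  assumes X: "space_with_functions X" and P: "P \<in> topspace (top_of X)"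
  shows "function_algebra (regular_at X P)"
proof
  have alg: "(\<lambda>x\<in>U. c) \<in> reg X U" "f \<in> reg X U \<Longrightarrow> g \<in> reg X U \<Longrightarrow> (\<lambda>x\<in>U. f x + g x) \<in> reg X U"
    "f \<in> reg X U \<Longrightarrow> g \<in> reg X U \<Longrightarrow> (\<lambda>x\<in>U. f x * g x) \<in> reg X U"
    if "openin (top_of X) U" for U c f g
    using X[unfolded space_with_functions_def, rule_format, OF that] by simp_all
  show "(\<lambda>_. c) \<in> regular_at X P" for c
    using alg(1)[of "topspace (top_of X)"] P by (auto simp: regular_at_def)
  have common: "\<exists>U. openin (top_of X) U \<and> P \<in> U \<and> restrict f U \<in> reg X U \<and> restrict g U \<in> reg X U"
    if fg: "f \<in> regular_at X P" "g \<in> regular_at X P" for f g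
  proof -
    obtain U where U: "openin (top_of X) U" "P \<in> U" "restrict f U \<in> reg X U"
      using fg by (auto simp: regular_at_def)
    obtain V where V: "openin (top_of X) V" "P \<in> V" "restrict g V \<in> reg X V"
      using fg by (auto simp: regular_at_def)
    show ?thesis
      using U V presheafD[OF space_with_functions_presheaf[OF X], of U "U \<inter> V" f]
        presheafD[OF space_with_functions_presheaf[OF X], of V "U \<inter> V" g]
      by (intro exI[of _ "U \<inter> V"]) auto
  qed
  fix f g assume "f \<in> regular_at X P" "g \<in> regular_at X P"
  then obtain U where U: "openin (top_of X) U" "P \<in> U" "restrict f U \<in> reg X U" "restrict g U \<in> reg X U"
    using common by blast
  have "(\<lambda>x\<in>U. restrict f U x + restrict g U x) = (\<lambda>x\<in>U. f x + g x)"
    "(\<lambda>x\<in>U. restrict f U x * restrict g U x) = (\<lambda>x\<in>U. f x * g x)"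
    by (auto simp: restrict_def fun_eq_iff)
  then show "(\<lambda>x. f x + g x) \<in> regular_at X P" "(\<lambda>x. f x * g x) \<in> regular_at X P"
    using alg(2,3)[OF U(1,3,4)] U(1,2) by (auto simp: regular_at_def)
qed

section \<open>Germs on induced subspaces and their pull-back along morphisms\<close>

lemma reg_inducedE:
  assumes "f \<in> reg (induced X S) V" "x \<in> V"
  obtains U g where "openin (top_of X) U" "x \<in> U" "U \<inter> S \<subseteq> V" "g \<in> reg X U"
    "\<forall>y\<in>U \<inter> S. f y = g y"
proof -
  have "\<exists>U. openin (top_of X) U \<and> x \<in> U \<and> U \<inter> S \<subseteq> V \<and> (\<exists>g\<in>reg X U. \<forall>y\<in>U \<inter> S. f y = g y)"
    using assms by (simp add: induced_def)
  then show ?thesis using that by blast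
qed

lemma presheaf_induced:
  assumes "presheaf X"
  shows "presheaf (induced X S)"
  unfolding presheaf_def
proof (intro allI impI, elim conjE)
  fix U V f
  assume V: "openin (top_of (induced X S)) V" "V \<subseteq> U" and f: "f \<in> reg (induced X S) U"
  obtain T where T: "openin (top_of X) T" "V = T \<inter> S"
    using V by (auto simp: induced_def openin_subtopology)
  have "\<exists>U. openin (top_of X) U \<and> x \<in> U \<and> U \<inter> S \<subseteq> V
      \<and> (\<exists>g\<in>reg X U. \<forall>y\<in>U \<inter> S. restrict f V y = g y)" if "x \<in> V" for x
  proof -
    have "x \<in> U" using that V(2) by blast
    obtain W g where W: "openin (top_of X) W" "x \<in> W" "W \<inter> S \<subseteq> U"
      "g \<in> reg X W" "\<forall>y\<in>W \<inter> S. f y = g y"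
      using reg_inducedE[OF f \<open>x \<in> U\<close>] .
    have "restrict g (W \<inter> T) \<in> reg X (W \<inter> T)"
      using assms W T(1) unfolding presheaf_def
      by (meson inf_le1 openin_Int)
    moreover have "restrict f V y = restrict g (W \<inter> T) y" if "y \<in> W \<inter> T \<inter> S" for y
      using W(5) T(2) that by (auto simp: restrict_def)
    ultimately show ?thesis
      using W(1,2) T that
      by (intro exI[of _ "W \<inter> T"] conjI bexI[of _ "restrict g (W \<inter> T)"]) auto
  qed
  then show "restrict f V \<in> reg (induced X S) V"
    by (auto simp: induced_def)
qed

lemma topspace_induced: "topspace (top_of (induced X S)) = topspace (top_of X) \<inter> S"
  by (simp add: induced_def)

text \<open>Lets every statement about germs on \<open>Y\<close> be made near \<open>P\<close> in
  \<open>X\<close>, guarded by membership in \<open>Y\<close>.\<close>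

lemma eventually_near_induced:
  assumes "P \<in> S"
  shows "eventually R (near (induced X S) P) \<longleftrightarrow> (\<forall>\<^sub>F x in near X P. x \<in> S \<longrightarrow> R x)"
  using assms
  by (auto simp: eventually_nhdsin induced_def openin_subtopology)

text \<open>Contains the surjectivity of the local ring of \<open>X\<close> onto that of a subspace,
  since sections on \<open>S\<close> are local restrictions by definition. This is what extends the
  coordinates of \<open>Y\<close> to functions on \<open>X\<close>.\<close>

lemma regular_at_induced:
  assumes X: "presheaf X" and P: "P \<in> S"
  shows "f \<in> regular_at (induced X S) P \<longleftrightarrow>
    (\<exists>g\<in>regular_at X P. \<forall>\<^sub>F x in near X P. x \<in> S \<longrightarrow> f x = g x)"
proof
  assume "f \<in> regular_at (induced X S) P"
  then obtain V where V: "P \<in> V" "restrict f V \<in> reg (induced X S) V"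
    by (auto simp: regular_at_def)
  obtain U g where U:
    "openin (top_of X) U" "P \<in> U" "U \<inter> S \<subseteq> V" "g \<in> reg X U"
    "\<forall>y\<in>U \<inter> S. restrict f V y = g y"
    using reg_inducedE[OF V(2,1)] .
  have "restrict g U \<in> reg X U" using X U unfolding presheaf_def by blast
  then have "g \<in> regular_at X P" using U by (auto simp: regular_at_def)
  moreover have "\<forall>\<^sub>F x in near X P. x \<in> S \<longrightarrow> f x = g x"
    by (rule eventually_nearI[OF U(1,2)]) (use U(3,5) in \<open>metis IntI restrict_apply' subsetD\<close>)
  ultimately show "\<exists>g\<in>regular_at X P. \<forall>\<^sub>F x in near X P. x \<in> S \<longrightarrow> f x = g x" by blast
next
  assume "\<exists>g\<in>regular_at X P. \<forall>\<^sub>F x in near X P. x \<in> S \<longrightarrow> f x = g x"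
  then obtain g where g: "g \<in> regular_at X P" "\<forall>\<^sub>F x in near X P. x \<in> S \<longrightarrow> f x = g x" by blast
  obtain W where W: "openin (top_of X) W" "P \<in> W" "\<And>x. x \<in> W \<Longrightarrow> x \<in> S \<Longrightarrow> f x = g x"
    using eventually_nearE[OF g(2) regular_at_topspace[OF g(1)]] by metis
  obtain U where U: "openin (top_of X) U" "P \<in> U" "restrict g U \<in> reg X U"
    using g(1) by (auto simp: regular_at_def)
  define T where "T = U \<inter> W"
  have T: "openin (top_of X) T" "P \<in> T" using U W by (auto simp: T_def)
  have "restrict g T \<in> reg X T"
    by (rule presheafD[OF X U(1) _ _ U(3)]) (use T in \<open>auto simp: T_def\<close>)
  then have "restrict f (T \<inter> S) \<in> reg (induced X S) (T \<inter> S)"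
    using T W(3) by (auto simp: induced_def T_def intro!: exI[of _ T] bexI[of _ "restrict g T"])
  moreover have "openin (top_of (induced X S)) (T \<inter> S)"
    using T by (auto simp: induced_def openin_subtopology)
  ultimately show "f \<in> regular_at (induced X S) P"
    unfolding regular_at_def using T P by blast
qed

lemma fs_morphism_near:
  assumes "fs_morphism X Z \<phi>" "P \<in> topspace (top_of X)" "eventually R (near Z (\<phi> P))"
  shows "\<forall>\<^sub>F x in near X P. R (\<phi> x)"
proof -
  have cont: "continuous_map (top_of X) (top_of Z) \<phi>"
    using assms(1) by (simp add: fs_morphism_def)
  then have "\<phi> P \<in> topspace (top_of Z)"
    using assms(2) by (auto simp: continuous_map_def)
  then obtain W where W: "openin (top_of Z) W" "\<phi> P \<in> W" "\<And>x. x \<in> W \<Longrightarrow> R x"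
    using eventually_nearE[OF assms(3)] by metis
  have "openin (top_of X) {x \<in> topspace (top_of X). \<phi> x \<in> W}"
    using cont W(1) by (auto simp: continuous_map_def)
  then show ?thesis
    by (rule eventually_nearI) (use assms(2) W in auto)
qed

lemma fs_morphism_regular_at:
  assumes "fs_morphism X Z \<phi>" "P \<in> topspace (top_of X)" "f \<in> regular_at Z (\<phi> P)"
  shows "(\<lambda>x. f (\<phi> x)) \<in> regular_at X P"
proof -
  obtain V where V: "openin (top_of Z) V" "\<phi> P \<in> V" "restrict f V \<in> reg Z V"
    using assms(3) by (auto simp: regular_at_def)
  define U where "U = {x \<in> topspace (top_of X). \<phi> x \<in> V}"
  have "openin (top_of X) U"
    using assms(1) V(1) by (auto simp: U_def fs_morphism_def continuous_map_def)
  moreover have "(\<lambda>x\<in>U. restrict f V (\<phi> x)) \<in> reg X U"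
    using assms(1) V unfolding fs_morphism_def U_def by blast
  moreover have "(\<lambda>x\<in>U. restrict f V (\<phi> x)) = (\<lambda>x\<in>U. f (\<phi> x))"
    by (auto simp: U_def restrict_def fun_eq_iff)
  ultimately show ?thesis
    using assms(2) V(2) by (auto simp: regular_at_def U_def intro!: exI[of _ U])
qed

section \<open>Local rings of affine algebraic sets\<close>

lemma topspace_zariski: "topspace (zariski N) = affine_points N"
proof
  show "topspace (zariski N) \<subseteq> affine_points N"
    using openin_topspace[of "zariski N"] unfolding openin_zariski by blast
  have "zeros N {\<lambda>_. 1} = {}" by (auto simp: zeros_def)
  moreover have "algebraic_set N (zeros N {\<lambda>_. 1})"
    unfolding algebraic_set_def by (intro exI[of _ "{\<lambda>_. 1}"]) auto
  ultimately have "openin (zariski N) (affine_points N)"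
    unfolding openin_zariski by auto
  then show "affine_points N \<subseteq> topspace (zariski N)" by (rule openin_subset)
qed

lemma algebraic_set_subset: "algebraic_set N Z \<Longrightarrow> Z \<subseteq> affine_points N"
  by (auto simp: algebraic_set_def zeros_def)

lemma topspace_affine_variety:
  "algebraic_set N Z \<Longrightarrow> topspace (top_of (affine_variety N Z)) = Z"
  using algebraic_set_subset by (auto simp: affine_variety_def topspace_zariski)

lemma eventually_poly_fun_nonzero:
  assumes Z: "algebraic_set N Z" and z: "z \<in> Z" and q: "q \<in> poly_fun N" "q z \<noteq> 0"
  shows "\<forall>\<^sub>F y in near (affine_variety N Z) z. q y \<noteq> 0"
proof (rule eventually_nearI)
  have "openin (zariski N) (affine_points N - zeros N {q})"
    unfolding openin_zariski algebraic_set_def using q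
    by (intro exI[of _ "zeros N {q}"] conjI exI[of _ "{q}"]) auto
  then show "openin (top_of (affine_variety N Z)) ((affine_points N - zeros N {q}) \<inter> Z)"
    by (auto simp: affine_variety_def openin_subtopology)
  show "z \<in> (affine_points N - zeros N {q}) \<inter> Z"
    using algebraic_set_subset[OF Z] z q by (auto simp: zeros_def)
qed (auto simp: zeros_def)

text \<open>A neighbourhood of \<open>z\<close> in \<open>Z\<close> is the locus where some
  polynomial of a family is nonzero. One member \<open>t\<close> with \<open>t z \<noteq> 0\<close>
  suffices: where \<open>t\<close> is nonzero, \<open>p\<close> vanishes, so the product vanishes on
  all of \<open>Z\<close>. Local vanishing thus becomes membership in the global vanishing
  ideal.\<close>

lemma eventually_poly_fun_zeroE:
  assumes Z: "algebraic_set N Z" and z: "z \<in> Z" and p: "p \<in> poly_fun N"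
    and "\<forall>\<^sub>F y in near (affine_variety N Z) z. p y = 0"
  obtains t where "t \<in> poly_fun N" "t z \<noteq> 0" "(\<lambda>x. t x * p x) \<in> vanishing_ideal N Z"
proof -
  obtain W where W: "openin (top_of (affine_variety N Z)) W" "z \<in> W" "\<And>y. y \<in> W \<Longrightarrow> p y = 0"
    using eventually_nearE[OF assms(4)] z topspace_affine_variety[OF Z] by metis
  then obtain S where S: "S \<subseteq> poly_fun N" "W = (affine_points N - zeros N S) \<inter> Z"
    by (auto simp: affine_variety_def openin_subtopology openin_zariski algebraic_set_def)
  then obtain t where t: "t \<in> S" "t z \<noteq> 0" using W(2) by (auto simp: zeros_def)
  have "t x * p x = 0" if "x \<in> Z" for x
    using that W(3)[of x] algebraic_set_subset[OF Z] t(1) by (auto simp: S(2) zeros_def)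
  then show ?thesis
    using t S(1) p by (intro that[of t]) (auto simp: vanishing_ideal_def)
qed

lemma reg_affine_varietyE:
  assumes "f \<in> reg (affine_variety N Z) U" "x \<in> U"
  obtains V p q where "openin (top_of (affine_variety N Z)) V" "x \<in> V" "V \<subseteq> U"
    "p \<in> poly_fun N" "q \<in> poly_fun N" "\<And>y. y \<in> V \<Longrightarrow> q y \<noteq> 0 \<and> f y = p y / q y"
  using assms by (auto simp: affine_variety_def)

lemma regular_at_affine_variety:
  assumes Z: "algebraic_set N Z" and z: "z \<in> Z"
  shows "f \<in> regular_at (affine_variety N Z) z \<longleftrightarrow> (\<exists>p\<in>poly_fun N. \<exists>q\<in>poly_fun N.
    \<forall>\<^sub>F y in near (affine_variety N Z) z. q y \<noteq> 0 \<and> f y = p y / q y)"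
proof
  assume "f \<in> regular_at (affine_variety N Z) z"
  then obtain U where "z \<in> U" "restrict f U \<in> reg (affine_variety N Z) U"
    by (auto simp: regular_at_def)
  then obtain V p q where V: "openin (top_of (affine_variety N Z)) V" "z \<in> V" "V \<subseteq> U"
    "p \<in> poly_fun N" "q \<in> poly_fun N" "\<And>y. y \<in> V \<Longrightarrow> q y \<noteq> 0 \<and> restrict f U y = p y / q y"
    using reg_affine_varietyE by metis
  have "q y \<noteq> 0 \<and> f y = p y / q y" if "y \<in> V" for y
    using V(3) V(6)[OF that] that by (auto simp: restrict_def)
  then show "\<exists>p\<in>poly_fun N. \<exists>q\<in>poly_fun N.
      \<forall>\<^sub>F y in near (affine_variety N Z) z. q y \<noteq> 0 \<and> f y = p y / q y"
    using V by (intro bexI[of _ p] bexI[of _ q] eventually_nearI[of _ V])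
next
  assume "\<exists>p\<in>poly_fun N. \<exists>q\<in>poly_fun N.
      \<forall>\<^sub>F y in near (affine_variety N Z) z. q y \<noteq> 0 \<and> f y = p y / q y"
  then obtain p q where pq: "p \<in> poly_fun N" "q \<in> poly_fun N"
    "\<forall>\<^sub>F y in near (affine_variety N Z) z. q y \<noteq> 0 \<and> f y = p y / q y" by blast
  obtain W where W: "openin (top_of (affine_variety N Z)) W" "z \<in> W"
    "\<And>y. y \<in> W \<Longrightarrow> q y \<noteq> 0 \<and> f y = p y / q y"
    using eventually_nearE[OF pq(3)] z topspace_affine_variety[OF Z] by metis
  have "restrict f W \<in> reg (affine_variety N Z) W"
  proof -
    have "\<exists>V. openin (subtopology (zariski N) Z) V \<and> x \<in> V \<and> V \<subseteq> W \<and>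
        (\<exists>p\<in>poly_fun N. \<exists>q\<in>poly_fun N. \<forall>y\<in>V. q y \<noteq> 0 \<and> restrict f W y = p y / q y)"
      if "x \<in> W" for x
      using W that pq(1,2)
      by (intro exI[of _ W] conjI bexI[of _ p] bexI[of _ q]) (auto simp: affine_variety_def)
    then show ?thesis
      by (simp add: affine_variety_def)
  qed
  then show "f \<in> regular_at (affine_variety N Z) z"
    using W by (auto simp: regular_at_def)
qed

text \<open>Serves two purposes: with \<open>E\<close> equal to \<open>X\<close> it inverts
  functions near a point, and with \<open>E\<close> the structure induced on \<open>Y\<close> it
  holds the chart provided by smoothness.\<close>

locale pointed_chart =
  fixes E :: "'p fun_space" and U N Z \<phi> P
  assumes presheaf: "presheaf E" and chart: "affine_chart E U N Z \<phi>" and point: "P \<in> U"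
begin

lemma algebraic: "algebraic_set N Z"
  using chart by (simp add: affine_chart_def)

lemma eventually_domain: "\<forall>\<^sub>F x in near E P. x \<in> U"
  using chart point by (auto simp: affine_chart_def intro: eventually_nearI)

lemma point_topspace: "P \<in> topspace (top_of E)" "P \<in> topspace (top_of (induced E U))"
  using chart point by (auto simp: affine_chart_def topspace_induced dest: openin_subset)

lemma chart_morphism: "fs_morphism (induced E U) (affine_variety N Z) \<phi>"
  using chart by (simp add: affine_chart_def fs_isomorphism_def)

lemma point_image: "\<phi> P \<in> Z"
  using chart_morphism point_topspace topspace_affine_variety[OF algebraic]
  by (auto simp: fs_morphism_def continuous_map_def)

lemma chart_maps: "x \<in> U \<Longrightarrow> \<phi> x \<in> Z"
  using chart_morphism topspace_affine_variety[OF algebraic] chart openin_subset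
  by (fastforce simp: fs_morphism_def continuous_map_def affine_chart_def topspace_induced)

lemma chart_inverse:
  obtains \<psi> where "fs_morphism (affine_variety N Z) (induced E U) \<psi>"
    and "\<And>x. x \<in> U \<Longrightarrow> \<psi> (\<phi> x) = x" and "\<And>z. z \<in> Z \<Longrightarrow> \<phi> (\<psi> z) = z"
proof -
  have "topspace (top_of (induced E U)) = U"
    using chart openin_subset by (fastforce simp: affine_chart_def topspace_induced)
  then show ?thesis
    using chart that topspace_affine_variety[OF algebraic]
    by (auto simp: affine_chart_def fs_isomorphism_def)
qed

lemma eventually_near_domain: "eventually R (near (induced E U) P) \<longleftrightarrow> eventually R (near E P)"
  unfolding eventually_near_induced[OF point]
  using eventually_domain by (auto elim: eventually_elim2)

lemma regular_at_domain: "regular_at (induced E U) P = regular_at E P"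
proof (intro equalityI subsetI)
  fix f assume "f \<in> regular_at (induced E U) P"
  then obtain g where g: "g \<in> regular_at E P" "\<forall>\<^sub>F x in near E P. x \<in> U \<longrightarrow> f x = g x"
    unfolding regular_at_induced[OF presheaf point] by blast
  from g(2) eventually_domain have "\<forall>\<^sub>F x in near E P. g x = f x"
    by eventually_elim simp
  then show "f \<in> regular_at E P" by (rule regular_at_cong[OF presheaf g(1)])
next
  fix f assume "f \<in> regular_at E P"
  then show "f \<in> regular_at (induced E U) P"
    unfolding regular_at_induced[OF presheaf point] by (intro bexI[of _ f]) auto
qed

lemma eventually_chart:
  "eventually R (near (affine_variety N Z) (\<phi> P)) \<Longrightarrow> \<forall>\<^sub>F x in near E P. R (\<phi> x)"
  using fs_morphism_near[OF chart_morphism point_topspace(2)] by (simp add: eventually_near_domain)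

lemma regular_at_fraction:
  assumes "p \<in> poly_fun N" "q \<in> poly_fun N" "q (\<phi> P) \<noteq> 0"
  shows "(\<lambda>x. p (\<phi> x) / q (\<phi> x)) \<in> regular_at E P"
proof -
  have "(\<lambda>y. p y / q y) \<in> regular_at (affine_variety N Z) (\<phi> P)"
    unfolding regular_at_affine_variety[OF algebraic point_image]
    by (intro bexI[of _ p] bexI[of _ q])
      (use assms eventually_poly_fun_nonzero[OF algebraic point_image assms(2,3)] in auto)
  then show ?thesis
    using fs_morphism_regular_at[OF chart_morphism point_topspace(2)] regular_at_domain by auto
qed

lemma regular_at_fractionE:
  assumes "f \<in> regular_at E P"
  obtains p q where "p \<in> poly_fun N" "q \<in> poly_fun N" "q (\<phi> P) \<noteq> 0"
    "\<forall>\<^sub>F x in near E P. f x = p (\<phi> x) / q (\<phi> x)"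
proof -
  obtain \<psi> where \<psi>: "fs_morphism (affine_variety N Z) (induced E U) \<psi>"
    "\<And>x. x \<in> U \<Longrightarrow> \<psi> (\<phi> x) = x" "\<And>z. z \<in> Z \<Longrightarrow> \<phi> (\<psi> z) = z"
    using chart_inverse by blast
  have "(\<lambda>y. f (\<psi> y)) \<in> regular_at (affine_variety N Z) (\<phi> P)"
    by (rule fs_morphism_regular_at[OF \<psi>(1)])
      (use assms point_image in
        \<open>auto simp: topspace_affine_variety[OF algebraic] \<psi>(2)[OF point] regular_at_domain\<close>)
  then obtain p q where pq: "p \<in> poly_fun N" "q \<in> poly_fun N"
    "\<forall>\<^sub>F y in near (affine_variety N Z) (\<phi> P). q y \<noteq> 0 \<and> f (\<psi> y) = p y / q y"
    unfolding regular_at_affine_variety[OF algebraic point_image] by blast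
  have "\<forall>\<^sub>F x in near E P. f x = p (\<phi> x) / q (\<phi> x)"
    using eventually_chart[OF pq(3)] eventually_domain by eventually_elim (use \<psi>(2) in auto)
  moreover have "q (\<phi> P) \<noteq> 0"
    using eventually_near_at[OF pq(3)] topspace_affine_variety[OF algebraic] point_image by auto
  ultimately show ?thesis using that pq by blast
qed

text \<open>The inverse of the chart carries the vanishing from \<open>E\<close> to
  \<open>Z\<close>, where it turns into membership in the ideal of \<open>Z\<close>, the form in
  which the generators \<open>g k\<close> can be applied.\<close>

lemma eventually_fraction_zeroE:
  assumes "p \<in> poly_fun N" "\<forall>\<^sub>F x in near E P. p (\<phi> x) = 0"
  obtains t where "t \<in> poly_fun N" "t (\<phi> P) \<noteq> 0" "(\<lambda>x. t x * p x) \<in> vanishing_ideal N Z"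
proof -
  obtain \<psi> where \<psi>: "fs_morphism (affine_variety N Z) (induced E U) \<psi>"
    "\<And>x. x \<in> U \<Longrightarrow> \<psi> (\<phi> x) = x" "\<And>z. z \<in> Z \<Longrightarrow> \<phi> (\<psi> z) = z"
    using chart_inverse by blast
  have top: "topspace (top_of (affine_variety N Z)) = Z"
    by (rule topspace_affine_variety[OF algebraic])
  have "\<forall>\<^sub>F x in near (induced E U) (\<psi> (\<phi> P)). p (\<phi> x) = 0"
    using assms(2) by (simp add: \<psi>(2)[OF point] eventually_near_domain)
  then have "\<forall>\<^sub>F y in near (affine_variety N Z) (\<phi> P). p (\<phi> (\<psi> y)) = 0"
    by (intro fs_morphism_near[OF \<psi>(1), where R = "\<lambda>x. p (\<phi> x) = 0"])
      (use point_image top in auto)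
  \<comment> \<open>The identity \<open>\<phi> (\<psi> y) = y\<close> is available for
    \<open>y\<close> in \<open>Z\<close>, so the neighbourhood is kept inside
    \<open>Z\<close>.\<close>
  moreover have "\<forall>\<^sub>F y in near (affine_variety N Z) (\<phi> P). y \<in> Z"
    by (rule eventually_nearI[OF openin_topspace]) (use point_image top in auto)
  ultimately have "\<forall>\<^sub>F y in near (affine_variety N Z) (\<phi> P). p y = 0"
    by eventually_elim (use \<psi>(3) in auto)
  then show ?thesis
    by (rule eventually_poly_fun_zeroE[OF algebraic point_image assms(1)]) (rule that)
qed

text \<open>The axioms of \<open>space_with_functions\<close> mention neither inverses nor
  continuity, so a chart is consulted: there the function is a fraction \<open>p / q\<close> with
  \<open>p\<close> and \<open>q\<close> nonzero at the point, and \<open>q / p\<close> is its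
  inverse.\<close>

lemma eventually_regular_nonzero:
  assumes f: "f \<in> regular_at E P" "f P \<noteq> 0"
  shows "\<forall>\<^sub>F x in near E P. f x \<noteq> 0" and "(\<lambda>x. 1 / f x) \<in> regular_at E P"
proof -
  obtain p q where pq: "p \<in> poly_fun N" "q \<in> poly_fun N" "q (\<phi> P) \<noteq> 0"
    "\<forall>\<^sub>F x in near E P. f x = p (\<phi> x) / q (\<phi> x)"
    using regular_at_fractionE[OF f(1)] .
  have p0: "p (\<phi> P) \<noteq> 0"
    using eventually_near_at[OF pq(4) point_topspace(1)] f(2) by auto
  have "\<forall>\<^sub>F x in near E P. p (\<phi> x) \<noteq> 0" "\<forall>\<^sub>F x in near E P. q (\<phi> x) \<noteq> 0"
    using eventually_chart eventually_poly_fun_nonzero[OF algebraic point_image] pq p0 by blast+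
  then show "\<forall>\<^sub>F x in near E P. f x \<noteq> 0"
    using pq(4) by eventually_elim auto
  from pq(4) have "\<forall>\<^sub>F x in near E P. q (\<phi> x) / p (\<phi> x) = 1 / f x"
    by eventually_elim auto
  then show "(\<lambda>x. 1 / f x) \<in> regular_at E P"
    by (rule regular_at_cong[OF presheaf regular_at_fraction[OF pq(2,1) p0]])
qed

end

section \<open>Stalks\<close>

lemma complex_field_simps [simp]:
  "carrier complex_field = UNIV" "mult complex_field = (*)" "one complex_field = 1"
  "zero complex_field = 0" "add complex_field = (+)"
  by (simp_all add: complex_field_def)

lemma cring_complex_field: "cring complex_field"
  by (intro cringI abelian_groupI comm_monoidI)
    (auto simp: algebra_simps intro: exI[of _ "- x" for x])

text \<open>\<open>germ\<close> compares \<open>f\<close> with sections near \<open>P\<close> and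
  does not ask \<open>f\<close> to be a section itself, so a function regular merely near
  \<open>P\<close> may be given the whole space as its nominal domain.\<close>

definition germ_of :: "'p fun_space \<Rightarrow> 'p \<Rightarrow> ('p \<Rightarrow> complex) \<Rightarrow> ('p set \<times> ('p \<Rightarrow> complex)) set" where
  "germ_of X P f = germ X P (topspace (top_of X)) f"

locale pointed_space =
  fixes X :: "'p fun_space" and P :: 'p
  assumes space: "space_with_functions X" and point_in: "P \<in> topspace (top_of X)"
begin

sublocale regular: function_algebra "regular_at X P"
  by (rule function_algebra_regular_at[OF space point_in])

lemma germ_eq_germ_of:
  assumes "openin (top_of X) U" "P \<in> U"
  shows "germ X P U f = germ_of X P f"
proof -
  have "(\<exists>W. openin (top_of X) W \<and> P \<in> W \<and> W \<subseteq> U \<inter> V \<and> (\<forall>x\<in>W. f x = g x)) \<longleftrightarrow>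
      (\<exists>W. openin (top_of X) W \<and> P \<in> W \<and> W \<subseteq> topspace (top_of X) \<inter> V \<and> (\<forall>x\<in>W. f x = g x))"
    (is "?L \<longleftrightarrow> ?R") for V g
  proof
    assume ?L
    then show ?R by (meson inf.bounded_iff openin_subset)
  next
    assume ?R
    then obtain W where "openin (top_of X) W" "P \<in> W" "W \<subseteq> topspace (top_of X) \<inter> V"
      "\<forall>x\<in>W. f x = g x" by blast
    then show ?L using assms by (intro exI[of _ "W \<inter> U"]) auto
  qed
  then show ?thesis by (simp add: germ_of_def germ_def)
qed

lemma mem_germ_of_iff:
  "(V, g) \<in> germ_of X P f \<longleftrightarrow>
    openin (top_of X) V \<and> P \<in> V \<and> g \<in> reg X V \<and> (\<forall>\<^sub>F x in near X P. f x = g x)"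
proof -
  have "(\<exists>W. openin (top_of X) W \<and> P \<in> W \<and> W \<subseteq> topspace (top_of X) \<inter> V \<and> (\<forall>x\<in>W. f x = g x))
      \<longleftrightarrow> (\<forall>\<^sub>F x in near X P. f x = g x)" (is "?L \<longleftrightarrow> ?R") if V: "openin (top_of X) V" "P \<in> V"
  proof
    assume ?L
    then show ?R by (elim exE conjE) (rule eventually_nearI, auto)
  next
    assume ev: ?R
    obtain W where "openin (top_of X) W" "P \<in> W" "\<And>x. x \<in> W \<Longrightarrow> f x = g x"
      using eventually_nearE[OF ev point_in] by blast
    then show ?L using V openin_subset[OF V(1)] by (intro exI[of _ "W \<inter> V"]) auto
  qed
  then show ?thesis by (auto simp: germ_of_def germ_def)
qed

lemma germ_of_cong:
  assumes "\<forall>\<^sub>F x in near X P. f x = g x"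
  shows "germ_of X P f = germ_of X P g"
proof -
  have "(\<forall>\<^sub>F x in near X P. f x = h x) \<longleftrightarrow> (\<forall>\<^sub>F x in near X P. g x = h x)" for h
    using assms by (intro eventually_subst) (auto elim: eventually_mono)
  then show ?thesis by (auto simp: mem_germ_of_iff)
qed

lemma germ_of_representative:
  assumes "f \<in> regular_at X P"
  obtains U where "(U, restrict f U) \<in> germ_of X P f"
proof -
  obtain U where "openin (top_of X) U" "P \<in> U" "restrict f U \<in> reg X U"
    using assms by (auto simp: regular_at_def)
  moreover from this have "\<forall>\<^sub>F x in near X P. f x = restrict f U x"
    by (intro eventually_nearI[of X U]) auto
  ultimately have "(U, restrict f U) \<in> germ_of X P f"
    by (simp add: mem_germ_of_iff)
  then show ?thesis by (rule that)
qed

lemma germ_of_nonempty: "f \<in> regular_at X P \<Longrightarrow> germ_of X P f \<noteq> {}"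
  using germ_of_representative by blast

text \<open>Regularity of \<open>f\<close> guards the forward direction: the germ of a function that
  is not regular near \<open>P\<close> is the empty set, so two such functions have equal germs
  whatever their values.\<close>

lemma germ_of_eq_iff:
  assumes "f \<in> regular_at X P"
  shows "germ_of X P f = germ_of X P g \<longleftrightarrow> (\<forall>\<^sub>F x in near X P. f x = g x)"
proof
  assume eq: "germ_of X P f = germ_of X P g"
  obtain U where U: "(U, restrict f U) \<in> germ_of X P f"
    using germ_of_representative[OF assms] .
  then have "\<forall>\<^sub>F x in near X P. f x = restrict f U x"
    unfolding mem_germ_of_iff by blast
  moreover have "\<forall>\<^sub>F x in near X P. g x = restrict f U x"
    using U unfolding eq mem_germ_of_iff by blast
  ultimately show "\<forall>\<^sub>F x in near X P. f x = g x" by eventually_elim simp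
qed (rule germ_of_cong)

lemma regular_at_reg: "openin (top_of X) U \<Longrightarrow> P \<in> U \<Longrightarrow> f \<in> reg X U \<Longrightarrow> f \<in> regular_at X P"
  unfolding regular_at_def
  using space_with_functions_presheaf[OF space] unfolding presheaf_def by blast

lemma carrier_stalk: "carrier (stalk X P) = germ_of X P ` regular_at X P"
proof (intro equalityI subsetI)
  fix a assume "a \<in> carrier (stalk X P)"
  then obtain U f where "a = germ X P U f" "openin (top_of X) U" "P \<in> U" "f \<in> reg X U"
    by (auto simp: stalk_def)
  then show "a \<in> germ_of X P ` regular_at X P"
    using germ_eq_germ_of regular_at_reg by blast
next
  fix a assume "a \<in> germ_of X P ` regular_at X P"
  then obtain f where f: "f \<in> regular_at X P" "a = germ_of X P f" by blast
  obtain U where U: "(U, restrict f U) \<in> germ_of X P f"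
    using germ_of_representative[OF f(1)] .
  have "a = germ X P U (restrict f U)"
    using U germ_of_cong[of f "restrict f U"] germ_eq_germ_of unfolding f(2) mem_germ_of_iff
    by blast
  then show "a \<in> carrier (stalk X P)"
    using U unfolding mem_germ_of_iff stalk_def by auto
qed

lemma germ_of_closed: "f \<in> regular_at X P \<Longrightarrow> germ_of X P f \<in> carrier (stalk X P)"
  by (simp add: carrier_stalk)

text \<open>All representatives give the same germ, so the union is over a constant family, and it
  is nonempty because \<open>f\<close> and \<open>g\<close> are regular. The operation is a variable
  in order to cover sum and product at once.\<close>

lemma germ_binary:
  assumes f: "f \<in> regular_at X P" and g: "g \<in> regular_at X P"
  shows "(\<Union>(U, f')\<in>germ_of X P f. \<Union>(V, g')\<in>germ_of X P g.
      germ X P (U \<inter> V) (\<lambda>x\<in>U \<inter> V. op (f' x) (g' x))) = germ_of X P (\<lambda>x. op (f x) (g x))"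
proof -
  have "germ X P (U \<inter> V) (\<lambda>x\<in>U \<inter> V. op (f' x) (g' x)) = germ_of X P (\<lambda>x. op (f x) (g x))"
    if "(U, f') \<in> germ_of X P f" "(V, g') \<in> germ_of X P g" for U V f' g'
  proof -
    have UV: "openin (top_of X) (U \<inter> V)" "P \<in> U \<inter> V"
      using that by (auto simp: mem_germ_of_iff)
    then have "\<forall>\<^sub>F x in near X P. x \<in> U \<inter> V" by (rule eventually_nearI)
    moreover have "\<forall>\<^sub>F x in near X P. f x = f' x" "\<forall>\<^sub>F x in near X P. g x = g' x"
      using that unfolding mem_germ_of_iff by blast+
    ultimately have "\<forall>\<^sub>F x in near X P. (\<lambda>x\<in>U \<inter> V. op (f' x) (g' x)) x = op (f x) (g x)"
      by eventually_elim simp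
    then show ?thesis unfolding germ_eq_germ_of[OF UV] by (rule germ_of_cong)
  qed
  then have "(\<Union>(U, f')\<in>germ_of X P f. \<Union>(V, g')\<in>germ_of X P g.
      germ X P (U \<inter> V) (\<lambda>x\<in>U \<inter> V. op (f' x) (g' x))) =
    (\<Union>u\<in>germ_of X P f. \<Union>v\<in>germ_of X P g. germ_of X P (\<lambda>x. op (f x) (g x)))"
    by (intro SUP_cong refl) (auto simp only: split_paired_all prod.case)
  then show ?thesis using germ_of_nonempty[OF f] germ_of_nonempty[OF g] by simp
qed

lemma germ_add:
  "f \<in> regular_at X P \<Longrightarrow> g \<in> regular_at X P \<Longrightarrow>
    germ_of X P f \<oplus>\<^bsub>stalk X P\<^esub> germ_of X P g = germ_of X P (\<lambda>x. f x + g x)"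
  using germ_binary[of f g "(+)"] by (simp add: stalk_def)

lemma germ_mult:
  "f \<in> regular_at X P \<Longrightarrow> g \<in> regular_at X P \<Longrightarrow>
    germ_of X P f \<otimes>\<^bsub>stalk X P\<^esub> germ_of X P g = germ_of X P (\<lambda>x. f x * g x)"
  using germ_binary[of f g "(*)"] by (simp add: stalk_def)

lemma germ_smult:
  assumes f: "f \<in> regular_at X P"
  shows "c \<odot>\<^bsub>stalk X P\<^esub> germ_of X P f = germ_of X P (\<lambda>x. c * f x)"
proof -
  have "germ X P U (\<lambda>x\<in>U. c * f' x) = germ_of X P (\<lambda>x. c * f x)"
    if "(U, f') \<in> germ_of X P f" for U f'
  proof -
    have U: "openin (top_of X) U" "P \<in> U"
      using that by (auto simp: mem_germ_of_iff)
    then have "\<forall>\<^sub>F x in near X P. x \<in> U" by (rule eventually_nearI)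
    moreover have "\<forall>\<^sub>F x in near X P. f x = f' x"
      using that unfolding mem_germ_of_iff by blast
    ultimately have "\<forall>\<^sub>F x in near X P. (\<lambda>x\<in>U. c * f' x) x = c * f x"
      by eventually_elim simp
    then show ?thesis unfolding germ_eq_germ_of[OF U] by (rule germ_of_cong)
  qed
  then have "(\<Union>(U, f')\<in>germ_of X P f. germ X P U (\<lambda>x\<in>U. c * f' x)) =
      (\<Union>u\<in>germ_of X P f. germ_of X P (\<lambda>x. c * f x))"
    by (intro SUP_cong refl) (auto simp only: split_paired_all prod.case)
  then show ?thesis using germ_of_nonempty[OF f] by (simp add: stalk_def)
qed

lemma germ_const: "\<one>\<^bsub>stalk X P\<^esub> = germ_of X P (\<lambda>_. 1)" "\<zero>\<^bsub>stalk X P\<^esub> = germ_of X P (\<lambda>_. 0)"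
proof -
  have "\<forall>\<^sub>F x in near X P. (\<lambda>x\<in>topspace (top_of X). c) x = c" for c :: complex
    by (rule eventually_nearI[of X "topspace (top_of X)"]) (use point_in in auto)
  then show "\<one>\<^bsub>stalk X P\<^esub> = germ_of X P (\<lambda>_. 1)" "\<zero>\<^bsub>stalk X P\<^esub> = germ_of X P (\<lambda>_. 0)"
    using germ_of_cong unfolding stalk_def germ_of_def[symmetric] by simp_all
qed

lemma stalk_algebra: "algebra complex_field (stalk X P)"
proof -
  note simps = carrier_stalk germ_add germ_mult germ_smult germ_const
    regular.add regular.mult regular.const
  have "\<exists>y\<in>carrier (stalk X P). y \<oplus>\<^bsub>stalk X P\<^esub> x = \<zero>\<^bsub>stalk X P\<^esub>"
    if x: "x \<in> carrier (stalk X P)" for x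
  proof -
    obtain f where f: "f \<in> regular_at X P" "x = germ_of X P f"
      using x by (auto simp: carrier_stalk)
    then show ?thesis
      by (intro bexI[of _ "germ_of X P (\<lambda>x. - f x)"]) (auto simp: simps regular.uminus)
  qed
  then have "cring (stalk X P)"
    by (intro cringI abelian_groupI comm_monoidI)
      (auto simp: simps algebra_simps)
  then show ?thesis
    by (intro algebraI cring_complex_field) (auto simp: simps algebra_simps)
qed

lemma ideal_stalk_germs:
  "ideal_stalk X Y P =
    germ_of X P ` {f \<in> regular_at X P. \<forall>\<^sub>F x in near X P. x \<in> Y \<longrightarrow> f x = 0}"
proof (intro equalityI subsetI)
  fix a assume "a \<in> ideal_stalk X Y P"
  then obtain U f where U: "a = germ X P U f" "openin (top_of X) U" "P \<in> U" "f \<in> reg X U"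
    "\<forall>x\<in>U \<inter> Y. f x = 0"
    by (auto simp: ideal_stalk_def ideal_sheaf_def)
  then have "\<forall>\<^sub>F x in near X P. x \<in> Y \<longrightarrow> f x = 0"
    by (intro eventually_nearI[of X U]) auto
  then show "a \<in> germ_of X P ` {f \<in> regular_at X P. \<forall>\<^sub>F x in near X P. x \<in> Y \<longrightarrow> f x = 0}"
    using U germ_eq_germ_of regular_at_reg by blast
next
  fix a assume "a \<in> germ_of X P ` {f \<in> regular_at X P. \<forall>\<^sub>F x in near X P. x \<in> Y \<longrightarrow> f x = 0}"
  then obtain f where f: "a = germ_of X P f" "f \<in> regular_at X P"
    "\<forall>\<^sub>F x in near X P. x \<in> Y \<longrightarrow> f x = 0" by blast
  obtain W where W: "openin (top_of X) W" "P \<in> W" "\<And>x. x \<in> W \<Longrightarrow> x \<in> Y \<longrightarrow> f x = 0"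
    using eventually_nearE[OF f(3) point_in] by metis
  obtain U where U: "openin (top_of X) U" "P \<in> U" "restrict f U \<in> reg X U"
    using f(2) by (auto simp: regular_at_def)
  have T: "openin (top_of X) (U \<inter> W)" "P \<in> U \<inter> W" using U W by auto
  have "restrict f (U \<inter> W) \<in> reg X (U \<inter> W)"
    by (rule presheafD[OF space_with_functions_presheaf[OF space] U(1) T(1) _ U(3)]) simp
  then have "restrict f (U \<inter> W) \<in> ideal_sheaf X Y (U \<inter> W)"
    using W(3) by (auto simp: ideal_sheaf_def)
  moreover have "a = germ X P (U \<inter> W) (restrict f (U \<inter> W))"
    unfolding f(1) germ_eq_germ_of[OF T]
    by (rule germ_of_cong, rule eventually_nearI[OF T]) simp
  ultimately show "a \<in> ideal_stalk X Y P"
    unfolding ideal_stalk_def using T by blast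
qed

end

section \<open>Lifting the coordinates of a smooth hypersurface\<close>

lemma prevariety_chartE:
  assumes "prevariety X" "P \<in> topspace (top_of X)"
  obtains U N Z \<phi> where "pointed_chart X U N Z \<phi> P"
proof -
  obtain \<U> where "\<Union>\<U> = topspace (top_of X)" "\<forall>U\<in>\<U>. \<exists>N Z \<phi>. affine_chart X U N Z \<phi>"
    using assms(1) unfolding prevariety_def by blast
  then obtain U N Z \<phi> where "P \<in> U" "affine_chart X U N Z \<phi>"
    using assms(2) by blast
  moreover have "presheaf X"
    using assms(1) by (simp add: prevariety_def space_with_functions_presheaf)
  ultimately show ?thesis using that by (simp add: pointed_chart_def)
qed

lemma regular_at_inverse:
  assumes "prevariety X" "f \<in> regular_at X P" "f P \<noteq> 0"
  shows "\<forall>\<^sub>F x in near X P. f x \<noteq> 0" and "(\<lambda>x. 1 / f x) \<in> regular_at X P"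
proof -
  obtain U N Z \<phi> where chart: "pointed_chart X U N Z \<phi> P"
    using prevariety_chartE[OF assms(1) regular_at_topspace[OF assms(2)]] .
  show "\<forall>\<^sub>F x in near X P. f x \<noteq> 0" and "(\<lambda>x. 1 / f x) \<in> regular_at X P"
    by (rule pointed_chart.eventually_regular_nonzero[OF chart assms(2,3)])+
qed

lemma openin_regular_nonzero:
  assumes X: "prevariety X" and W: "openin (top_of X) W" and f: "restrict f W \<in> reg X W"
  shows "openin (top_of X) {x \<in> W. f x \<noteq> 0}"
proof (subst openin_subopen, intro ballI)
  fix Q assume Q: "Q \<in> {x \<in> W. f x \<noteq> 0}"
  then have "f \<in> regular_at X Q" using W f by (auto simp: regular_at_def)
  from regular_at_inverse(1)[OF X this] Q have ev: "\<forall>\<^sub>F x in near X Q. f x \<noteq> 0" by simp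
  have "Q \<in> topspace (top_of X)" using Q openin_subset[OF W] by blast
  from eventually_nearE[OF ev this] obtain T where
    "openin (top_of X) T" "Q \<in> T" "\<And>x. x \<in> T \<Longrightarrow> f x \<noteq> 0" by blast
  then show "\<exists>T. openin (top_of X) T \<and> Q \<in> T \<and> T \<subseteq> {x \<in> W. f x \<noteq> 0}"
    using Q W by (intro exI[of _ "T \<inter> W"]) auto
qed

text \<open>The loci in a neighbourhood \<open>W\<close> of \<open>P\<close> where \<open>f\<close>
  and where \<open>g\<close> is nonzero are open in \<open>X\<close> and disjoint. Irreducibility
  forbids two disjoint nonempty open sets, so one of the functions is zero on
  \<open>W\<close>.\<close>

lemma irreducible_variety_regular_integral:
  assumes X: "irreducible_variety X"
    and f: "f \<in> regular_at X P" and g: "g \<in> regular_at X P"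
    and fg: "\<forall>\<^sub>F x in near X P. f x * g x = 0"
  shows "(\<forall>\<^sub>F x in near X P. f x = 0) \<or> (\<forall>\<^sub>F x in near X P. g x = 0)"
proof -
  have pre: "prevariety X" and presheaf: "presheaf X"
    using X by (auto simp: irreducible_variety_def variety_def prevariety_def
        space_with_functions_presheaf)
  obtain U where U: "openin (top_of X) U" "P \<in> U" "restrict f U \<in> reg X U"
    using f by (auto simp: regular_at_def)
  obtain V where V: "openin (top_of X) V" "P \<in> V" "restrict g V \<in> reg X V"
    using g by (auto simp: regular_at_def)
  obtain T where T: "openin (top_of X) T" "P \<in> T" "\<And>x. x \<in> T \<Longrightarrow> f x * g x = 0"
    using eventually_nearE[OF fg regular_at_topspace[OF f]] by blast
  define W where "W = U \<inter> V \<inter> T"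
  have W: "openin (top_of X) W" "P \<in> W" using U V T by (auto simp: W_def)
  have fW: "restrict f W \<in> reg X W"
    by (rule presheafD[OF presheaf U(1) W(1) _ U(3)]) (auto simp: W_def)
  have gW: "restrict g W \<in> reg X W"
    by (rule presheafD[OF presheaf V(1) W(1) _ V(3)]) (auto simp: W_def)
  define F where "F = {x \<in> W. f x \<noteq> 0}"
  define G where "G = {x \<in> W. g x \<noteq> 0}"
  have FG: "openin (top_of X) F" "openin (top_of X) G"
    unfolding F_def G_def by (rule openin_regular_nonzero[OF pre W(1)] fW gW)+
  have "F \<inter> G = {}" using T(3) by (auto simp: F_def G_def W_def)
  then have "(topspace (top_of X) - F) \<union> (topspace (top_of X) - G) = topspace (top_of X)" by blast
  moreover have "closedin (top_of X) (topspace (top_of X) - F)"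
    "closedin (top_of X) (topspace (top_of X) - G)"
    using FG by auto
  ultimately have "topspace (top_of X) - F = topspace (top_of X)
      \<or> topspace (top_of X) - G = topspace (top_of X)"
    using X unfolding irreducible_variety_def by blast
  then have "F = {} \<or> G = {}"
    using FG openin_subset by blast
  then show ?thesis
    using eventually_nearI[OF W, of "\<lambda>x. f x = 0"] eventually_nearI[OF W, of "\<lambda>x. g x = 0"]
    by (auto simp: F_def G_def)
qed

text \<open>The geometry behind the lifting, put in terms of functions near \<open>P\<close>: those
  nonzero at \<open>P\<close> are units, and \<open>e\<close> generates those that vanish on
  \<open>Y\<close>.\<close>

locale hypersurface_point = pointed_space +
  fixes Y :: "'a set" and e
  assumes regular_inverse: "f \<in> regular_at X P \<Longrightarrow> f P \<noteq> 0 \<Longrightarrow> (\<lambda>x. 1 / f x) \<in> regular_at X P"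
    and regular_nonzero: "f \<in> regular_at X P \<Longrightarrow> f P \<noteq> 0 \<Longrightarrow> \<forall>\<^sub>F x in near X P. f x \<noteq> 0"
    and point_Y: "P \<in> Y"
    and equation_regular: "e \<in> regular_at X P"
    and equation_vanishes: "\<forall>\<^sub>F x in near X P. x \<in> Y \<longrightarrow> e x = 0"
    and equation_generates: "f \<in> regular_at X P \<Longrightarrow> \<forall>\<^sub>F x in near X P. x \<in> Y \<longrightarrow> f x = 0 \<Longrightarrow>
      \<exists>r\<in>regular_at X P. \<forall>\<^sub>F x in near X P. f x = e x * r x"
begin

text \<open>By the Taylor formula the new value is \<open>e^(m+1)\<close> times the sum of
  \<open>r k\<close> and the differential of \<open>g k\<close> applied to \<open>\<rho>\<close>, up
  to a multiple of \<open>e^(2m+2)\<close>. The choice of \<open>\<rho>\<close> makes that sum zero,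
  and \<open>2m+2\<close> is at least \<open>m+2\<close>. The exponent is written
  \<open>Suc m\<close> because a step starting from exponent zero would gain nothing.\<close>

lemma newton_step:
  fixes g :: "nat \<Rightarrow> (nat \<Rightarrow> complex) \<Rightarrow> complex"
  assumes g: "\<And>k. k < c \<Longrightarrow> g k \<in> poly_fun N"
    and jacobian: "\<And>l. \<forall>i<N. (\<Sum>k<c. l k * partial_deriv i (g k) (s P)) = 0 \<Longrightarrow> \<forall>k<c. l k = 0"
    and s: "\<And>i. i < N \<Longrightarrow> (\<lambda>x. s x i) \<in> regular_at X P"
    and r: "\<And>k. k < c \<Longrightarrow> r k \<in> regular_at X P"
    and eq: "\<And>k. k < c \<Longrightarrow> \<forall>\<^sub>F x in near X P. g k (s x) = e x ^ Suc m * r k x"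
  shows "\<exists>\<rho>. (\<forall>i<N. (\<lambda>x. \<rho> x i) \<in> regular_at X P) \<and> (\<forall>k<c. \<exists>R\<in>regular_at X P.
      \<forall>\<^sub>F x in near X P. g k (\<lambda>i. s x i + e x ^ Suc m * \<rho> x i) = e x ^ Suc (Suc m) * R x)"
proof -
  have "\<exists>M d. d \<in> poly_fun N \<and> d (s P) \<noteq> 0 \<and> (\<forall>i<N. \<forall>l<c. M i l \<in> poly_fun N)
    \<and> (\<forall>x. \<forall>k<c. \<forall>l<c. (\<Sum>i<N. partial_deriv i (g k) x * M i l x) = (if k = l then d x else 0))"
    by (rule poly_fun_right_inverse[where v = "\<lambda>k i. partial_deriv i (g k)"])
      (use g partial_deriv_poly_fun jacobian in auto)
  then obtain M d where Md: "d \<in> poly_fun N \<and> d (s P) \<noteq> 0 \<and> (\<forall>i<N. \<forall>l<c. M i l \<in> poly_fun N)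
    \<and> (\<forall>x. \<forall>k<c. \<forall>l<c. (\<Sum>i<N. partial_deriv i (g k) x * M i l x) = (if k = l then d x else 0))"
    by (elim exE)
  then have d: "d \<in> poly_fun N" "d (s P) \<noteq> 0"
    and M: "\<And>i l. i < N \<Longrightarrow> l < c \<Longrightarrow> M i l \<in> poly_fun N" by blast+
  have inv: "(\<Sum>i<N. partial_deriv i (g k) x * M i l x) = (if k = l then d x else 0)"
    if "k < c" "l < c" for x k l
    using Md that by simp
  have ds: "(\<lambda>x. d (s x)) \<in> regular_at X P" by (rule regular.poly_fun_comp[OF d(1) s])
  \<comment> \<open>Solves \<open>J \<rho> = - r\<close>, where the Jacobian matrix \<open>J\<close>
    has the right inverse \<open>M / d\<close>; dividing is legitimate near \<open>P\<close> because
    \<open>d\<close> is nonzero at \<open>s P\<close>.\<close>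
  define \<rho> where "\<rho> x i = - (\<Sum>l<c. M i l (s x) * r l x) * (1 / d (s x))" for x i
  have \<rho>: "(\<lambda>x. \<rho> x i) \<in> regular_at X P" if "i < N" for i
    unfolding \<rho>_def
  proof (intro regular.mult regular.uminus regular.sum)
    show "(\<lambda>x. M i l (s x)) \<in> regular_at X P" if "l \<in> {..<c}" for l
      using that \<open>i < N\<close> by (intro regular.poly_fun_comp[OF M s]) auto
    show "(\<lambda>x. 1 / d (s x)) \<in> regular_at X P"
      by (rule regular_inverse[OF ds d(2)])
  qed (use r in auto)
  have "\<exists>R\<in>regular_at X P. \<forall>\<^sub>F x in near X P.
      g k (\<lambda>i. s x i + e x ^ Suc m * \<rho> x i) = e x ^ Suc (Suc m) * R x" if k: "k < c" for k
  proof -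
    have "\<exists>R\<in>regular_at X P. \<forall>x. g k (\<lambda>i. s x i + e x ^ Suc m * \<rho> x i) =
        g k (s x) + e x ^ Suc m * (\<Sum>i<N. partial_deriv i (g k) (s x) * \<rho> x i)
          + (e x ^ Suc m)\<^sup>2 * R x"
      by (rule regular.poly_fun_taylor[OF g[OF k] s \<rho> regular.power[OF equation_regular]])
    then obtain R where R: "R \<in> regular_at X P" "\<And>x. g k (\<lambda>i. s x i + e x ^ Suc m * \<rho> x i) =
        g k (s x) + e x ^ Suc m * (\<Sum>i<N. partial_deriv i (g k) (s x) * \<rho> x i)
          + (e x ^ Suc m)\<^sup>2 * R x"
      by (elim bexE) simp
    have deriv: "(\<Sum>i<N. partial_deriv i (g k) y * \<rho> x i) = - r k x"
      if "y = s x" "d (s x) \<noteq> 0" for x y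
    proof -
      have "(\<Sum>i<N. partial_deriv i (g k) y * \<rho> x i) =
          - (1 / d y) * (\<Sum>i<N. \<Sum>l<c. partial_deriv i (g k) y * M i l y * r l x)"
        unfolding \<rho>_def sum_distrib_left sum_distrib_right sum_negf[symmetric] that(1)
        by (intro sum.cong refl) (simp add: sum_distrib_left sum_distrib_right algebra_simps sum_negf)
      also have "(\<Sum>i<N. \<Sum>l<c. partial_deriv i (g k) y * M i l y * r l x) =
          (\<Sum>l<c. (\<Sum>i<N. partial_deriv i (g k) y * M i l y) * r l x)"
        unfolding sum_distrib_right by (rule sum.swap)
      also have "\<dots> = (\<Sum>l<c. if l = k then d y * r l x else 0)"
        using k by (intro sum.cong refl) (auto simp: inv)
      also have "\<dots> = d y * r k x" using k by simp
      finally show ?thesis using that by simp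
    qed
    have "\<forall>\<^sub>F x in near X P. d (s x) \<noteq> 0"
      by (rule regular_nonzero[OF ds d(2)])
    with eq[OF k] have "\<forall>\<^sub>F x in near X P.
        g k (\<lambda>i. s x i + e x ^ Suc m * \<rho> x i) = e x ^ Suc (Suc m) * (e x ^ m * R x)"
    proof eventually_elim
      case (elim x)
      have "(e x ^ Suc m)\<^sup>2 = e x ^ Suc (Suc m) * e x ^ m"
        by (simp flip: power_mult power_add) (simp add: power2_eq_square flip: power_add)
      then show ?case
        unfolding R(2) deriv[OF refl elim(2)] elim(1) by (simp add: algebra_simps)
    qed
    moreover have "(\<lambda>x. e x ^ m * R x) \<in> regular_at X P"
      by (intro regular.mult regular.power equation_regular R(1))
    ultimately show ?thesis by (rule bexI)
  qed
  then show ?thesis using \<rho> by blast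
qed

text \<open>The exponent begins at one because \<open>g k (s x)\<close> vanishes on \<open>Y\<close>
  and is therefore divisible by \<open>e\<close>. Corrections are multiples of \<open>e\<close>, so
  they change neither the values on \<open>Y\<close> nor those at \<open>P\<close>, and the Jacobian
  condition survives every step.\<close>

lemma newton_lift:
  fixes g :: "nat \<Rightarrow> (nat \<Rightarrow> complex) \<Rightarrow> complex"
  assumes g: "\<And>k. k < c \<Longrightarrow> g k \<in> poly_fun N"
    and jacobian: "\<And>l. \<forall>i<N. (\<Sum>k<c. l k * partial_deriv i (g k) (s P)) = 0 \<Longrightarrow> \<forall>k<c. l k = 0"
    and s: "\<And>i. i < N \<Longrightarrow> (\<lambda>x. s x i) \<in> regular_at X P"
    and zero: "\<And>k. k < c \<Longrightarrow> \<forall>\<^sub>F x in near X P. x \<in> Y \<longrightarrow> g k (s x) = 0"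
  shows "\<exists>u. (\<forall>i<N. (\<lambda>x. u x i) \<in> regular_at X P)
    \<and> (\<forall>i<N. \<forall>\<^sub>F x in near X P. x \<in> Y \<longrightarrow> u x i = s x i)
    \<and> (\<forall>k<c. \<exists>r\<in>regular_at X P. \<forall>\<^sub>F x in near X P. g k (u x) = e x ^ Suc m * r x)"
proof (induction m)
  case 0
  have "\<exists>r\<in>regular_at X P. \<forall>\<^sub>F x in near X P. g k (s x) = e x ^ Suc 0 * r x" if "k < c" for k
  proof -
    have "(\<lambda>x. g k (s x)) \<in> regular_at X P"
      by (rule regular.poly_fun_comp[OF g[OF that] s])
    from equation_generates[OF this zero[OF that]] show ?thesis by simp
  qed
  then show ?case using s by (intro exI[of _ s]) simp
next
  case (Suc m)
  then obtain u where u: "\<And>i. i < N \<Longrightarrow> (\<lambda>x. u x i) \<in> regular_at X P"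
    "\<And>i. i < N \<Longrightarrow> \<forall>\<^sub>F x in near X P. x \<in> Y \<longrightarrow> u x i = s x i"
    "\<forall>k<c. \<exists>r\<in>regular_at X P. \<forall>\<^sub>F x in near X P. g k (u x) = e x ^ Suc m * r x" by blast
  obtain r where r: "\<And>k. k < c \<Longrightarrow> r k \<in> regular_at X P"
    "\<And>k. k < c \<Longrightarrow> \<forall>\<^sub>F x in near X P. g k (u x) = e x ^ Suc m * r k x"
    using u(3) by metis
  have "u P i = s P i" if "i < N" for i
    using eventually_near_at[OF u(2)[OF that] point_in] point_Y by simp
  then have "partial_deriv i (g k) (u P) = partial_deriv i (g k) (s P)" if "k < c" for i k
    by (intro poly_fun_cong[OF partial_deriv_poly_fun[OF g[OF that]]])
  then have jac_u: "\<forall>k<c. l k = 0"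
    if "\<forall>i<N. (\<Sum>k<c. l k * partial_deriv i (g k) (u P)) = 0" for l
    using that by (intro jacobian) simp
  have "\<exists>\<rho>. (\<forall>i<N. (\<lambda>x. \<rho> x i) \<in> regular_at X P) \<and> (\<forall>k<c. \<exists>R\<in>regular_at X P.
      \<forall>\<^sub>F x in near X P. g k (\<lambda>i. u x i + e x ^ Suc m * \<rho> x i) = e x ^ Suc (Suc m) * R x)"
    by (rule newton_step) (fact g jac_u u(1) r)+
  then obtain \<rho> where
    \<rho>: "\<And>i. i < N \<Longrightarrow> (\<lambda>x. \<rho> x i) \<in> regular_at X P"
    "\<forall>k<c. \<exists>R\<in>regular_at X P. \<forall>\<^sub>F x in near X P.
      g k (\<lambda>i. u x i + e x ^ Suc m * \<rho> x i) = e x ^ Suc (Suc m) * R x" by blast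
  have "\<forall>\<^sub>F x in near X P. x \<in> Y \<longrightarrow> u x i + e x ^ Suc m * \<rho> x i = s x i" if "i < N" for i
    using u(2)[OF that] equation_vanishes by eventually_elim simp
  moreover have "(\<lambda>x. u x i + e x ^ Suc m * \<rho> x i) \<in> regular_at X P" if "i < N" for i
    by (intro regular.add regular.mult regular.power equation_regular u(1) \<rho>(1) that)
  ultimately show ?case
    using \<rho>(2) by (intro exI[of _ "\<lambda>x i. u x i + e x ^ Suc m * \<rho> x i"]) simp
qed

lemma germ_of_power:
  fixes n :: nat
  assumes "f \<in> regular_at X P"
  shows "germ_of X P f [^]\<^bsub>stalk X P\<^esub> n = germ_of X P (\<lambda>x. f x ^ n)"
proof -
  interpret A: algebra complex_field "stalk X P" by (rule stalk_algebra)
  show ?thesis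
    using assms by (induction n) (simp_all add: germ_const germ_mult regular.power mult.commute)
qed

text \<open>Packs the outcome of the lifting into properties of a subset of the stalk, so that the
  section and the tensor decomposition become pure algebra.\<close>

lemma smooth_complement:
  fixes n :: nat
  assumes Y: "smooth_at (induced X Y) P" and n: "n \<ge> 1"
  shows "\<exists>S. S \<subseteq> carrier (stalk X P) \<and> \<one>\<^bsub>stalk X P\<^esub> \<in> S
    \<and> (\<forall>a\<in>S. \<forall>b\<in>S. a \<oplus>\<^bsub>stalk X P\<^esub> b \<in> S \<and> a \<otimes>\<^bsub>stalk X P\<^esub> b \<in> S)
    \<and> (\<forall>c. \<forall>a\<in>S. c \<odot>\<^bsub>stalk X P\<^esub> a \<in> S)
    \<and> (\<forall>a\<in>carrier (stalk X P). \<exists>b\<in>S. \<exists>i\<in>ideal_stalk X Y P. a = i \<oplus>\<^bsub>stalk X P\<^esub> b)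
    \<and> S \<inter> ideal_stalk X Y P \<subseteq> PIdl\<^bsub>stalk X P\<^esub> (germ_of X P e [^]\<^bsub>stalk X P\<^esub> n)"
proof -
  obtain U N Z \<phi> c g where chart: "affine_chart (induced X Y) U N Z \<phi>" "P \<in> U"
    and g: "\<forall>k<c. g k \<in> vanishing_ideal N Z"
    and gen: "\<forall>p\<in>vanishing_ideal N Z. \<exists>h\<in>poly_fun N. h (\<phi> P) \<noteq> 0 \<and>
      (\<exists>a. (\<forall>k<c. a k \<in> poly_fun N) \<and> (\<forall>x. h x * p x = (\<Sum>k<(c::nat). a k x * g k x)))"
    and jac: "\<forall>l. (\<forall>i<N. (\<Sum>k<c. l k * partial_deriv i (g k) (\<phi> P)) = 0) \<longrightarrow> (\<forall>k<c. l k = 0)"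
    using Y unfolding smooth_at_def by (elim exE conjE)
  have preX: "presheaf X" by (rule space_with_functions_presheaf[OF space])
  interpret Y: pointed_chart "induced X Y" U N Z \<phi> P
    using chart presheaf_induced[OF preX] by unfold_locales
  note near_Y = eventually_near_induced[OF point_Y]
  have gp: "g k \<in> poly_fun N" if "k < c" for k
    using g that by (auto simp: vanishing_ideal_def)
  have "\<exists>t\<in>regular_at X P. \<forall>\<^sub>F x in near X P. x \<in> Y \<longrightarrow> \<phi> x i = t x" if i: "i < N" for i
  proof -
    have "(\<lambda>x. \<phi> x i / 1) \<in> regular_at (induced X Y) P"
      by (rule Y.regular_at_fraction) (use i in \<open>auto intro: poly_fun.intros\<close>)
    then show ?thesis unfolding regular_at_induced[OF preX point_Y] by simp
  qed
  \<comment> \<open>The chart coordinates \<open>\<phi> x i\<close> are meaningful only on a part of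
    \<open>Y\<close>; \<open>t i\<close> extends one of them to a function on \<open>X\<close> that
    is regular near \<open>P\<close>.\<close>
  then obtain t where t: "\<And>i. i < N \<Longrightarrow> t i \<in> regular_at X P"
    "\<And>i. i < N \<Longrightarrow> \<forall>\<^sub>F x in near X P. x \<in> Y \<longrightarrow> \<phi> x i = t i x" by metis
  have tY: "\<forall>\<^sub>F x in near X P. x \<in> Y \<longrightarrow> (\<forall>i<N. t i x = \<phi> x i)"
  proof -
    have "\<forall>\<^sub>F x in near X P. \<forall>i\<in>{..<N}. x \<in> Y \<longrightarrow> \<phi> x i = t i x"
      using t(2) by (intro eventually_ball_finite) auto
    then show ?thesis by eventually_elim auto
  qed
  define s where "s x i = t i x" for x i
  have tP: "s P i = \<phi> P i" if "i < N" for i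
    using eventually_near_at[OF tY point_in] point_Y that by (simp add: s_def)
  have jac_s: "\<forall>k<c. l k = 0" if "\<forall>i<N. (\<Sum>k<c. l k * partial_deriv i (g k) (s P)) = 0" for l
  proof -
    have "partial_deriv i (g k) (s P) = partial_deriv i (g k) (\<phi> P)" if "k < c" for i k
      by (rule poly_fun_cong[OF partial_deriv_poly_fun[OF gp[OF that]] tP])
    then show ?thesis using that jac by simp
  qed
  have g_s: "\<forall>\<^sub>F x in near X P. x \<in> Y \<longrightarrow> g k (s x) = 0" if k: "k < c" for k
  proof -
    have "\<forall>\<^sub>F x in near X P. x \<in> Y \<longrightarrow> x \<in> U"
      using Y.eventually_domain unfolding near_Y .
    with tY show ?thesis
    proof eventually_elim
      case (elim x)
      show ?case
      proof
        assume x: "x \<in> Y"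
        have "\<phi> x \<in> Z" using elim x Y.chart_maps by blast
        then have "g k (\<phi> x) = 0" using g k by (auto simp: vanishing_ideal_def)
        moreover have "g k (s x) = g k (\<phi> x)"
          by (rule poly_fun_cong[OF gp[OF k]]) (use elim x in \<open>simp add: s_def\<close>)
        ultimately show "g k (s x) = 0" by simp
      qed
    qed
  qed
  have s_regular: "(\<lambda>x. s x i) \<in> regular_at X P" if "i < N" for i
    using t(1)[OF that] by (simp add: s_def)
  \<comment> \<open>\<open>newton_lift\<close> produces the exponent \<open>Suc m\<close>; this is
    where \<open>n \<ge> 1\<close> enters.\<close>
  obtain m where m: "n = Suc m" using n by (cases n) auto
  have "\<exists>u. (\<forall>i<N. (\<lambda>x. u x i) \<in> regular_at X P)
    \<and> (\<forall>i<N. \<forall>\<^sub>F x in near X P. x \<in> Y \<longrightarrow> u x i = s x i)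
    \<and> (\<forall>k<c. \<exists>r\<in>regular_at X P. \<forall>\<^sub>F x in near X P. g k (u x) = e x ^ Suc m * r x)"
    by (rule newton_lift) (fact gp jac_s s_regular g_s)+
  then obtain u where u: "\<And>i. i < N \<Longrightarrow> (\<lambda>x. u x i) \<in> regular_at X P"
    "\<And>i. i < N \<Longrightarrow> \<forall>\<^sub>F x in near X P. x \<in> Y \<longrightarrow> u x i = s x i"
    "\<forall>k<c. \<exists>r\<in>regular_at X P. \<forall>\<^sub>F x in near X P. g k (u x) = e x ^ n * r x"
    unfolding m by blast
  from u(3) have "\<forall>k. \<exists>r. k < c \<longrightarrow>
      r \<in> regular_at X P \<and> (\<forall>\<^sub>F x in near X P. g k (u x) = e x ^ n * r x)" by blast
  from choice[OF this] obtain r where r: "\<And>k. k < c \<Longrightarrow> r k \<in> regular_at X P"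
    "\<And>k. k < c \<Longrightarrow> \<forall>\<^sub>F x in near X P. g k (u x) = e x ^ n * r k x"
    by auto
  have uY: "\<forall>\<^sub>F x in near X P. x \<in> Y \<longrightarrow> (\<forall>i<N. u x i = \<phi> x i)"
  proof -
    have "\<forall>\<^sub>F x in near X P. \<forall>i\<in>{..<N}. x \<in> Y \<longrightarrow> u x i = s x i"
      using u(2) by (intro eventually_ball_finite) auto
    with tY show ?thesis by eventually_elim (auto simp: s_def)
  qed
  have poly_uY: "\<forall>\<^sub>F x in near X P. x \<in> Y \<longrightarrow> p (u x) = p (\<phi> x)" if "p \<in> poly_fun N" for p
    using uY by eventually_elim (auto intro: poly_fun_cong[OF that])
  have poly_uP: "p (u P) = p (\<phi> P)" if "p \<in> poly_fun N" for p
    using eventually_near_at[OF poly_uY[OF that] point_in] point_Y by simp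
  have pu: "(\<lambda>x. p (u x)) \<in> regular_at X P" if "p \<in> poly_fun N" for p
    by (rule regular.poly_fun_comp[OF that u(1)])
  \<comment> \<open>Division is total, so this is a function on the whole space; for pairs in
    \<open>D\<close> below, \<open>q\<close> is nonzero at \<open>u P\<close> and hence the fraction
    is regular near \<open>P\<close>.\<close>
  define fract where "fract p q = (\<lambda>x. p (u x) * (1 / q (u x)))"
    for p q :: "(nat \<Rightarrow> complex) \<Rightarrow> complex"
  define D where "D = {(p, q). p \<in> poly_fun N \<and> q \<in> poly_fun N \<and> q (u P) \<noteq> 0}"
  define S where "S = (\<lambda>(p, q). germ_of X P (fract p q)) ` D"
  have fract: "fract p q \<in> regular_at X P" if "(p, q) \<in> D" for p q
    unfolding fract_def using that
    by (intro regular.mult pu regular_inverse) (auto simp: D_def pu)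
  have den: "\<forall>\<^sub>F x in near X P. q (u x) \<noteq> 0" if "(p, q) \<in> D" for p q
    using that by (intro regular_nonzero pu) (auto simp: D_def)
  have SI: "germ_of X P (fract p q) \<in> S" if "(p, q) \<in> D" for p q
    using that by (auto simp: S_def)
  have SE: "\<exists>p q. (p, q) \<in> D \<and> a = germ_of X P (fract p q)" if "a \<in> S" for a
    using that by (auto simp: S_def)
  have S_add: "a \<oplus>\<^bsub>stalk X P\<^esub> b \<in> S" and S_mult: "a \<otimes>\<^bsub>stalk X P\<^esub> b \<in> S"
    if ab: "a \<in> S" "b \<in> S" for a b
  proof -
    obtain p q p' q' where pq: "(p, q) \<in> D" "a = germ_of X P (fract p q)"
      "(p', q') \<in> D" "b = germ_of X P (fract p' q')"
      using SE ab by metis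
    have D1: "(\<lambda>x. p x * q' x + p' x * q x, \<lambda>x. q x * q' x) \<in> D"
      and D2: "(\<lambda>x. p x * p' x, \<lambda>x. q x * q' x) \<in> D"
      using pq(1,3) by (auto simp: D_def intro!: poly_fun.intros)
    have "\<forall>\<^sub>F x in near X P. fract p q x + fract p' q' x =
        fract (\<lambda>x. p x * q' x + p' x * q x) (\<lambda>x. q x * q' x) x"
      using den[OF pq(1)] den[OF pq(3)] by eventually_elim (simp add: fract_def field_simps)
    then show "a \<oplus>\<^bsub>stalk X P\<^esub> b \<in> S"
      using SI[OF D1] by (simp add: pq germ_add fract germ_of_cong)
    have "\<forall>\<^sub>F x in near X P. fract p q x * fract p' q' x = fract (\<lambda>x. p x * p' x) (\<lambda>x. q x * q' x) x"
      using den[OF pq(1)] den[OF pq(3)] by eventually_elim (simp add: fract_def field_simps)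
    then show "a \<otimes>\<^bsub>stalk X P\<^esub> b \<in> S"
      using SI[OF D2] by (simp add: pq germ_mult fract germ_of_cong)
  qed
  have S_smult: "z \<odot>\<^bsub>stalk X P\<^esub> a \<in> S" if a: "a \<in> S" for z a
  proof -
    obtain p q where pq: "(p, q) \<in> D" "a = germ_of X P (fract p q)"
      using SE a by metis
    have D1: "(\<lambda>x. z * p x, q) \<in> D"
      using pq(1) by (auto simp: D_def intro!: poly_fun.intros)
    have "(\<lambda>x. z * fract p q x) = fract (\<lambda>x. z * p x) q"
      by (simp add: fract_def fun_eq_iff)
    then show ?thesis
      using SI[OF D1] by (simp add: pq germ_smult fract)
  qed
  have S_one: "\<one>\<^bsub>stalk X P\<^esub> \<in> S"
  proof -
    have "(\<lambda>_. 1, \<lambda>_. 1) \<in> D" by (auto simp: D_def)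
    from SI[OF this] show ?thesis by (simp add: fract_def germ_const)
  qed
  \<comment> \<open>On \<open>Y\<close> the function \<open>f\<close> is a fraction in the chart
    coordinates, with which \<open>u\<close> agrees there. The same fraction in \<open>u\<close>
    therefore differs from \<open>f\<close> by a function vanishing on \<open>Y\<close>.\<close>
  have S_dense: "\<exists>b\<in>S. \<exists>i\<in>ideal_stalk X Y P. a = i \<oplus>\<^bsub>stalk X P\<^esub> b"
    if a: "a \<in> carrier (stalk X P)" for a
  proof -
    obtain f where f: "f \<in> regular_at X P" "a = germ_of X P f"
      using a by (auto simp: carrier_stalk)
    then have "f \<in> regular_at (induced X Y) P"
      unfolding regular_at_induced[OF preX point_Y] by (intro bexI[of _ f]) auto
    then obtain p q where pq: "p \<in> poly_fun N" "q \<in> poly_fun N" "q (\<phi> P) \<noteq> 0"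
      "\<forall>\<^sub>F x in near (induced X Y) P. f x = p (\<phi> x) / q (\<phi> x)"
      using Y.regular_at_fractionE by metis
    have D1: "(p, q) \<in> D" using pq poly_uP[OF pq(2)] by (simp add: D_def)
    have "\<forall>\<^sub>F x in near X P. x \<in> Y \<longrightarrow> f x - fract p q x = 0"
      using pq(4)[unfolded near_Y] poly_uY[OF pq(1)] poly_uY[OF pq(2)]
      by eventually_elim (simp add: fract_def)
    then have "germ_of X P (\<lambda>x. f x - fract p q x) \<in> ideal_stalk X Y P"
      using f(1) fract[OF D1] by (auto simp: ideal_stalk_germs)
    moreover have "a = germ_of X P (\<lambda>x. f x - fract p q x) \<oplus>\<^bsub>stalk X P\<^esub> germ_of X P (fract p q)"
      using f fract[OF D1] by (subst germ_add) auto
    ultimately show ?thesis using SI[OF D1] by blast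
  qed
  have S_power: "a \<in> PIdl\<^bsub>stalk X P\<^esub> (germ_of X P e [^]\<^bsub>stalk X P\<^esub> n)"
    if a: "a \<in> S" "a \<in> ideal_stalk X Y P" for a
  proof -
    obtain p q where pq: "(p, q) \<in> D" "a = germ_of X P (fract p q)"
      using SE a by metis
    then have p: "p \<in> poly_fun N" and q: "q \<in> poly_fun N" "q (u P) \<noteq> 0"
      by (auto simp: D_def)
    obtain f where f: "\<forall>\<^sub>F x in near X P. x \<in> Y \<longrightarrow> f x = 0" "a = germ_of X P f"
      using a(2) by (auto simp: ideal_stalk_germs)
    have "\<forall>\<^sub>F x in near X P. fract p q x = f x"
      using germ_of_eq_iff[OF fract[OF pq(1)], of f] f(2) pq(2) by simp
    then have "\<forall>\<^sub>F x in near X P. x \<in> Y \<longrightarrow> p (\<phi> x) = 0"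
      using f(1) den[OF pq(1)] poly_uY[OF p] by eventually_elim (auto simp: fract_def)
    then have "\<forall>\<^sub>F x in near (induced X Y) P. p (\<phi> x) = 0" unfolding near_Y .
    then obtain v where v: "v \<in> poly_fun N" "v (\<phi> P) \<noteq> 0" "(\<lambda>x. v x * p x) \<in> vanishing_ideal N Z"
      using Y.eventually_fraction_zeroE[OF p] by metis
    \<comment> \<open>The identity holds at all points, not only on \<open>Z\<close>. Below it is
      evaluated at \<open>u x\<close>, which need not lie in \<open>Z\<close>, and each
      \<open>g k (u x)\<close> contributes a factor \<open>e x ^ n\<close>.\<close>
    obtain h b where h: "h \<in> poly_fun N" "h (\<phi> P) \<noteq> 0" "\<forall>k<c. b k \<in> poly_fun N"
      "\<forall>x. h x * (v x * p x) = (\<Sum>k<c. b k x * g k x)"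
      using gen v(3) by meson
    \<comment> \<open>All denominators together: \<open>h\<close> from the relation with the
      generators, \<open>v\<close> from the passage to the vanishing ideal, \<open>q\<close> from
      the fraction. The first two are nonzero at \<open>u P\<close> because polynomials take the
      same value there as at \<open>\<phi> P\<close>.\<close>
    define w where "w x = h x * v x * q x" for x
    have w: "w \<in> poly_fun N" "w (u P) \<noteq> 0"
      using h v q poly_uP[OF h(1)] poly_uP[OF v(1)] unfolding w_def by (auto intro!: poly_fun.intros)
    define R where "R x = (\<Sum>k<c. b k (u x) * r k x) * (1 / w (u x))" for x
    have R: "R \<in> regular_at X P"
      unfolding R_def using h(3) r(1) w
      by (intro regular.mult regular.sum regular_inverse pu) auto
    have "\<forall>\<^sub>F x in near X P. \<forall>k\<in>{..<c}. g k (u x) = e x ^ n * r k x"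
      using r(2) by (intro eventually_ball_finite) auto
    moreover have "\<forall>\<^sub>F x in near X P. w (u x) \<noteq> 0"
      by (rule regular_nonzero[OF pu[OF w(1)] w(2)])
    ultimately have "\<forall>\<^sub>F x in near X P. fract p q x = R x * e x ^ n"
    proof eventually_elim
      case (elim x)
      have "h (u x) * (v (u x) * p (u x)) = (\<Sum>k<c. b k (u x) * (e x ^ n * r k x))"
        using h(4) elim(1) by simp
      also have "\<dots> = e x ^ n * (\<Sum>k<c. b k (u x) * r k x)"
        by (simp add: sum_distrib_left algebra_simps)
      finally have "fract p q x = e x ^ n * (\<Sum>k<c. b k (u x) * r k x) / w (u x)"
        using elim(2) unfolding w_def fract_def by (simp add: field_simps)
      then show ?case by (simp add: R_def)
    qed
    then have "a = germ_of X P R \<otimes>\<^bsub>stalk X P\<^esub> (germ_of X P e [^]\<^bsub>stalk X P\<^esub> n)"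
      using germ_of_cong R by (simp add: pq(2) germ_of_power equation_regular germ_mult regular.power)
    then show ?thesis
      using R by (auto simp: cgenideal_def carrier_stalk)
  qed
  have "S \<subseteq> carrier (stalk X P)"
    using fract by (auto simp: S_def carrier_stalk)
  then show ?thesis
    by (intro exI[of _ S] conjI ballI allI subsetI S_one S_add S_mult S_smult S_dense S_power)
      auto
qed

end

section \<open>Quotients of commutative algebras\<close>

lemma a_inv_complex_field [simp]: "a_inv complex_field x = - x"
proof -
  interpret cring complex_field by (rule cring_complex_field)
  show ?thesis using minus_equality[of "- x" x] by simp
qed

lemma (in abelian_monoid) finsum_lessThan_Suc:
  "f \<in> {..k} \<rightarrow> carrier G \<Longrightarrow> finsum G f {..<Suc k} = f k \<oplus> finsum G f {..<k}"
  by (subst lessThan_Suc, subst finsum_insert) (auto simp: Pi_def)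

lemma (in ideal) finsum_mem:
  "(\<And>i. i < k \<Longrightarrow> f i \<in> I) \<Longrightarrow> finsum R f {..<k} \<in> I" for k :: nat
proof (induction k)
  case (Suc k)
  then show ?case
    by (subst finsum_lessThan_Suc) (auto simp: Pi_def less_Suc_eq_le Icarr intro!: a_closed)
qed simp

text \<open>Fixes the scalars, so that the module laws can be restated with complex arithmetic
  instead of the operations of \<open>complex_field\<close>.\<close>

locale calg = algebra complex_field A for A (structure)
begin

lemma scale_closed [simp]: "x \<in> carrier A \<Longrightarrow> c \<odot> x \<in> carrier A"
  by (rule smult_closed) auto

lemma scale_add: "x \<in> carrier A \<Longrightarrow> (c + d) \<odot> x = c \<odot> x \<oplus> d \<odot> x"
  using smult_l_distr[of c d x] by simp

lemma scale_add_right: "x \<in> carrier A \<Longrightarrow> y \<in> carrier A \<Longrightarrow> c \<odot> (x \<oplus> y) = c \<odot> x \<oplus> c \<odot> y"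
  using smult_r_distr[of c x y] by simp

lemma scale_scale: "x \<in> carrier A \<Longrightarrow> c \<odot> (d \<odot> x) = (c * d) \<odot> x"
  using smult_assoc1[of c d x] by simp

lemma scale_one [simp]: "x \<in> carrier A \<Longrightarrow> 1 \<odot> x = x"
  using smult_one[of x] by simp

lemma scale_mult: "x \<in> carrier A \<Longrightarrow> y \<in> carrier A \<Longrightarrow> c \<odot> x \<otimes> y = c \<odot> (x \<otimes> y)"
  using smult_assoc2[of c x y] by simp

lemma scale_mult_right: "x \<in> carrier A \<Longrightarrow> y \<in> carrier A \<Longrightarrow> x \<otimes> (c \<odot> y) = c \<odot> (x \<otimes> y)"
  using scale_mult[of y x c] by (simp add: m_comm)

lemma scale_zero [simp]: "x \<in> carrier A \<Longrightarrow> 0 \<odot> x = \<zero>"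
  using smult_l_null[of x] by simp

lemma scale_neg: "x \<in> carrier A \<Longrightarrow> (- 1) \<odot> x = \<ominus> x"
  using smult_l_minus[of 1 x] by simp

end

lemma alg_quot_carrier:
  "carrier (alg_quot A I) = (\<lambda>x. I +>\<^bsub>A\<^esub> x) ` carrier A"
  by (auto simp: alg_quot_def ring.defs FactRing_simps)

lemma alg_quot_const:
  "\<one>\<^bsub>alg_quot A I\<^esub> = I +>\<^bsub>A\<^esub> \<one>\<^bsub>A\<^esub>" "\<zero>\<^bsub>alg_quot A I\<^esub> = I"
  by (simp_all add: alg_quot_def ring.defs FactRing_def)

lemma alg_quot_closed:
  "x \<in> carrier A \<Longrightarrow> I +>\<^bsub>A\<^esub> x \<in> carrier (alg_quot A I)"
  by (simp add: alg_quot_carrier)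

context
  fixes A :: "(complex, 'a, 'm) module_scheme" and I
  assumes A: "algebra complex_field A" and I: "ideal I A"
begin

interpretation A: calg A by (rule calg.intro[OF A])
interpretation I: ideal I A by (rule I)

lemma coset_eq_iff:
  "x \<in> carrier A \<Longrightarrow> y \<in> carrier A \<Longrightarrow>
    I +>\<^bsub>A\<^esub> x = I +>\<^bsub>A\<^esub> y \<longleftrightarrow> x \<ominus>\<^bsub>A\<^esub> y \<in> I"
  using A.quotient_eq_iff_same_a_r_cos[OF I] by blast

lemma coset_eq_zero_iff: "x \<in> carrier A \<Longrightarrow> I +>\<^bsub>A\<^esub> x = I \<longleftrightarrow> x \<in> I"
  using I.a_rcos_const I.rcos_const_imp_mem by blast

text \<open>Scalars act through multiples of the unit, so ideals are linear subspaces; this is what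
  makes the scalar action on cosets well defined.\<close>

lemma ideal_smult_closed: "x \<in> I \<Longrightarrow> c \<odot>\<^bsub>A\<^esub> x \<in> I"
proof -
  assume x: "x \<in> I"
  have "c \<odot>\<^bsub>A\<^esub> x = (c \<odot>\<^bsub>A\<^esub> \<one>\<^bsub>A\<^esub>) \<otimes>\<^bsub>A\<^esub> x"
    using I.Icarr[OF x] by (simp add: A.scale_mult)
  then show ?thesis using x by (simp add: I.I_l_closed)
qed

lemma alg_quot_add:
  "x \<in> carrier A \<Longrightarrow> y \<in> carrier A \<Longrightarrow>
    (I +>\<^bsub>A\<^esub> x) \<oplus>\<^bsub>alg_quot A I\<^esub> (I +>\<^bsub>A\<^esub> y) = I +>\<^bsub>A\<^esub> (x \<oplus>\<^bsub>A\<^esub> y)"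
  by (simp add: alg_quot_def ring.defs FactRing_def I.a_rcos_sum)

lemma alg_quot_mult:
  "x \<in> carrier A \<Longrightarrow> y \<in> carrier A \<Longrightarrow>
    (I +>\<^bsub>A\<^esub> x) \<otimes>\<^bsub>alg_quot A I\<^esub> (I +>\<^bsub>A\<^esub> y) = I +>\<^bsub>A\<^esub> (x \<otimes>\<^bsub>A\<^esub> y)"
  by (simp add: alg_quot_def ring.defs FactRing_def I.rcoset_mult_add)

lemma alg_quot_smult:
  assumes x: "x \<in> carrier A"
  shows "c \<odot>\<^bsub>alg_quot A I\<^esub> (I +>\<^bsub>A\<^esub> x) = I +>\<^bsub>A\<^esub> (c \<odot>\<^bsub>A\<^esub> x)"
proof -
  have "I +>\<^bsub>A\<^esub> (c \<odot>\<^bsub>A\<^esub> y) = I +>\<^bsub>A\<^esub> (c \<odot>\<^bsub>A\<^esub> x)" if y: "y \<in> I +>\<^bsub>A\<^esub> x" for y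
  proof -
    obtain i where i: "i \<in> I" "y = i \<oplus>\<^bsub>A\<^esub> x" using y by (auto simp: a_r_coset_def')
    have "c \<odot>\<^bsub>A\<^esub> y = c \<odot>\<^bsub>A\<^esub> i \<oplus>\<^bsub>A\<^esub> c \<odot>\<^bsub>A\<^esub> x"
      using i x I.Icarr by (simp add: A.scale_add_right)
    then have "c \<odot>\<^bsub>A\<^esub> y \<in> I +>\<^bsub>A\<^esub> (c \<odot>\<^bsub>A\<^esub> x)"
      using ideal_smult_closed[OF i(1)] by (auto simp: a_r_coset_def')
    then show ?thesis by (rule I.a_repr_independence'[symmetric]) (use x in simp)
  qed
  then have "(\<Union>y\<in>I +>\<^bsub>A\<^esub> x. I +>\<^bsub>A\<^esub> (c \<odot>\<^bsub>A\<^esub> y)) = (\<Union>y\<in>I +>\<^bsub>A\<^esub> x. I +>\<^bsub>A\<^esub> (c \<odot>\<^bsub>A\<^esub> x))"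
    by (intro SUP_cong refl)
  moreover have "I +>\<^bsub>A\<^esub> x \<noteq> {}" using I.a_rcos_self[OF x] by blast
  ultimately show ?thesis
    by (simp add: alg_quot_def ring.defs module.defs)
qed

lemmas alg_quot_simps = alg_quot_const alg_quot_add alg_quot_mult alg_quot_smult

lemma alg_quot_algebra: "algebra complex_field (alg_quot A I)"
proof -
  have inv: "\<exists>y\<in>carrier (alg_quot A I). y \<oplus>\<^bsub>alg_quot A I\<^esub> x = \<zero>\<^bsub>alg_quot A I\<^esub>"
    if x: "x \<in> carrier (alg_quot A I)" for x
  proof -
    obtain f where f: "f \<in> carrier A" "x = I +>\<^bsub>A\<^esub> f"
      using x by (auto simp: alg_quot_carrier)
    then show ?thesis
      by (intro bexI[of _ "I +>\<^bsub>A\<^esub> (\<ominus>\<^bsub>A\<^esub> f)"])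
        (auto simp: alg_quot_simps alg_quot_closed A.l_neg coset_eq_zero_iff)
  qed
  have zero: "I = I +>\<^bsub>A\<^esub> \<zero>\<^bsub>A\<^esub>" using coset_eq_zero_iff[of "\<zero>\<^bsub>A\<^esub>"] by simp
  have "cring (alg_quot A I)"
  proof (intro cringI abelian_groupI comm_monoidI)
    show "\<zero>\<^bsub>alg_quot A I\<^esub> \<in> carrier (alg_quot A I)"
      using zero by (auto simp: alg_quot_const alg_quot_carrier)
    show "\<zero>\<^bsub>alg_quot A I\<^esub> \<oplus>\<^bsub>alg_quot A I\<^esub> x = x" if "x \<in> carrier (alg_quot A I)" for x
      using that by (subst alg_quot_const(2), subst zero) (auto simp: alg_quot_carrier alg_quot_simps)
  qed (use inv in \<open>auto simp: alg_quot_carrier alg_quot_simps A.a_ac A.m_ac A.l_distr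
      A.r_distr\<close>)
  then show ?thesis
    by (intro algebraI cring_complex_field)
      (auto simp: alg_quot_carrier alg_quot_simps A.scale_add A.scale_add_right A.scale_scale
        A.scale_mult)
qed

lemma coset_calg_hom: "(\<lambda>x. I +>\<^bsub>A\<^esub> x) \<in> calg_hom A (alg_quot A I)"
  by (auto simp: calg_hom_def alg_quot_simps alg_quot_closed intro!: ring_hom_memI)

lemma alg_quot_lift:
  assumes D: "algebra complex_field D" and f: "f \<in> calg_hom A D"
    and ker: "\<And>x. x \<in> I \<Longrightarrow> f x = \<zero>\<^bsub>D\<^esub>"
  obtains g where "g \<in> calg_hom (alg_quot A I) D"
    and "\<And>x. x \<in> carrier A \<Longrightarrow> g (I +>\<^bsub>A\<^esub> x) = f x"
proof -
  interpret D: calg D by (rule calg.intro[OF D])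
  interpret f: ring_hom_cring A D f
    using f by unfold_locales (auto simp: calg_hom_def)
  define g where "g C = f (SOME x. x \<in> carrier A \<and> C = I +>\<^bsub>A\<^esub> x)" for C
  have g: "g (I +>\<^bsub>A\<^esub> x) = f x" if x: "x \<in> carrier A" for x
  proof -
    define y where "y = (SOME y. y \<in> carrier A \<and> I +>\<^bsub>A\<^esub> x = I +>\<^bsub>A\<^esub> y)"
    have y: "y \<in> carrier A \<and> I +>\<^bsub>A\<^esub> x = I +>\<^bsub>A\<^esub> y"
      unfolding y_def by (rule someI[of _ x]) (use x in auto)
    then have "f (y \<ominus>\<^bsub>A\<^esub> x) = \<zero>\<^bsub>D\<^esub>"
      using x coset_eq_iff[of y x] by (intro ker) auto
    moreover have "y = (y \<ominus>\<^bsub>A\<^esub> x) \<oplus>\<^bsub>A\<^esub> x"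
      using x y by (simp add: A.minus_eq A.a_assoc A.l_neg)
    then have "f y = f (y \<ominus>\<^bsub>A\<^esub> x) \<oplus>\<^bsub>D\<^esub> f x"
      using x y by (metis A.minus_closed f.hom_add)
    ultimately have "f y = f x" using x by simp
    then show ?thesis by (simp add: g_def y_def)
  qed
  have smult: "f (c \<odot>\<^bsub>A\<^esub> x) = c \<odot>\<^bsub>D\<^esub> f x" if "x \<in> carrier A" for c x
    using f that by (simp add: calg_hom_def)
  have "g \<in> calg_hom (alg_quot A I) D"
    unfolding calg_hom_def
    by (auto simp: alg_quot_carrier alg_quot_simps g smult intro!: ring_hom_memI)
  then show ?thesis using g by (rule that)
qed

end

text \<open>The isomorphism will be built as a map out of the tensor product, by the universal
  property, while the opposite direction is wanted.\<close>

lemma calg_iso_inverse: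
  assumes A: "algebra complex_field A" and B: "algebra complex_field B" and f: "f \<in> calg_iso A B"
  shows "inv_into (carrier A) f \<in> calg_iso B A"
proof -
  interpret A: calg A by (rule calg.intro[OF A])
  interpret B: calg B by (rule calg.intro[OF B])
  let ?g = "inv_into (carrier A) f"
  have hom: "f \<in> ring_hom A B" and smult: "\<And>c x. x \<in> carrier A \<Longrightarrow> f (c \<odot>\<^bsub>A\<^esub> x) = c \<odot>\<^bsub>B\<^esub> f x"
    and bij: "bij_betw f (carrier A) (carrier B)"
    using f by (auto simp: calg_iso_def calg_hom_def)
  have gbij: "bij_betw ?g (carrier B) (carrier A)" by (rule bij_betw_inv_into[OF bij])
  have inj: "inj_on f (carrier A)" using bij by (rule bij_betw_imp_inj_on)
  have fg: "f (?g y) = y" and gc: "?g y \<in> carrier A" if "y \<in> carrier B" for y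
    using bij that by (auto simp: bij_betw_inv_into_right bij_betw_apply[OF gbij])
  have eq: "?g y = x" if "x \<in> carrier A" "y = f x" for x y
    using inj that by simp
  have "?g \<in> ring_hom B A"
    by (intro ring_hom_memI gc eq)
      (auto simp: gc fg ring_hom_mult[OF hom] ring_hom_add[OF hom] ring_hom_one[OF hom])
  moreover have "?g (c \<odot>\<^bsub>B\<^esub> y) = c \<odot>\<^bsub>A\<^esub> ?g y" if "y \<in> carrier B" for c y
    using that by (intro eq) (auto simp: gc fg smult)
  ultimately show ?thesis
    using gbij by (simp add: calg_iso_def calg_hom_def)
qed

section \<open>Tensor products\<close>

definition support :: "('a \<Rightarrow> complex) \<Rightarrow> 'a set" where
  "support F = {z. F z \<noteq> 0}"

text \<open>Carries a coefficient, unlike \<open>pure_tensor\<close>, so that every finitely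
  supported function is a sum of such functions.\<close>

definition single :: "'a \<Rightarrow> complex \<Rightarrow> 'a \<Rightarrow> complex" where
  "single u c = (\<lambda>z. if z = u then c else 0)"

lemma pure_tensor_single: "pure_tensor a b = single (a, b) 1"
  by (simp add: pure_tensor_def single_def)

lemma support_single: "support (single u c) \<subseteq> {u}"
  by (auto simp: support_def single_def)

locale calg_pair = B: calg B + T: calg T
  for B :: "(complex, 'b, 'm) module_scheme" and T :: "(complex, 't, 'n) module_scheme"
begin

abbreviation F where "F \<equiv> free_product_alg B T"

definition pair_mult :: "'b \<times> 't \<Rightarrow> 'b \<times> 't \<Rightarrow> 'b \<times> 't" where
  "pair_mult u v = (fst u \<otimes>\<^bsub>B\<^esub> fst v, snd u \<otimes>\<^bsub>T\<^esub> snd v)"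

lemma pair_mult_closed:
  "u \<in> carrier B \<times> carrier T \<Longrightarrow> v \<in> carrier B \<times> carrier T \<Longrightarrow>
    pair_mult u v \<in> carrier B \<times> carrier T"
  by (auto simp: pair_mult_def)

lemma free_carrier: "G \<in> carrier F \<longleftrightarrow> finite (support G) \<and> support G \<subseteq> carrier B \<times> carrier T"
  by (simp add: free_product_alg_def support_def)

lemma free_simps:
  "\<one>\<^bsub>F\<^esub> = single (\<one>\<^bsub>B\<^esub>, \<one>\<^bsub>T\<^esub>) 1" "\<zero>\<^bsub>F\<^esub> = (\<lambda>_. 0)"
  "G \<oplus>\<^bsub>F\<^esub> H = (\<lambda>z. G z + H z)" "c \<odot>\<^bsub>F\<^esub> G = (\<lambda>z. c * G z)"
  by (simp_all add: free_product_alg_def pure_tensor_single)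

text \<open>Arbitrary finite supersets of the supports are allowed so that several products can be
  summed over one common index set.\<close>

lemma free_mult:
  assumes "finite S" "support G \<subseteq> S" "finite S'" "support H \<subseteq> S'"
  shows "G \<otimes>\<^bsub>F\<^esub> H = (\<lambda>z. \<Sum>u\<in>S. \<Sum>v\<in>S'. if pair_mult u v = z then G u * H v else 0)"
proof
  fix z
  have "(G \<otimes>\<^bsub>F\<^esub> H) z =
      (\<Sum>u\<in>support G. \<Sum>v\<in>support H. if pair_mult u v = z then G u * H v else 0)"
    by (simp add: free_product_alg_def support_def pair_mult_def case_prod_beta cong: if_cong)
  also have "\<dots> = (\<Sum>u\<in>support G. \<Sum>v\<in>S'. if pair_mult u v = z then G u * H v else 0)"
    using assms by (intro sum.cong refl sum.mono_neutral_left) (auto simp: support_def)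
  also have "\<dots> = (\<Sum>u\<in>S. \<Sum>v\<in>S'. if pair_mult u v = z then G u * H v else 0)"
    using assms by (intro sum.mono_neutral_left ballI sum.neutral) (auto simp: support_def)
  finally show "(G \<otimes>\<^bsub>F\<^esub> H) z =
    (\<Sum>u\<in>S. \<Sum>v\<in>S'. if pair_mult u v = z then G u * H v else 0)" .
qed

lemma support_add: "support (\<lambda>z. G z + H z) \<subseteq> support G \<union> support H"
  by (auto simp: support_def)

lemma free_zero_closed: "(\<lambda>_. 0) \<in> carrier F"
  by (simp add: free_carrier support_def)

lemma free_add_closed:
  "G \<in> carrier F \<Longrightarrow> H \<in> carrier F \<Longrightarrow> (\<lambda>z. G z + H z) \<in> carrier F"
  unfolding free_carrier using support_add[of G H] by (meson finite_Un finite_subset le_sup_iff subset_trans)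

lemma free_scale_closed: "G \<in> carrier F \<Longrightarrow> (\<lambda>z. c * G z) \<in> carrier F"
proof -
  have "support (\<lambda>z. c * G z) \<subseteq> support G" by (auto simp: support_def)
  then show "G \<in> carrier F \<Longrightarrow> (\<lambda>z. c * G z) \<in> carrier F"
    unfolding free_carrier by (meson finite_subset subset_trans)
qed

lemma free_single_closed: "u \<in> carrier B \<times> carrier T \<Longrightarrow> single u c \<in> carrier F"
  unfolding free_carrier using support_single[of u c] by (auto intro: finite_subset)

lemma free_mult_closed:
  assumes G: "G \<in> carrier F" and H: "H \<in> carrier F"
  shows "G \<otimes>\<^bsub>F\<^esub> H \<in> carrier F"
proof -
  have "support (G \<otimes>\<^bsub>F\<^esub> H) \<subseteq> (\<lambda>(u, v). pair_mult u v) ` (support G \<times> support H)"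
  proof
    fix z assume z: "z \<in> support (G \<otimes>\<^bsub>F\<^esub> H)"
    show "z \<in> (\<lambda>(u, v). pair_mult u v) ` (support G \<times> support H)"
    proof (rule ccontr)
      assume "\<not> ?thesis"
      then have "pair_mult u v \<noteq> z" if "u \<in> support G" "v \<in> support H" for u v
        using that by blast
      then have "(G \<otimes>\<^bsub>F\<^esub> H) z = 0"
        using G H by (subst free_mult[of "support G" _ "support H"])
          (auto simp: free_carrier intro!: sum.neutral)
      then show False using z by (simp add: support_def)
    qed
  qed
  moreover have "(\<lambda>(u, v). pair_mult u v) ` (support G \<times> support H) \<subseteq> carrier B \<times> carrier T"
    using G H by (auto simp: free_carrier pair_mult_def subset_iff)
  moreover have "finite ((\<lambda>(u, v). pair_mult u v) ` (support G \<times> support H))"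
    using G H by (simp add: free_carrier)
  ultimately show ?thesis
    unfolding free_carrier by (meson finite_subset subset_trans)
qed

text \<open>Identities that are additive in an argument reduce to multiples of basis elements;
  associativity, and later the multiplicativity of the induced map, nest this induction.\<close>

lemma free_induct [consumes 1, case_names zero single add]:
  assumes "G \<in> carrier F"
    and zero: "Q (\<lambda>_. 0)"
    and single: "\<And>u c. u \<in> carrier B \<times> carrier T \<Longrightarrow> Q (single u c)"
    and add: "\<And>G H. G \<in> carrier F \<Longrightarrow> H \<in> carrier F \<Longrightarrow> Q G \<Longrightarrow> Q H \<Longrightarrow> Q (\<lambda>z. G z + H z)"
  shows "Q G"
proof -
  \<comment> \<open>Generalised to any finite set \<open>K\<close> containing the support, so that
    clearing one value leads to a smaller \<open>K\<close> without regard to the exact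
    support.\<close>
  have "Q G" if "finite K" "support G \<subseteq> K" "K \<subseteq> carrier B \<times> carrier T" for K G
    using that
  proof (induction K arbitrary: G rule: finite_induct)
    case empty
    then have "G = (\<lambda>_. 0)" by (auto simp: support_def)
    then show ?case using zero by simp
  next
    case (insert u K)
    define H where "H = G(u := 0)"
    have H: "support H \<subseteq> K" using insert.prems by (auto simp: H_def support_def)
    then have "H \<in> carrier F"
      using insert.hyps insert.prems by (auto simp: free_carrier intro: finite_subset)
    moreover have "Q H" using insert.IH[OF H] insert.prems by simp
    ultimately have "Q (\<lambda>z. single u (G u) z + H z)"
      using insert.prems by (intro add free_single_closed single) auto
    moreover have "(\<lambda>z. single u (G u) z + H z) = G"
      by (auto simp: single_def H_def)
    ultimately show ?case by simp
  qed
  then show ?thesis using assms(1) by (auto simp: free_carrier)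
qed

lemma free_mult_add:
  assumes "G \<in> carrier F" "G' \<in> carrier F" "H \<in> carrier F"
  shows "(\<lambda>z. G z + G' z) \<otimes>\<^bsub>F\<^esub> H = (\<lambda>z. (G \<otimes>\<^bsub>F\<^esub> H) z + (G' \<otimes>\<^bsub>F\<^esub> H) z)"
proof -
  have fin: "finite (support G \<union> support G')" "finite (support H)"
    using assms by (auto simp: free_carrier)
  have "G \<otimes>\<^bsub>F\<^esub> H = (\<lambda>z. \<Sum>u\<in>support G \<union> support G'. \<Sum>v\<in>support H.
      if pair_mult u v = z then G u * H v else 0)"
    by (rule free_mult) (use fin in auto)
  moreover have "G' \<otimes>\<^bsub>F\<^esub> H = (\<lambda>z. \<Sum>u\<in>support G \<union> support G'. \<Sum>v\<in>support H.
      if pair_mult u v = z then G' u * H v else 0)"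
    by (rule free_mult) (use fin in auto)
  moreover have "(\<lambda>z. G z + G' z) \<otimes>\<^bsub>F\<^esub> H = (\<lambda>z. \<Sum>u\<in>support G \<union> support G'. \<Sum>v\<in>support H.
      if pair_mult u v = z then (G u + G' u) * H v else 0)"
    by (rule free_mult) (use fin support_add[of G G'] in auto)
  ultimately show ?thesis
    by (simp add: sum.distrib[symmetric] distrib_right if_distrib[where f = "\<lambda>x. x + _"] cong: if_cong)
qed

lemma free_mult_comm:
  assumes "G \<in> carrier F" "H \<in> carrier F"
  shows "G \<otimes>\<^bsub>F\<^esub> H = H \<otimes>\<^bsub>F\<^esub> G"
proof -
  have fin: "finite (support G)" "finite (support H)"
    and sub: "support G \<subseteq> carrier B \<times> carrier T" "support H \<subseteq> carrier B \<times> carrier T"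
    using assms by (auto simp: free_carrier)
  have comm: "pair_mult u v = pair_mult v u" if "u \<in> support G" "v \<in> support H" for u v
    using that sub by (auto simp: pair_mult_def intro!: B.m_comm T.m_comm)
  show ?thesis
    unfolding free_mult[OF fin(1) subset_refl fin(2) subset_refl]
      free_mult[OF fin(2) subset_refl fin(1) subset_refl]
    by (subst sum.swap, intro ext sum.cong refl) (auto simp: comm mult.commute)
qed

lemma free_mult_single:
  "single u c \<otimes>\<^bsub>F\<^esub> single v d = single (pair_mult u v) (c * d)"
proof -
  have "single u c \<otimes>\<^bsub>F\<^esub> single v d = (\<lambda>z. \<Sum>u'\<in>{u}. \<Sum>v'\<in>{v}.
      if pair_mult u' v' = z then single u c u' * single v d v' else 0)"
    by (rule free_mult) (auto simp: support_single)
  then show ?thesis by (auto simp: single_def)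
qed

lemma free_mult_zero: "(\<lambda>_. 0) \<otimes>\<^bsub>F\<^esub> G = (\<lambda>_. 0)"
  by (simp add: free_product_alg_def)

lemma free_mult_scale:
  assumes "G \<in> carrier F" "H \<in> carrier F"
  shows "(\<lambda>z. c * G z) \<otimes>\<^bsub>F\<^esub> H = (\<lambda>z. c * (G \<otimes>\<^bsub>F\<^esub> H) z)"
proof -
  have fin: "finite (support G)" "finite (support H)"
    using assms by (auto simp: free_carrier)
  have "(\<lambda>z. c * G z) \<otimes>\<^bsub>F\<^esub> H = (\<lambda>z. \<Sum>u\<in>support G. \<Sum>v\<in>support H.
      if pair_mult u v = z then (c * G u) * H v else 0)"
    by (rule free_mult) (use fin in \<open>auto simp: support_def\<close>)
  then show ?thesis
    unfolding free_mult[OF fin(1) subset_refl fin(2) subset_refl] sum_distrib_left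
    by simp (intro ext sum.cong refl, simp)
qed

lemma free_mult_assoc:
  assumes "G \<in> carrier F" "H \<in> carrier F" "K \<in> carrier F"
  shows "(G \<otimes>\<^bsub>F\<^esub> H) \<otimes>\<^bsub>F\<^esub> K = G \<otimes>\<^bsub>F\<^esub> (H \<otimes>\<^bsub>F\<^esub> K)"
  using assms(1)
proof (induction rule: free_induct)
  case zero
  show ?case by (simp add: free_mult_zero)
next
  case (add G G')
  then show ?case
    using assms by (simp add: free_mult_add free_mult_closed)
next
  case G: (single u c)
  show ?case using assms(2)
  proof (induction rule: free_induct)
    case zero
    show ?case
      using assms G
      by (simp add: free_mult_zero free_mult_comm[OF _ free_zero_closed] free_single_closed)
  next
    case (add H H')
    then show ?case
      using assms G
      by (simp add: free_mult_add free_mult_closed free_single_closed free_add_closed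
          free_mult_comm[of "single u c"])
  next
    case H: (single v d)
    show ?case using assms(3)
    proof (induction rule: free_induct)
      case zero
      show ?case
        using G H
        by (simp add: free_mult_zero free_mult_comm[OF _ free_zero_closed] free_single_closed
            free_mult_closed)
    next
      case (add K K')
      have "X \<otimes>\<^bsub>F\<^esub> (\<lambda>z. K z + K' z) = (\<lambda>z. (X \<otimes>\<^bsub>F\<^esub> K) z + (X \<otimes>\<^bsub>F\<^esub> K') z)" if "X \<in> carrier F" for X
        using that add.hyps by (simp add: free_mult_comm[of X] free_mult_add free_add_closed)
      moreover have "X \<otimes>\<^bsub>F\<^esub> (\<lambda>z. (Y \<otimes>\<^bsub>F\<^esub> K) z + (Y \<otimes>\<^bsub>F\<^esub> K') z) =
          (\<lambda>z. (X \<otimes>\<^bsub>F\<^esub> (Y \<otimes>\<^bsub>F\<^esub> K)) z + (X \<otimes>\<^bsub>F\<^esub> (Y \<otimes>\<^bsub>F\<^esub> K')) z)"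
        if "X \<in> carrier F" "Y \<in> carrier F" for X Y
        using that add.hyps
        by (simp add: free_mult_comm[of X] free_mult_add free_add_closed free_mult_closed)
      ultimately show ?case
        using add.IH G H by (simp add: free_single_closed free_mult_closed)
    next
      case K: (single w e)
      have "pair_mult (pair_mult u v) w = pair_mult u (pair_mult v w)"
        using G H K by (auto simp: pair_mult_def B.m_assoc T.m_assoc)
      then show ?case by (simp add: free_mult_single mult.assoc)
    qed
  qed
qed

lemma free_one_mult: "G \<in> carrier F \<Longrightarrow> single (\<one>\<^bsub>B\<^esub>, \<one>\<^bsub>T\<^esub>) 1 \<otimes>\<^bsub>F\<^esub> G = G"
proof (induction rule: free_induct)
  case zero
  show ?case
    by (simp add: free_mult_zero free_mult_comm[OF _ free_zero_closed] free_single_closed)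
next
  case (single u c)
  then show ?case by (auto simp: free_mult_single pair_mult_def)
next
  case (add G H)
  then show ?case
    by (simp add: free_mult_comm[of "single _ _"] free_mult_add free_add_closed free_single_closed)
qed

lemma free_algebra: "algebra complex_field F"
proof -
  have "cring F"
  proof (intro cringI abelian_groupI comm_monoidI)
    show "\<exists>y\<in>carrier F. y \<oplus>\<^bsub>F\<^esub> x = \<zero>\<^bsub>F\<^esub>" if "x \<in> carrier F" for x
      using free_scale_closed[OF that, of "-1"] by (auto simp: free_simps intro!: bexI)
    show "x \<otimes>\<^bsub>F\<^esub> y = y \<otimes>\<^bsub>F\<^esub> x" if "x \<in> carrier F" "y \<in> carrier F" for x y
      using that by (rule free_mult_comm)
  qed (auto simp: free_simps free_mult_closed free_add_closed free_zero_closed free_single_closed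
      free_mult_assoc free_one_mult free_mult_add add.assoc add.commute)
  then show ?thesis
    by (intro algebraI cring_complex_field)
      (auto simp: free_simps free_scale_closed free_mult_scale algebra_simps)
qed

end

section \<open>Relations and universal property of the tensor product\<close>

context calg_pair
begin

abbreviation K where "K \<equiv> genideal F (tensor_relations B T)"

abbreviation Q where "Q \<equiv> tensor_alg B T"

definition tensor :: "'b \<Rightarrow> 't \<Rightarrow> ('b \<times> 't \<Rightarrow> complex) set" where
  "tensor b x = K +>\<^bsub>F\<^esub> single (b, x) 1"

interpretation F: calg F by (rule calg.intro[OF free_algebra])

lemma free_minus:
  assumes "G \<in> carrier F" "H \<in> carrier F"
  shows "G \<ominus>\<^bsub>F\<^esub> H = (\<lambda>z. G z - H z)"
  using F.scale_neg[OF assms(2)] by (simp add: F.minus_eq free_simps fun_eq_iff)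

lemma free_diff_closed: "G \<in> carrier F \<Longrightarrow> H \<in> carrier F \<Longrightarrow> (\<lambda>z. G z - H z) \<in> carrier F"
  using F.minus_closed[of G H] by (simp add: free_minus)

lemma tensor_relations_closed: "tensor_relations B T \<subseteq> carrier F"
  unfolding tensor_relations_def pure_tensor_single
  by (auto intro!: free_diff_closed free_scale_closed free_single_closed)

lemma K_ideal: "ideal K F"
  by (rule F.genideal_ideal[OF tensor_relations_closed])

lemma tensor_alg_quot: "Q = alg_quot F K"
  by (simp add: tensor_alg_def Let_def)

lemma tensor_algebra: "algebra complex_field Q"
  unfolding tensor_alg_quot by (rule alg_quot_algebra[OF free_algebra K_ideal])

interpretation Q: calg Q by (rule calg.intro[OF tensor_algebra])

lemma tensor_eqI:
  assumes "G \<in> carrier F" "H \<in> carrier F" "(\<lambda>z. G z - H z) \<in> tensor_relations B T"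
  shows "K +>\<^bsub>F\<^esub> G = K +>\<^bsub>F\<^esub> H"
  using assms F.genideal_self[OF tensor_relations_closed]
  by (auto simp: coset_eq_iff[OF free_algebra K_ideal] free_minus)

lemma coset_add:
  "G \<in> carrier F \<Longrightarrow> H \<in> carrier F \<Longrightarrow>
    K +>\<^bsub>F\<^esub> (\<lambda>z. G z + H z) = (K +>\<^bsub>F\<^esub> G) \<oplus>\<^bsub>Q\<^esub> (K +>\<^bsub>F\<^esub> H)"
  by (simp add: tensor_alg_quot alg_quot_add[OF free_algebra K_ideal] free_simps)

lemma coset_scale:
  "G \<in> carrier F \<Longrightarrow> K +>\<^bsub>F\<^esub> (\<lambda>z. c * G z) = c \<odot>\<^bsub>Q\<^esub> (K +>\<^bsub>F\<^esub> G)"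
  by (simp add: tensor_alg_quot alg_quot_smult[OF free_algebra K_ideal] free_simps)

lemma coset_single:
  assumes "b \<in> carrier B" "x \<in> carrier T"
  shows "K +>\<^bsub>F\<^esub> single (b, x) c = c \<odot>\<^bsub>Q\<^esub> tensor b x"
proof -
  have "single (b, x) c = (\<lambda>z. c * single (b, x) 1 z)" by (auto simp: single_def)
  then show ?thesis
    using coset_scale[of "single (b, x) 1" c] assms by (simp add: tensor_def free_single_closed)
qed

lemma tensor_closed: "b \<in> carrier B \<Longrightarrow> x \<in> carrier T \<Longrightarrow> tensor b x \<in> carrier Q"
  unfolding tensor_def tensor_alg_quot by (intro alg_quot_closed free_single_closed) simp

text \<open>\<open>diff_diff_eq\<close> puts the additive relations into the shape
  \<open>G - H\<close> that the scalar ones already have, so that a single rule,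
  \<open>tensor_eqI\<close> here and \<open>cancel\<close> in the universal property, handles all
  four.\<close>

lemma tensor_relationsI:
  "b \<in> carrier B \<Longrightarrow> b' \<in> carrier B \<Longrightarrow> x \<in> carrier T \<Longrightarrow>
    (\<lambda>z. single (b \<oplus>\<^bsub>B\<^esub> b', x) 1 z - (single (b, x) 1 z + single (b', x) 1 z))
      \<in> tensor_relations B T"
  "b \<in> carrier B \<Longrightarrow> x \<in> carrier T \<Longrightarrow> x' \<in> carrier T \<Longrightarrow>
    (\<lambda>z. single (b, x \<oplus>\<^bsub>T\<^esub> x') 1 z - (single (b, x) 1 z + single (b, x') 1 z))
      \<in> tensor_relations B T"
  "b \<in> carrier B \<Longrightarrow> x \<in> carrier T \<Longrightarrow>
    (\<lambda>z. single (c \<odot>\<^bsub>B\<^esub> b, x) 1 z - c * single (b, x) 1 z) \<in> tensor_relations B T"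
  "b \<in> carrier B \<Longrightarrow> x \<in> carrier T \<Longrightarrow>
    (\<lambda>z. single (b, c \<odot>\<^bsub>T\<^esub> x) 1 z - c * single (b, x) 1 z) \<in> tensor_relations B T"
  unfolding tensor_relations_def pure_tensor_single diff_diff_eq by blast+

lemma tensor_relations_induct [consumes 1, case_names add_left add_right scale_left scale_right]:
  assumes "r \<in> tensor_relations B T"
    and "\<And>b b' x. b \<in> carrier B \<Longrightarrow> b' \<in> carrier B \<Longrightarrow> x \<in> carrier T \<Longrightarrow>
      R (\<lambda>z. single (b \<oplus>\<^bsub>B\<^esub> b', x) 1 z - (single (b, x) 1 z + single (b', x) 1 z))"
    and "\<And>b x x'. b \<in> carrier B \<Longrightarrow> x \<in> carrier T \<Longrightarrow> x' \<in> carrier T \<Longrightarrow>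
      R (\<lambda>z. single (b, x \<oplus>\<^bsub>T\<^esub> x') 1 z - (single (b, x) 1 z + single (b, x') 1 z))"
    and "\<And>b x c. b \<in> carrier B \<Longrightarrow> x \<in> carrier T \<Longrightarrow>
      R (\<lambda>z. single (c \<odot>\<^bsub>B\<^esub> b, x) 1 z - c * single (b, x) 1 z)"
    and "\<And>b x c. b \<in> carrier B \<Longrightarrow> x \<in> carrier T \<Longrightarrow>
      R (\<lambda>z. single (b, c \<odot>\<^bsub>T\<^esub> x) 1 z - c * single (b, x) 1 z)"
  shows "R r"
  using assms(1) unfolding tensor_relations_def pure_tensor_single diff_diff_eq
  by (elim UnE) ((erule CollectE exE conjE)+, erule ssubst, (rule assms(2-5); assumption))+

lemma tensor_add_left:
  assumes "b \<in> carrier B" "b' \<in> carrier B" "x \<in> carrier T"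
  shows "tensor (b \<oplus>\<^bsub>B\<^esub> b') x = tensor b x \<oplus>\<^bsub>Q\<^esub> tensor b' x"
proof -
  have "tensor (b \<oplus>\<^bsub>B\<^esub> b') x = K +>\<^bsub>F\<^esub> (\<lambda>z. single (b, x) 1 z + single (b', x) 1 z)"
    unfolding tensor_def
    by (intro tensor_eqI free_single_closed free_add_closed tensor_relationsI) (use assms in auto)
  then show ?thesis using assms by (simp add: tensor_def coset_add free_single_closed)
qed

lemma tensor_add_right:
  assumes "b \<in> carrier B" "x \<in> carrier T" "x' \<in> carrier T"
  shows "tensor b (x \<oplus>\<^bsub>T\<^esub> x') = tensor b x \<oplus>\<^bsub>Q\<^esub> tensor b x'"
proof -
  have "tensor b (x \<oplus>\<^bsub>T\<^esub> x') = K +>\<^bsub>F\<^esub> (\<lambda>z. single (b, x) 1 z + single (b, x') 1 z)"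
    unfolding tensor_def
    by (intro tensor_eqI free_single_closed free_add_closed tensor_relationsI) (use assms in auto)
  then show ?thesis using assms by (simp add: tensor_def coset_add free_single_closed)
qed

lemma tensor_scale_left:
  assumes "b \<in> carrier B" "x \<in> carrier T"
  shows "tensor (c \<odot>\<^bsub>B\<^esub> b) x = c \<odot>\<^bsub>Q\<^esub> tensor b x"
proof -
  have "tensor (c \<odot>\<^bsub>B\<^esub> b) x = K +>\<^bsub>F\<^esub> (\<lambda>z. c * single (b, x) 1 z)"
    unfolding tensor_def
    by (intro tensor_eqI free_single_closed free_scale_closed tensor_relationsI) (use assms in auto)
  then show ?thesis using assms by (simp add: tensor_def coset_scale free_single_closed)
qed

lemma tensor_scale_right:
  assumes "b \<in> carrier B" "x \<in> carrier T"
  shows "tensor b (c \<odot>\<^bsub>T\<^esub> x) = c \<odot>\<^bsub>Q\<^esub> tensor b x"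
proof -
  have "tensor b (c \<odot>\<^bsub>T\<^esub> x) = K +>\<^bsub>F\<^esub> (\<lambda>z. c * single (b, x) 1 z)"
    unfolding tensor_def
    by (intro tensor_eqI free_single_closed free_scale_closed tensor_relationsI) (use assms in auto)
  then show ?thesis using assms by (simp add: tensor_def coset_scale free_single_closed)
qed

lemma tensor_zero_left: "x \<in> carrier T \<Longrightarrow> tensor \<zero>\<^bsub>B\<^esub> x = \<zero>\<^bsub>Q\<^esub>"
  using tensor_scale_left[of "\<zero>\<^bsub>B\<^esub>" x 0] tensor_closed[of "\<zero>\<^bsub>B\<^esub>" x] by simp

lemma tensor_zero_right: "b \<in> carrier B \<Longrightarrow> tensor b \<zero>\<^bsub>T\<^esub> = \<zero>\<^bsub>Q\<^esub>"
  using tensor_scale_right[of b "\<zero>\<^bsub>T\<^esub>" 0] tensor_closed[of b "\<zero>\<^bsub>T\<^esub>"] by simp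

lemma tensor_finsum:
  assumes "b \<in> carrier B" "\<And>i. y i \<in> carrier T"
  shows "tensor b (finsum T y {..<k}) = finsum Q (\<lambda>i. tensor b (y i)) {..<k::nat}"
proof (induction k)
  case 0
  show ?case using assms by (simp add: tensor_zero_right)
next
  case (Suc k)
  then show ?case
    using assms
    by (simp add: T.finsum_lessThan_Suc Q.finsum_lessThan_Suc tensor_add_right Pi_def tensor_closed)
qed

text \<open>Bilinearity collects everything on a spanning family of the right factor. Uniqueness of
  the coefficients is not claimed here; for powers of the variable it will come out of
  \<open>independence\<close> in the local ring.\<close>

lemma tensor_span:
  fixes n :: nat
  assumes t: "\<And>i. t i \<in> carrier T"
    and span: "\<And>x. x \<in> carrier T \<Longrightarrow> \<exists>c. x = finsum T (\<lambda>i. c i \<odot>\<^bsub>T\<^esub> t i) {..<n}"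
    and q: "q \<in> carrier Q"
  shows "\<exists>b. (\<forall>i. b i \<in> carrier B) \<and> q = finsum Q (\<lambda>i. tensor (b i) (t i)) {..<n}"
proof -
  obtain G where G: "G \<in> carrier F" "q = K +>\<^bsub>F\<^esub> G"
    using q by (auto simp: tensor_alg_quot alg_quot_carrier)
  have "\<exists>b. (\<forall>i. b i \<in> carrier B) \<and> K +>\<^bsub>F\<^esub> G = finsum Q (\<lambda>i. tensor (b i) (t i)) {..<n}"
    using G(1)
  proof (induction rule: free_induct)
    case zero
    have "(\<lambda>_. 0) = \<zero>\<^bsub>F\<^esub>" by (simp add: free_simps)
    then have "K +>\<^bsub>F\<^esub> (\<lambda>_. 0) = \<zero>\<^bsub>Q\<^esub>"
      using coset_eq_zero_iff[OF free_algebra K_ideal, of "\<zero>\<^bsub>F\<^esub>"]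
        additive_subgroup.zero_closed[OF ideal.axioms(1)[OF K_ideal]]
      by (simp add: tensor_alg_quot alg_quot_const)
    then show ?case
      by (intro exI[of _ "\<lambda>_. \<zero>\<^bsub>B\<^esub>"]) (simp add: tensor_zero_left t)
  next
    case (single u c)
    obtain b x where u: "u = (b, x)" "b \<in> carrier B" "x \<in> carrier T" using single by auto
    obtain d where d: "x = finsum T (\<lambda>i. d i \<odot>\<^bsub>T\<^esub> t i) {..<n}" using span[OF u(3)] by blast
    \<comment> \<open>The coefficients of \<open>x\<close> with respect to the \<open>t i\<close>
      move across the tensor sign to the left factor.\<close>
    define b' where "b' i = d i \<odot>\<^bsub>B\<^esub> (c \<odot>\<^bsub>B\<^esub> b)" for i
    have "K +>\<^bsub>F\<^esub> single u c = tensor (c \<odot>\<^bsub>B\<^esub> b) x"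
      using u by (simp add: coset_single tensor_scale_left)
    also have "\<dots> = finsum Q (\<lambda>i. tensor (c \<odot>\<^bsub>B\<^esub> b) (d i \<odot>\<^bsub>T\<^esub> t i)) {..<n}"
      unfolding d by (rule tensor_finsum) (use u t in auto)
    also have "(\<lambda>i. tensor (c \<odot>\<^bsub>B\<^esub> b) (d i \<odot>\<^bsub>T\<^esub> t i)) = (\<lambda>i. tensor (b' i) (t i))"
      using u t by (simp add: b'_def tensor_scale_left[of "c \<odot>\<^bsub>B\<^esub> b"] tensor_scale_right)
    finally show ?case using u by (intro exI[of _ b']) (simp add: b'_def)
  next
    case (add G H)
    then obtain b b' where b: "\<forall>i. b i \<in> carrier B" "\<forall>i. b' i \<in> carrier B"
      "K +>\<^bsub>F\<^esub> G = finsum Q (\<lambda>i. tensor (b i) (t i)) {..<n}"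
      "K +>\<^bsub>F\<^esub> H = finsum Q (\<lambda>i. tensor (b' i) (t i)) {..<n}" by blast
    have "K +>\<^bsub>F\<^esub> (\<lambda>z. G z + H z) = finsum Q (\<lambda>i. tensor (b i \<oplus>\<^bsub>B\<^esub> b' i) (t i)) {..<n}"
      using add.hyps b t by (simp add: coset_add tensor_add_left Q.finsum_addf Pi_def tensor_closed)
    then show ?case using b by (intro exI[of _ "\<lambda>i. b i \<oplus>\<^bsub>B\<^esub> b' i"]) simp
  qed
  then show ?thesis using G by simp
qed

text \<open>\<open>f\<close> is the linear extension of
  \<open>(b, x) \<mapsto> h b \<otimes> k x\<close> to the free algebra. It is multiplicative
  because \<open>D\<close> is commutative, and it kills the bilinearity relations because
  \<open>h\<close> and \<open>k\<close> are linear.\<close>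

lemma tensor_lift:
  assumes D: "algebra complex_field D" and h: "h \<in> calg_hom B D" and k: "k \<in> calg_hom T D"
  obtains \<Theta> where "\<Theta> \<in> calg_hom Q D"
    and "\<And>b x. b \<in> carrier B \<Longrightarrow> x \<in> carrier T \<Longrightarrow> \<Theta> (tensor b x) = h b \<otimes>\<^bsub>D\<^esub> k x"
proof -
  interpret D: calg D by (rule calg.intro[OF D])
  interpret h: ring_hom_cring B D h using h by unfold_locales (auto simp: calg_hom_def)
  interpret k: ring_hom_cring T D k using k by unfold_locales (auto simp: calg_hom_def)
  have h_scale: "h (c \<odot>\<^bsub>B\<^esub> b) = c \<odot>\<^bsub>D\<^esub> h b" if "b \<in> carrier B" for c b
    using h that by (simp add: calg_hom_def)
  have k_scale: "k (c \<odot>\<^bsub>T\<^esub> x) = c \<odot>\<^bsub>D\<^esub> k x" if "x \<in> carrier T" for c x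
    using k that by (simp add: calg_hom_def)
  define \<beta> where "\<beta> u = h (fst u) \<otimes>\<^bsub>D\<^esub> k (snd u)" for u
  have \<beta>: "\<beta> u \<in> carrier D" if "u \<in> carrier B \<times> carrier T" for u
    using that by (auto simp: \<beta>_def)
  define f where "f G = finsum D (\<lambda>u. G u \<odot>\<^bsub>D\<^esub> \<beta> u) (support G)" for G
  have f: "f G = finsum D (\<lambda>u. G u \<odot>\<^bsub>D\<^esub> \<beta> u) S"
    if "finite S" "support G \<subseteq> S" "S \<subseteq> carrier B \<times> carrier T" for G S
    unfolding f_def
    by (rule D.add.finprod_mono_neutral_cong_left)
      (use that \<beta> in \<open>auto simp: support_def Pi_def subset_iff\<close>)
  have f_closed: "f G \<in> carrier D" if "G \<in> carrier F" for G
    unfolding f_def using that \<beta> by (intro D.finsum_closed) (auto simp: free_carrier subset_iff)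
  have f_single: "f (single u c) = c \<odot>\<^bsub>D\<^esub> \<beta> u" if u: "u \<in> carrier B \<times> carrier T" for u c
  proof -
    have "f (single u c) = finsum D (\<lambda>v. single u c v \<odot>\<^bsub>D\<^esub> \<beta> v) {u}"
      by (rule f) (use u support_single[of u c] in auto)
    also have "\<dots> = c \<odot>\<^bsub>D\<^esub> \<beta> u"
      using \<beta>[OF u] by (subst D.finsum_insert) (auto simp: single_def)
    finally show ?thesis .
  qed
  have f_add: "f (\<lambda>z. G z + H z) = f G \<oplus>\<^bsub>D\<^esub> f H" if G: "G \<in> carrier F" and H: "H \<in> carrier F" for G H
  proof -
    define S where "S = support G \<union> support H"
    have S: "finite S" "S \<subseteq> carrier B \<times> carrier T" using G H by (auto simp: S_def free_carrier)
    have \<beta>S: "\<beta> u \<in> carrier D" if "u \<in> S" for u using S(2) that \<beta> by blast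
    have "f (\<lambda>z. G z + H z) = finsum D (\<lambda>u. (G u + H u) \<odot>\<^bsub>D\<^esub> \<beta> u) S"
      by (rule f) (use S support_add[of G H] in \<open>auto simp: S_def\<close>)
    also have "\<dots> = finsum D (\<lambda>u. G u \<odot>\<^bsub>D\<^esub> \<beta> u \<oplus>\<^bsub>D\<^esub> H u \<odot>\<^bsub>D\<^esub> \<beta> u) S"
      by (rule D.finsum_cong') (use \<beta>S in \<open>auto simp: D.scale_add\<close>)
    also have "\<dots> = finsum D (\<lambda>u. G u \<odot>\<^bsub>D\<^esub> \<beta> u) S \<oplus>\<^bsub>D\<^esub> finsum D (\<lambda>u. H u \<odot>\<^bsub>D\<^esub> \<beta> u) S"
      by (rule D.finsum_addf) (use \<beta>S in auto)
    also have "\<dots> = f G \<oplus>\<^bsub>D\<^esub> f H"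
      using f[of S G] f[of S H] S by (simp add: S_def)
    finally show ?thesis .
  qed
  have f_zero: "f (\<lambda>_. 0) = \<zero>\<^bsub>D\<^esub>" by (simp add: f_def support_def)
  have f_scale: "f (\<lambda>z. c * G z) = c \<odot>\<^bsub>D\<^esub> f G" if "G \<in> carrier F" for c G
    using that
  proof (induction rule: free_induct)
    case zero
    show ?case by (simp add: f_zero)
  next
    case (single u d)
    have "(\<lambda>z. c * single u d z) = single u (c * d)" by (auto simp: single_def)
    then show ?case using single \<beta> by (simp add: f_single D.scale_scale)
  next
    case (add G H)
    then show ?case
      using f_add[of "\<lambda>z. c * G z" "\<lambda>z. c * H z"]
      by (simp add: f_add f_closed D.scale_add_right distrib_left free_scale_closed)
  qed
  have mult_right: "G \<otimes>\<^bsub>F\<^esub> (\<lambda>z. H z + H' z) = (\<lambda>z. (G \<otimes>\<^bsub>F\<^esub> H) z + (G \<otimes>\<^bsub>F\<^esub> H') z)"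
    if "G \<in> carrier F" "H \<in> carrier F" "H' \<in> carrier F" for G H H'
    using F.r_distr[of H H' G] that by (simp add: free_simps)
  have f_mult: "f (G \<otimes>\<^bsub>F\<^esub> H) = f G \<otimes>\<^bsub>D\<^esub> f H" if G: "G \<in> carrier F" and H: "H \<in> carrier F" for G H
    using G
  proof (induction rule: free_induct)
    case zero
    then show ?case using H by (simp add: free_mult_zero f_zero f_closed)
  next
    case (add G G')
    then show ?case
      using H by (simp add: free_mult_add f_add f_closed free_mult_closed D.l_distr)
  next
    case u: (single u c)
    show ?case using H
    proof (induction rule: free_induct)
      case zero
      have "single u c \<otimes>\<^bsub>F\<^esub> (\<lambda>_. 0) = (\<lambda>_. 0)"
        using F.r_null[of "single u c"] u by (simp add: free_simps free_single_closed)
      then show ?case using u \<beta> by (simp add: f_zero f_single)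
    next
      case (add H H')
      then show ?case
        using u by (simp add: mult_right f_add f_closed free_mult_closed D.r_distr free_single_closed)
    next
      case v: (single v d)
      have "\<beta> (pair_mult u v) = \<beta> u \<otimes>\<^bsub>D\<^esub> \<beta> v"
        using u v by (auto simp: \<beta>_def pair_mult_def D.m_ac)
      then show ?case
        using u v \<beta> by (simp add: free_mult_single f_single pair_mult_closed D.scale_mult
            D.scale_mult_right D.scale_scale mult.commute)
    qed
  qed
  have fhom: "f \<in> calg_hom F D"
  proof -
    have "f \<one>\<^bsub>F\<^esub> = \<one>\<^bsub>D\<^esub>" by (simp add: free_simps f_single \<beta>_def)
    then have "f \<in> ring_hom F D"
      by (intro ring_hom_memI) (auto simp: f_closed f_mult f_add free_simps(3))
    then show ?thesis by (simp add: calg_hom_def free_simps f_scale)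
  qed
  interpret f: ring_hom_cring F D f using fhom by unfold_locales (auto simp: calg_hom_def)
  have f_diff: "f (\<lambda>z. G z - H z) = f G \<ominus>\<^bsub>D\<^esub> f H" if "G \<in> carrier F" "H \<in> carrier F" for G H
    using that f.hom_add[of G "\<ominus>\<^bsub>F\<^esub> H"] by (simp add: F.minus_eq D.minus_eq flip: free_minus)
  have cancel: "f (\<lambda>z. G z - H z) = \<zero>\<^bsub>D\<^esub>" if "G \<in> carrier F" "H \<in> carrier F" "f G = f H" for G H
    using that f_closed by (simp add: f_diff D.minus_eq D.r_neg)
  have rel1: "f (\<lambda>z. single (b \<oplus>\<^bsub>B\<^esub> b', x) 1 z - (single (b, x) 1 z + single (b', x) 1 z)) = \<zero>\<^bsub>D\<^esub>"
    if "b \<in> carrier B" "b' \<in> carrier B" "x \<in> carrier T" for b b' x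
    using that \<beta>
    by (intro cancel) (simp_all add: free_single_closed free_add_closed f_add f_single \<beta>_def D.l_distr)
  have rel2: "f (\<lambda>z. single (b, x \<oplus>\<^bsub>T\<^esub> x') 1 z - (single (b, x) 1 z + single (b, x') 1 z)) = \<zero>\<^bsub>D\<^esub>"
    if "b \<in> carrier B" "x \<in> carrier T" "x' \<in> carrier T" for b x x'
    using that \<beta>
    by (intro cancel) (simp_all add: free_single_closed free_add_closed f_add f_single \<beta>_def D.r_distr)
  have rel3: "f (\<lambda>z. single (c \<odot>\<^bsub>B\<^esub> b, x) 1 z - c * single (b, x) 1 z) = \<zero>\<^bsub>D\<^esub>"
    if "b \<in> carrier B" "x \<in> carrier T" for b x c
    using that \<beta>
    by (intro cancel) (simp_all add: free_single_closed free_scale_closed f_scale f_single \<beta>_def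
        h_scale D.scale_mult)
  have rel4: "f (\<lambda>z. single (b, c \<odot>\<^bsub>T\<^esub> x) 1 z - c * single (b, x) 1 z) = \<zero>\<^bsub>D\<^esub>"
    if "b \<in> carrier B" "x \<in> carrier T" for b x c
    using that \<beta>
    by (intro cancel) (simp_all add: free_single_closed free_scale_closed f_scale f_single \<beta>_def
        k_scale D.scale_mult_right)
  have "f r = \<zero>\<^bsub>D\<^esub>" if "r \<in> tensor_relations B T" for r
    using that by (induction rule: tensor_relations_induct) (rule rel1 rel2 rel3 rel4; assumption)+
  then have "tensor_relations B T \<subseteq> a_kernel F D f"
    using tensor_relations_closed unfolding a_kernel_def' by blast
  \<comment> \<open>A kernel is an ideal, so with the relations it contains the ideal they
    generate.\<close>
  then have "K \<subseteq> a_kernel F D f"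
    using fhom by (intro F.genideal_minimal ring_hom_ring.kernel_is_ideal ring_hom_ringI2)
      (auto simp: calg_hom_def F.ring_axioms D.ring_axioms)
  then have "f x = \<zero>\<^bsub>D\<^esub>" if "x \<in> K" for x
    using that unfolding a_kernel_def' by blast
  then obtain \<Theta> where \<Theta>: "\<Theta> \<in> calg_hom (alg_quot F K) D"
    "\<And>x. x \<in> carrier F \<Longrightarrow> \<Theta> (K +>\<^bsub>F\<^esub> x) = f x"
    using alg_quot_lift[OF free_algebra K_ideal D fhom] by blast
  show ?thesis
  proof (rule that)
    show "\<Theta> \<in> calg_hom Q D" using \<Theta>(1) by (simp add: tensor_alg_quot)
    show "\<Theta> (tensor b x) = h b \<otimes>\<^bsub>D\<^esub> k x" if "b \<in> carrier B" "x \<in> carrier T" for b x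
      using that \<beta>[of "(b, x)"]
      by (simp add: tensor_def \<Theta>(2) free_single_closed f_single) (simp add: \<beta>_def)
  qed
qed

end

section \<open>Truncated polynomials\<close>

lemma (in ideal) add_mem_cancel: "x \<in> I \<Longrightarrow> y \<in> carrier R \<Longrightarrow> x \<oplus> y \<in> I \<Longrightarrow> y \<in> I"
proof -
  assume x: "x \<in> I" and y: "y \<in> carrier R" and xy: "x \<oplus> y \<in> I"
  have "\<ominus> x \<oplus> (x \<oplus> y) \<in> I"
    by (intro additive_subgroup.a_closed[OF is_additive_subgroup]
        additive_subgroup.a_inv_closed[OF is_additive_subgroup] x xy)
  moreover have "\<ominus> x \<oplus> (x \<oplus> y) = y"
    using Icarr[OF x] y by (simp add: a_assoc[symmetric] l_neg)
  ultimately show "y \<in> I" by simp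
qed

lemma (in cring) mem_cgenideal: "x \<in> PIdl b \<longleftrightarrow> (\<exists>y\<in>carrier R. x = y \<otimes> b)"
  by (auto simp: cgenideal_def)

interpretation UP_complex: UP_cring complex_field "UP complex_field"
  by (rule UP_cring.intro[OF cring_complex_field])

definition truncated_power :: "nat \<Rightarrow> nat \<Rightarrow> (nat \<Rightarrow> complex) set" where
  "truncated_power n i =
    PIdl\<^bsub>UP complex_field\<^esub> (monom (UP complex_field) 1 n) +>\<^bsub>UP complex_field\<^esub> monom (UP complex_field) 1 i"

lemma truncated_ideal:
  "ideal (PIdl\<^bsub>UP complex_field\<^esub> (monom (UP complex_field) 1 n)) (UP complex_field)"
  by (rule UP_complex.P.cgenideal_ideal) simp

lemma truncated_poly_quot:
  "truncated_poly n = alg_quot (UP complex_field) (PIdl\<^bsub>UP complex_field\<^esub> (monom (UP complex_field) 1 n))"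
  by (simp add: truncated_poly_def Let_def)

lemma truncated_algebra: "algebra complex_field (truncated_poly n)"
  unfolding truncated_poly_quot by (rule alg_quot_algebra[OF UP_complex.UP_algebra truncated_ideal])

lemma truncated_power_closed: "truncated_power n i \<in> carrier (truncated_poly n)"
  unfolding truncated_power_def truncated_poly_quot by (rule alg_quot_closed) simp

lemma truncated_power_span:
  assumes x: "x \<in> carrier (truncated_poly n)"
  shows "\<exists>c. x = finsum (truncated_poly n) (\<lambda>i. c i \<odot>\<^bsub>truncated_poly n\<^esub> truncated_power n i) {..<n}"
proof -
  let ?U = "UP complex_field" and ?T = "truncated_poly n"
  let ?I = "PIdl\<^bsub>?U\<^esub> (monom ?U 1 n)"
  let ?\<pi> = "\<lambda>p. ?I +>\<^bsub>?U\<^esub> p"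
  interpret T: calg ?T by (rule calg.intro[OF truncated_algebra])
  interpret \<pi>: ring_hom_cring ?U ?T ?\<pi>
    using coset_calg_hom[OF UP_complex.UP_algebra truncated_ideal]
    by unfold_locales (simp add: calg_hom_def truncated_poly_quot)
  obtain p where p: "p \<in> carrier ?U" "x = ?\<pi> p"
    using x by (auto simp: truncated_poly_quot alg_quot_carrier)
  define c where "c = coeff ?U p"
  \<comment> \<open>The degree bound keeps all coefficients of \<open>p\<close>; the maximum with
    \<open>n\<close> makes \<open>{..<n}\<close> a subset of \<open>{..m}\<close>, the terms from
    \<open>n\<close> on being zero in the quotient.\<close>
  define m where "m = max n (deg complex_field p)"
  have monomial: "?\<pi> (monom ?U (c i) i) = c i \<odot>\<^bsub>?T\<^esub> truncated_power n i" for i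
  proof -
    have "monom ?U (c i) i = c i \<odot>\<^bsub>?U\<^esub> monom ?U 1 i"
      using UP_complex.monom_mult_smult[of "c i" 1 i] by simp
    then show ?thesis
      by (simp add: truncated_power_def truncated_poly_quot
          alg_quot_smult[OF UP_complex.UP_algebra truncated_ideal])
  qed
  have high: "truncated_power n i = \<zero>\<^bsub>?T\<^esub>" if "n \<le> i" for i
  proof -
    have "monom ?U 1 i = monom ?U 1 (i - n) \<otimes>\<^bsub>?U\<^esub> monom ?U 1 n"
      using that UP_complex.monom_mult[of 1 1 "i - n" n] by simp
    then have "monom ?U 1 i \<in> ?I"
      unfolding UP_complex.P.mem_cgenideal by (intro bexI[of _ "monom ?U 1 (i - n)"]) auto
    then show ?thesis
      using coset_eq_zero_iff[OF UP_complex.UP_algebra truncated_ideal]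
      by (simp add: truncated_power_def truncated_poly_quot alg_quot_const)
  qed
  have "x = ?\<pi> (finsum ?U (\<lambda>i. monom ?U (c i) i) {..m})"
    unfolding p(2) c_def using UP_complex.up_repr_le[of p m] p(1) by (simp add: m_def)
  also have "\<dots> = finsum ?T (?\<pi> \<circ> (\<lambda>i. monom ?U (c i) i)) {..m}"
    by (rule \<pi>.hom_finsum) auto
  also have "\<dots> = finsum ?T (\<lambda>i. c i \<odot>\<^bsub>?T\<^esub> truncated_power n i) {..m}"
    by (simp add: o_def monomial)
  also have "\<dots> = finsum ?T (\<lambda>i. c i \<odot>\<^bsub>?T\<^esub> truncated_power n i) {..<n}"
    by (rule T.add.finprod_mono_neutral_cong_left[symmetric])
      (auto simp: m_def high truncated_power_closed)
  finally show ?thesis by blast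
qed

text \<open>Evaluation at \<open>s\<close> kills the ideal that is divided out, because the
  \<open>n\<close>-th power of \<open>s\<close> is zero.\<close>

lemma truncated_poly_lift:
  assumes D: "algebra complex_field D" and s: "s \<in> carrier D" "s [^]\<^bsub>D\<^esub> n = \<zero>\<^bsub>D\<^esub>"
  obtains k where "k \<in> calg_hom (truncated_poly n) D"
    and "\<And>i. k (truncated_power n i) = s [^]\<^bsub>D\<^esub> i"
proof -
  let ?U = "UP complex_field"
  let ?I = "PIdl\<^bsub>?U\<^esub> (monom ?U 1 n)"
  interpret D: calg D by (rule calg.intro[OF D])
  \<comment> \<open>The structure map of the algebra \<open>D\<close>, in the form that the
    evaluation homomorphism of \<open>UP\<close> expects for coefficients.\<close>
  define h where "h c = c \<odot>\<^bsub>D\<^esub> \<one>\<^bsub>D\<^esub>" for c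
  have "h \<in> ring_hom complex_field D"
    by (rule ring_hom_memI) (auto simp: h_def D.scale_add D.scale_mult D.scale_scale)
  then interpret ev: UP_pre_univ_prop complex_field D h ?U
    by (intro UP_pre_univ_propI cring_complex_field D.M_cring)
  define E where "E = eval complex_field D h s"
  have E: "E \<in> ring_hom ?U D" unfolding E_def by (rule ev.eval_ring_hom[OF s(1)])
  interpret E: ring_hom_cring ?U D E using E by unfold_locales
  have E_monom: "E (monom ?U c i) = c \<odot>\<^bsub>D\<^esub> (s [^]\<^bsub>D\<^esub> i)" for c i
    unfolding E_def using s(1) by (subst ev.eval_monom) (auto simp: h_def D.scale_mult)
  have "E (c \<odot>\<^bsub>?U\<^esub> p) = c \<odot>\<^bsub>D\<^esub> E p" if p: "p \<in> carrier ?U" for c p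
  proof -
    have "E (c \<odot>\<^bsub>?U\<^esub> p) = E (monom ?U c 0 \<otimes>\<^bsub>?U\<^esub> p)"
      using UP_complex.monom_mult_is_smult[of c p] p by simp
    then show ?thesis using p by (simp add: E_monom D.scale_mult)
  qed
  then have "E \<in> calg_hom ?U D" using E by (simp add: calg_hom_def)
  moreover have "E x = \<zero>\<^bsub>D\<^esub>" if "x \<in> ?I" for x
    using that s by (auto simp: UP_complex.P.mem_cgenideal E_monom)
  ultimately obtain k where k: "k \<in> calg_hom (alg_quot ?U ?I) D"
    "\<And>x. x \<in> carrier ?U \<Longrightarrow> k (?I +>\<^bsub>?U\<^esub> x) = E x"
    using alg_quot_lift[OF UP_complex.UP_algebra truncated_ideal D] by blast
  show ?thesis
  proof (rule that)
    show "k \<in> calg_hom (truncated_poly n) D" using k(1) by (simp add: truncated_poly_quot)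
    show "k (truncated_power n i) = s [^]\<^bsub>D\<^esub> i" for i
      using s by (simp add: truncated_power_def k(2) E_monom)
  qed
qed

section \<open>Complements of a principal ideal\<close>

text \<open>\<open>S\<close> plays the role of a coefficient ring for expansions in powers of
  \<open>a\<close>. It complements the ideal of \<open>a\<close> only modulo the \<open>n\<close>-th
  power: the intersection of the two may be nonzero, which is why coefficients are unique only
  modulo \<open>a\<close>.\<close>

locale calg_complement = calg +
  fixes a S and n :: nat
  assumes generator_closed: "a \<in> carrier A"
    and nonzerodivisor: "x \<in> carrier A \<Longrightarrow> x \<otimes> a = \<zero> \<Longrightarrow> x = \<zero>"
    and S_subset: "S \<subseteq> carrier A"
    and S_one: "\<one> \<in> S"
    and S_add: "x \<in> S \<Longrightarrow> y \<in> S \<Longrightarrow> x \<oplus> y \<in> S"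
    and S_mult: "x \<in> S \<Longrightarrow> y \<in> S \<Longrightarrow> x \<otimes> y \<in> S"
    and S_scale: "x \<in> S \<Longrightarrow> c \<odot> x \<in> S"
    and S_dense: "x \<in> carrier A \<Longrightarrow> \<exists>s\<in>S. \<exists>i\<in>PIdl a. x = i \<oplus> s"
    and S_power: "S \<inter> PIdl a \<subseteq> PIdl (a [^] n)"
    and n_pos: "n \<ge> 1"
begin

abbreviation I where "I \<equiv> PIdl a"
abbreviation J where "J \<equiv> PIdl (a [^] n)"
abbreviation B where "B \<equiv> alg_quot A I"
abbreviation D where "D \<equiv> alg_quot A J"

lemma A_algebra: "algebra complex_field A"
  by (rule algebra_axioms)

lemma pow_closed [simp]: "a [^] (k::nat) \<in> carrier A"
  using generator_closed by simp

lemma ideals: "ideal I A" "ideal J A"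
  using generator_closed by (auto intro: cgenideal_ideal)

lemma power_ideal: "ideal (PIdl (a [^] (k::nat))) A"
  by (auto intro: cgenideal_ideal)

lemma power_ideal_mono:
  assumes "k \<le> m"
  shows "PIdl (a [^] (m::nat)) \<subseteq> PIdl (a [^] (k::nat))"
proof
  fix x assume "x \<in> PIdl (a [^] m)"
  then obtain y where y: "y \<in> carrier A" "x = y \<otimes> a [^] m" by (auto simp: mem_cgenideal)
  have "a [^] m = a [^] (m - k) \<otimes> a [^] k"
    using assms generator_closed by (simp add: nat_pow_mult)
  then have "x = (y \<otimes> a [^] (m - k)) \<otimes> a [^] k"
    using y by (simp add: m_assoc)
  then show "x \<in> PIdl (a [^] k)" using y by (auto simp: mem_cgenideal)
qed

lemma J_subset_I: "J \<subseteq> I"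
  using power_ideal_mono[OF n_pos] generator_closed by simp

lemma S_closed [simp]: "s \<in> S \<Longrightarrow> s \<in> carrier A"
  using S_subset by blast

lemma S_minus: "x \<in> S \<Longrightarrow> y \<in> S \<Longrightarrow> x \<ominus> y \<in> S"
  using S_add[OF _ S_scale[of y "-1"], of x] by (simp add: scale_neg minus_eq)

lemma S_coset:
  assumes "b \<in> carrier B"
  shows "\<exists>s\<in>S. b = I +> s"
proof -
  obtain x where x: "x \<in> carrier A" "b = I +> x" using assms by (auto simp: alg_quot_carrier)
  obtain s i where s: "s \<in> S" "i \<in> I" "x = i \<oplus> s" using S_dense[OF x(1)] by blast
  have "x \<ominus> s = i"
    using s ideal.Icarr[OF ideals(1) s(2)] by (simp add: minus_eq a_assoc r_neg)
  then have "I +> x = I +> s"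
    using coset_eq_iff[OF A_algebra ideals(1) x(1), of s] s by simp
  then show ?thesis using s x by blast
qed

text \<open>Well-definedness of the section: the difference of two elements of \<open>S\<close> lies
  in \<open>S\<close> again, where \<open>S_power\<close> upgrades membership in \<open>I\<close> to
  membership in \<open>J\<close>.\<close>

lemma S_coset_eq:
  assumes "s \<in> S" "t \<in> S" "I +> s = I +> t"
  shows "J +> s = J +> t"
proof -
  have "s \<ominus> t \<in> I" using assms coset_eq_iff[OF A_algebra ideals(1), of s t] by simp
  then have "s \<ominus> t \<in> J" using S_power S_minus[OF assms(1,2)] by blast
  then show ?thesis using assms coset_eq_iff[OF A_algebra ideals(2), of s t] by simp
qed

lemma section_exists:
  obtains \<sigma> where "\<sigma> \<in> calg_hom B D" and "\<And>s. s \<in> S \<Longrightarrow> \<sigma> (I +> s) = J +> s"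
proof -
  define \<sigma> where "\<sigma> b = J +> (SOME s. s \<in> S \<and> b = I +> s)" for b
  have \<sigma>: "\<sigma> (I +> s) = J +> s" if "s \<in> S" for s
  proof -
    define t where "t = (SOME t. t \<in> S \<and> I +> s = I +> t)"
    have "t \<in> S \<and> I +> s = I +> t"
      unfolding t_def by (rule someI[of _ s]) (use that in auto)
    moreover have "\<sigma> (I +> s) = J +> t" unfolding \<sigma>_def t_def ..
    ultimately show ?thesis using S_coset_eq[OF that, of t] by simp
  qed
  note IS = alg_quot_simps[OF A_algebra ideals(1)] and JS = alg_quot_simps[OF A_algebra ideals(2)]
  have "\<sigma> \<in> ring_hom B D"
  proof (rule ring_hom_memI)
    show "\<sigma> \<one>\<^bsub>B\<^esub> = \<one>\<^bsub>D\<^esub>" by (simp add: IS(1) JS(1) \<sigma> S_one)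
    fix x assume "x \<in> carrier B"
    then obtain s where s: "s \<in> S" "x = I +> s" using S_coset by blast
    then show "\<sigma> x \<in> carrier D" by (simp add: \<sigma> alg_quot_closed)
    fix y assume "y \<in> carrier B"
    then obtain t where t: "t \<in> S" "y = I +> t" using S_coset by blast
    show "\<sigma> (x \<otimes>\<^bsub>B\<^esub> y) = \<sigma> x \<otimes>\<^bsub>D\<^esub> \<sigma> y" "\<sigma> (x \<oplus>\<^bsub>B\<^esub> y) = \<sigma> x \<oplus>\<^bsub>D\<^esub> \<sigma> y"
      using s t by (simp_all add: IS JS \<sigma> S_mult S_add)
  qed
  moreover have "\<sigma> (c \<odot>\<^bsub>B\<^esub> x) = c \<odot>\<^bsub>D\<^esub> \<sigma> x" if x: "x \<in> carrier B" for c x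
  proof -
    obtain s where s: "s \<in> S" "x = I +> s" using S_coset[OF x] by blast
    then show ?thesis by (simp add: IS JS \<sigma> S_scale)
  qed
  ultimately have "\<sigma> \<in> calg_hom B D" by (simp add: calg_hom_def)
  then show ?thesis using \<sigma> that by blast
qed

text \<open>The left side is the restriction morphism applied to a class modulo \<open>J\<close>.
  With \<open>J \<subseteq> I\<close> adding \<open>I\<close> absorbs \<open>J\<close>, so
  restriction undoes the section.\<close>

lemma ideal_add_coset:
  assumes "x \<in> carrier A"
  shows "I <+> (J +> x) = I +> x"
proof -
  interpret I: ideal I A by (rule ideals(1))
  interpret J: ideal J A by (rule ideals(2))
  have "(i \<oplus> (j \<oplus> x)) \<in> I +> x" if "i \<in> I" "j \<in> J" for i j
  proof -
    have "i \<oplus> j \<in> I"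
      using that J_subset_I by (intro additive_subgroup.a_closed[OF I.is_additive_subgroup]) auto
    moreover have "i \<oplus> (j \<oplus> x) = (i \<oplus> j) \<oplus> x"
      using that assms I.Icarr J.Icarr by (simp add: a_assoc)
    ultimately show ?thesis by (auto simp: a_r_coset_def')
  qed
  moreover have "\<exists>j\<in>J. i \<oplus> x = i \<oplus> (j \<oplus> x)" if "i \<in> I" for i
    using that assms additive_subgroup.zero_closed[OF J.is_additive_subgroup]
    by (intro bexI[of _ \<zero>]) auto
  ultimately show ?thesis
    by (fastforce simp: set_add_def' a_r_coset_def')
qed

section \<open>Expansions in powers of the generator\<close>

lemma power_cancel:
  "x \<in> carrier A \<Longrightarrow> x \<otimes> a [^] (k::nat) = \<zero> \<Longrightarrow> x = \<zero>"
proof (induction k)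
  case (Suc k)
  then have "(x \<otimes> a [^] k) \<otimes> a = \<zero>" using generator_closed by (simp add: m_assoc)
  then show ?case using Suc nonzerodivisor[of "x \<otimes> a [^] k"] by simp
qed simp

text \<open>Repeated division by \<open>a\<close>: the cofactor \<open>y\<close> is split by
  \<open>S_dense\<close> into a new coefficient in \<open>S\<close> and a multiple of
  \<open>a\<close>.\<close>

lemma expansion:
  assumes "x \<in> carrier A"
  shows "\<exists>s y. (\<forall>i. s i \<in> S) \<and> y \<in> carrier A
    \<and> x = finsum A (\<lambda>i. s i \<otimes> a [^] i) {..<k} \<oplus> y \<otimes> a [^] (k::nat)"
proof (induction k)
  case 0
  \<comment> \<open>The sum is empty; the constant family \<open>\<one>\<close> only provides a
    member of \<open>S\<close> at every index.\<close>
  then show ?case using assms S_one by (intro exI[of _ "\<lambda>_. \<one>"] exI[of _ x]) simp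
next
  case (Suc k)
  then obtain s y where s: "\<And>i. s i \<in> S" and y: "y \<in> carrier A"
    and x: "x = finsum A (\<lambda>i. s i \<otimes> a [^] i) {..<k} \<oplus> y \<otimes> a [^] k" by blast
  obtain t i where t: "t \<in> S" "i \<in> I" "y = i \<oplus> t" using S_dense[OF y] by blast
  obtain z where z: "z \<in> carrier A" "i = z \<otimes> a" using t(2) by (auto simp: mem_cgenideal)
  define u where "u = s(k := t)"
  have u: "u i \<in> S" for i using s t by (simp add: u_def)
  have eq: "finsum A (\<lambda>i. u i \<otimes> a [^] i) {..<k} = finsum A (\<lambda>i. s i \<otimes> a [^] i) {..<k}"
    by (rule finsum_cong') (use s in \<open>auto simp: u_def\<close>)
  define p where "p = finsum A (\<lambda>i. s i \<otimes> a [^] i) {..<k}"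
  have p: "p \<in> carrier A" unfolding p_def by (rule finsum_closed) (use s in auto)
  have "finsum A (\<lambda>i. u i \<otimes> a [^] i) {..<Suc k} = t \<otimes> a [^] k \<oplus> p"
    using u by (subst finsum_lessThan_Suc) (auto simp: eq p_def, simp add: u_def)
  moreover have "y \<otimes> a [^] k = t \<otimes> a [^] k \<oplus> z \<otimes> a [^] Suc k"
    using t(1) z generator_closed by (simp add: t(3) l_distr r_distr m_ac a_ac)
  then have "x = t \<otimes> a [^] k \<oplus> p \<oplus> z \<otimes> a [^] Suc k"
    unfolding x p_def[symmetric] using t(1) p z generator_closed by (simp add: a_ac del: nat_pow_Suc)
  ultimately have "x = finsum A (\<lambda>i. u i \<otimes> a [^] i) {..<Suc k} \<oplus> z \<otimes> a [^] Suc k"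
    by (simp only:)
  then show ?case using u z(1) by (intro exI[of _ u] exI[of _ z] conjI allI)
qed

text \<open>
  The induction removes the top term: if the lower coefficients lie in \<open>I\<close>, they lie in \<open>J\<close>, and
  then the top one can be divided by \<open>a\<close>.
\<close>

lemma independence:
  assumes s: "\<And>i. s i \<in> S"
    and "k \<le> n" "finsum A (\<lambda>i. s i \<otimes> a [^] i) {..<k} \<in> PIdl (a [^] k)" "i < k"
  shows "s i \<in> I"
  using assms(2-)
proof (induction k arbitrary: i)
  case 0
  then show ?case by simp
next
  case (Suc k)
  define p where "p = finsum A (\<lambda>i. s i \<otimes> a [^] i) {..<k}"
  define q where "q = s k \<otimes> a [^] k"
  have p: "p \<in> carrier A" unfolding p_def by (rule finsum_closed) (use s in auto)
  have q: "q \<in> carrier A" using s by (simp add: q_def)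
  have sum: "q \<oplus> p \<in> PIdl (a [^] Suc k)"
    using Suc.prems(2) s by (subst (asm) finsum_lessThan_Suc) (auto simp: p_def q_def)
  have "q \<in> PIdl (a [^] k)" using s by (auto simp: q_def mem_cgenideal)
  moreover have "q \<oplus> p \<in> PIdl (a [^] k)"
    using sum power_ideal_mono[of k "Suc k"] by auto
  ultimately have "p \<in> PIdl (a [^] k)"
    using ideal.add_mem_cancel[OF power_ideal] p by blast
  then have low: "s j \<in> I" if "j < k" for j
    using Suc.IH[of j] Suc.prems(1) that by (simp add: p_def)
  then have "s j \<otimes> a [^] j \<in> J" if "j < k" for j
    using that S_power s by (intro ideal.I_r_closed[OF ideals(2)]) auto
  then have "p \<in> J" unfolding p_def by (rule ideal.finsum_mem[OF ideals(2)])
  \<comment> \<open>The bound \<open>Suc k \<le> n\<close> is used here: it places \<open>J\<close>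
    inside the ideal of \<open>a [^] Suc k\<close>.\<close>
  then have "p \<in> PIdl (a [^] Suc k)" using power_ideal_mono[OF Suc.prems(1)] by blast
  moreover have "p \<oplus> q \<in> PIdl (a [^] Suc k)" using sum p q by (simp add: a_comm)
  ultimately have "q \<in> PIdl (a [^] Suc k)"
    using ideal.add_mem_cancel[OF power_ideal] q by blast
  then obtain y where y: "y \<in> carrier A" "q = y \<otimes> a [^] Suc k" unfolding mem_cgenideal by blast
  then have "s k \<otimes> a [^] k = (y \<otimes> a) \<otimes> a [^] k"
    using generator_closed by (simp add: q_def m_ac)
  \<comment> \<open>Prepares the cancellation of \<open>a [^] k\<close>, which is where
    \<open>a\<close> must not be a zero divisor.\<close>
  then have "(s k \<ominus> y \<otimes> a) \<otimes> a [^] k = \<zero>"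
    using s y generator_closed by (simp add: minus_eq l_distr l_minus r_neg)
  then have "s k \<ominus> y \<otimes> a = \<zero>"
    using power_cancel[of "s k \<ominus> y \<otimes> a" k] s y generator_closed by simp
  moreover have "s k = (s k \<ominus> y \<otimes> a) \<oplus> y \<otimes> a"
    using s y generator_closed by (simp add: minus_eq a_assoc l_neg)
  ultimately have "s k = y \<otimes> a" using y generator_closed by simp
  then have "s k \<in> I" using y by (auto simp: mem_cgenideal)
  then show ?case using low Suc.prems(3) by (cases "i = k") auto
qed

text \<open>The map \<open>\<Theta>\<close> out of the tensor product is the section on the left
  factor and sends the variable to the class of \<open>a\<close>, whose \<open>n\<close>-th power is
  zero. \<open>expansion\<close> gives surjectivity and \<open>independence\<close>
  injectivity.\<close>

theorem quotient_iso_tensor: "\<exists>\<psi>. \<psi> \<in> calg_iso D (tensor_alg B (truncated_poly n))"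
proof -
  let ?T = "truncated_poly n"
  have B: "algebra complex_field B" and D: "algebra complex_field D"
    by (rule alg_quot_algebra[OF A_algebra ideals(1)] alg_quot_algebra[OF A_algebra ideals(2)])+
  interpret pair: calg_pair B ?T
    using B truncated_algebra by (simp add: calg_pair_def calg_def)
  interpret Q: calg "tensor_alg B ?T" by (rule calg.intro[OF pair.tensor_algebra])
  interpret D: calg D by (rule calg.intro[OF D])
  interpret \<pi>: ring_hom_cring A D "\<lambda>x. J +> x"
    using coset_calg_hom[OF A_algebra ideals(2)] by unfold_locales (simp add: calg_hom_def)
  obtain \<sigma> where \<sigma>: "\<sigma> \<in> calg_hom B D" "\<And>s. s \<in> S \<Longrightarrow> \<sigma> (I +> s) = J +> s"
    using section_exists by blast
  have "(J +> a) [^]\<^bsub>D\<^esub> n = \<zero>\<^bsub>D\<^esub>"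
  proof -
    have "(J +> a) [^]\<^bsub>D\<^esub> n = J +> (a [^] n)" using generator_closed by simp
    also have "\<dots> = J" using coset_eq_zero_iff[OF A_algebra ideals(2)] cgenideal_self by simp
    finally show ?thesis by (simp add: alg_quot_const)
  qed
  moreover have "J +> a \<in> carrier D" using generator_closed by (rule alg_quot_closed)
  ultimately obtain k where k: "k \<in> calg_hom ?T D"
    "\<And>i. k (truncated_power n i) = (J +> a) [^]\<^bsub>D\<^esub> i"
    using truncated_poly_lift[OF D] by blast
  obtain \<Theta> where \<Theta>: "\<Theta> \<in> calg_hom (tensor_alg B ?T) D"
    "\<And>b x. b \<in> carrier B \<Longrightarrow> x \<in> carrier ?T \<Longrightarrow> \<Theta> (pair.tensor b x) = \<sigma> b \<otimes>\<^bsub>D\<^esub> k x"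
    using pair.tensor_lift[OF D \<sigma>(1) k(1)] by blast
  interpret \<Theta>: ring_hom_cring "tensor_alg B ?T" D \<Theta>
    using \<Theta>(1) by unfold_locales (simp add: calg_hom_def)
  define \<tau> where "\<tau> s = finsum (tensor_alg B ?T) (\<lambda>i. pair.tensor (I +> s i) (truncated_power n i)) {..<n}"
    for s
  have tensor: "pair.tensor (I +> x) (truncated_power n i) \<in> carrier (tensor_alg B ?T)"
    if "x \<in> carrier A" for x i
    using that by (intro pair.tensor_closed alg_quot_closed truncated_power_closed)
  have \<tau>_closed: "\<tau> s \<in> carrier (tensor_alg B ?T)" if "\<And>i. s i \<in> S" for s
    unfolding \<tau>_def by (rule Q.finsum_closed) (use that tensor in auto)
  have \<Theta>_\<tau>: "\<Theta> (\<tau> s) = J +> finsum A (\<lambda>i. s i \<otimes> a [^] i) {..<n}" if s: "\<And>i. s i \<in> S" for s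
  proof -
    have "\<Theta> (pair.tensor (I +> s i) (truncated_power n i)) = J +> (s i \<otimes> a [^] i)" for i
      using s generator_closed by (simp add: \<Theta>(2) alg_quot_closed truncated_power_closed \<sigma>(2) k(2))
    moreover have "\<Theta> (\<tau> s) = finsum D (\<Theta> \<circ> (\<lambda>i. pair.tensor (I +> s i) (truncated_power n i))) {..<n}"
      unfolding \<tau>_def by (rule \<Theta>.hom_finsum) (use s tensor in auto)
    moreover have "J +> finsum A (\<lambda>i. s i \<otimes> a [^] i) {..<n}
        = finsum D ((\<lambda>x. J +> x) \<circ> (\<lambda>i. s i \<otimes> a [^] i)) {..<n}"
      by (rule \<pi>.hom_finsum) (use s in auto)
    ultimately show ?thesis by (simp add: o_def)
  qed
  \<comment> \<open>Each coefficient in the left factor is replaced by a representative in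
    \<open>S\<close>, so that the kernel of \<open>\<Theta>\<close> consists of expansions to which
    \<open>independence\<close> applies.\<close>
  have surj_\<tau>: "\<exists>s. (\<forall>i. s i \<in> S) \<and> q = \<tau> s" if q: "q \<in> carrier (tensor_alg B ?T)" for q
  proof -
    obtain b where b: "\<forall>i. b i \<in> carrier B"
      "q = finsum (tensor_alg B ?T) (\<lambda>i. pair.tensor (b i) (truncated_power n i)) {..<n}"
      using pair.tensor_span[OF truncated_power_closed truncated_power_span q] by blast
    have "\<forall>i. \<exists>s. s \<in> S \<and> b i = I +> s" using S_coset b(1) by blast
    from choice[OF this] obtain s where "\<forall>i. s i \<in> S \<and> b i = I +> s i" by blast
    then show ?thesis using b(2) by (intro exI[of _ s]) (simp add: \<tau>_def)
  qed
  have "q = \<zero>\<^bsub>tensor_alg B ?T\<^esub>" if q: "q \<in> carrier (tensor_alg B ?T)" "\<Theta> q = \<zero>\<^bsub>D\<^esub>" for q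
  proof -
    obtain s where s: "\<And>i. s i \<in> S" "q = \<tau> s" using surj_\<tau>[OF q(1)] by blast
    have "finsum A (\<lambda>i. s i \<otimes> a [^] i) {..<n} \<in> carrier A"
      by (rule finsum_closed) (use s in auto)
    moreover have "J +> finsum A (\<lambda>i. s i \<otimes> a [^] i) {..<n} = J"
      using q(2) \<Theta>_\<tau>[OF s(1)] by (simp add: s(2) alg_quot_const del: \<pi>.hom_finsum)
    ultimately have "finsum A (\<lambda>i. s i \<otimes> a [^] i) {..<n} \<in> J"
      using coset_eq_zero_iff[OF A_algebra ideals(2)] by blast
    then have "s i \<in> I" if "i < n" for i
      using independence[of s n i] s(1) that by simp
    then have "I +> s i = \<zero>\<^bsub>B\<^esub>" if "i < n" for i
      using that coset_eq_zero_iff[OF A_algebra ideals(1)] s(1) by (simp add: alg_quot_const)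
    then have "\<tau> s = finsum (tensor_alg B ?T) (\<lambda>i. \<zero>\<^bsub>tensor_alg B ?T\<^esub>) {..<n}"
      unfolding \<tau>_def
      by (intro Q.finsum_cong') (auto simp: pair.tensor_zero_left truncated_power_closed)
    then show ?thesis by (simp add: s(2))
  qed
  then have "a_kernel (tensor_alg B ?T) D \<Theta> = {\<zero>\<^bsub>tensor_alg B ?T\<^esub>}"
    unfolding a_kernel_def' by (auto simp: \<Theta>.hom_zero)
  then have inj: "inj_on \<Theta> (carrier (tensor_alg B ?T))"
    by (rule ring_hom_ring.trivial_ker_imp_inj[OF ring_hom_ringI2[OF
          cring.axioms(1)[OF algebra.M_cring[OF pair.tensor_algebra]]
          cring.axioms(1)[OF algebra.M_cring[OF D]] \<Theta>.homh]])
  have "d \<in> \<Theta> ` carrier (tensor_alg B ?T)" if d: "d \<in> carrier D" for d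
  proof -
    obtain x where x: "x \<in> carrier A" "d = J +> x" using d by (auto simp: alg_quot_carrier)
    obtain s y where s: "\<And>i. s i \<in> S" and y: "y \<in> carrier A"
      "x = finsum A (\<lambda>i. s i \<otimes> a [^] i) {..<n} \<oplus> y \<otimes> a [^] n"
      using expansion[OF x(1), of n] by blast
    have p: "finsum A (\<lambda>i. s i \<otimes> a [^] i) {..<n} \<in> carrier A"
      by (rule finsum_closed) (use s in auto)
    have "y \<otimes> a [^] n \<in> J" using y(1) by (auto simp: mem_cgenideal)
    moreover have yc: "y \<otimes> a [^] n \<in> carrier A" using y(1) by simp
    ultimately have zero: "J +> (y \<otimes> a [^] n) = \<zero>\<^bsub>D\<^esub>"
      unfolding alg_quot_const using coset_eq_zero_iff[OF A_algebra ideals(2)] by blast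
    have "d = (J +> finsum A (\<lambda>i. s i \<otimes> a [^] i) {..<n}) \<oplus>\<^bsub>D\<^esub> (J +> (y \<otimes> a [^] n))"
      unfolding x(2) y(2) by (rule \<pi>.hom_add[OF p yc])
    also have "\<dots> = J +> finsum A (\<lambda>i. s i \<otimes> a [^] i) {..<n}"
      unfolding zero by (rule D.r_zero[OF \<pi>.hom_closed[OF p]])
    finally have "d = \<Theta> (\<tau> s)" unfolding \<Theta>_\<tau>[OF s] .
    then show ?thesis by (rule image_eqI) (rule \<tau>_closed[OF s])
  qed
  then have "\<Theta> ` carrier (tensor_alg B ?T) = carrier D"
    by (intro equalityI subsetI image_subsetI \<Theta>.hom_closed)
  then have iso: "\<Theta> \<in> calg_iso (tensor_alg B ?T) D"
    using \<Theta>(1) inj by (simp add: calg_iso_def bij_betw_def)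
  show ?thesis by (rule exI, rule calg_iso_inverse[OF pair.tensor_algebra D iso])
qed

end

section \<open>The local structure of multiple hypersurfaces\<close>

text \<open>Matches the power of the ideal sheaf with the principal ideal on which
  \<open>calg_complement\<close> works. A product of ideals contains finite sums of products, hence
  the induction over its construction.\<close>

lemma (in cring) ideal_pow_cgenideal:
  assumes a: "a \<in> carrier R"
  shows "ideal_pow R (PIdl a) n = PIdl (a [^] n)"
proof (induction n)
  case 0
  show ?case by (auto simp: mem_cgenideal)
next
  case (Suc n)
  have "(PIdl a) \<cdot> (PIdl (a [^] n)) = PIdl (a [^] Suc n)"
  proof (intro equalityI subsetI)
    fix x assume "x \<in> (PIdl a) \<cdot> (PIdl (a [^] n))"
    then show "x \<in> PIdl (a [^] Suc n)"
    proof (induction rule: ideal_prod.induct)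
      case (prod i j)
      then obtain y z where "y \<in> carrier R" "i = y \<otimes> a" "z \<in> carrier R" "j = z \<otimes> a [^] n"
        by (auto simp: mem_cgenideal)
      then show ?case
        using a unfolding mem_cgenideal by (intro bexI[of _ "y \<otimes> z"]) (simp_all add: m_ac)
    next
      case (sum s t)
      then show ?case
        using a by (intro additive_subgroup.a_closed[OF ideal.axioms(1)[OF cgenideal_ideal]]) auto
    qed
  next
    fix x assume "x \<in> PIdl (a [^] Suc n)"
    then obtain y where y: "y \<in> carrier R" "x = y \<otimes> a [^] Suc n" unfolding mem_cgenideal by blast
    have "(y \<otimes> a) \<otimes> a [^] n \<in> (PIdl a) \<cdot> (PIdl (a [^] n))"
      using y(1) a by (intro ideal_prod.prod) (auto simp: mem_cgenideal intro: bexI[of _ \<one>])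
    then show "x \<in> (PIdl a) \<cdot> (PIdl (a [^] n))"
      using y a by (simp add: m_ac)
  qed
  then show ?case using Suc by simp
qed

text \<open>A function \<open>e\<close> is chosen for the generator of the ideal stalk. It vanishes
  on \<open>Y\<close> because a generator lies in its own ideal, and it is no zero divisor because
  it is a nonzero germ on an irreducible variety.\<close>

lemma hypersurface_local_equation:
  assumes X: "irreducible_variety X" and Y: "hypersurface X Y" and P: "P \<in> Y"
  obtains e where "hypersurface_point X P Y e"
    and "ideal_stalk X Y P = PIdl\<^bsub>stalk X P\<^esub> (germ_of X P e)"
    and "\<And>x. x \<in> carrier (stalk X P) \<Longrightarrow> x \<otimes>\<^bsub>stalk X P\<^esub> germ_of X P e = \<zero>\<^bsub>stalk X P\<^esub> \<Longrightarrow>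
      x = \<zero>\<^bsub>stalk X P\<^esub>"
proof -
  have pre: "prevariety X" and space: "space_with_functions X"
    using X by (auto simp: irreducible_variety_def variety_def prevariety_def)
  have top: "P \<in> topspace (top_of X)"
    using Y P closedin_subset by (fastforce simp: hypersurface_def)
  interpret pointed_space X P using space top by unfold_locales
  interpret A: calg "stalk X P" by (rule calg.intro[OF stalk_algebra])
  obtain f where f: "f \<in> carrier (stalk X P)" "f \<noteq> \<zero>\<^bsub>stalk X P\<^esub>"
    "ideal_stalk X Y P = PIdl\<^bsub>stalk X P\<^esub> f"
    using Y P unfolding hypersurface_def by blast
  then obtain e where e: "e \<in> regular_at X P" "f = germ_of X P e" by (auto simp: carrier_stalk)
  have "f \<in> ideal_stalk X Y P" unfolding f(3) by (rule A.cgenideal_self[OF f(1)])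
  then obtain h where h: "\<forall>\<^sub>F x in near X P. x \<in> Y \<longrightarrow> h x = 0" "f = germ_of X P h"
    unfolding ideal_stalk_germs by blast
  have "\<forall>\<^sub>F x in near X P. e x = h x" using germ_of_eq_iff[OF e(1)] e(2) h(2) by blast
  with h(1) have e_zero: "\<forall>\<^sub>F x in near X P. x \<in> Y \<longrightarrow> e x = 0" by eventually_elim simp
  have generates: "\<exists>r\<in>regular_at X P. \<forall>\<^sub>F x in near X P. g x = e x * r x"
    if g: "g \<in> regular_at X P" "\<forall>\<^sub>F x in near X P. x \<in> Y \<longrightarrow> g x = 0" for g
  proof -
    have "germ_of X P g \<in> PIdl\<^bsub>stalk X P\<^esub> f"
      using g unfolding f(3)[symmetric] ideal_stalk_germs by blast
    then obtain r where r: "r \<in> regular_at X P"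
      "germ_of X P g = germ_of X P r \<otimes>\<^bsub>stalk X P\<^esub> germ_of X P e"
      unfolding A.mem_cgenideal carrier_stalk e(2) by blast
    then have "\<forall>\<^sub>F x in near X P. g x = r x * e x"
      using germ_of_eq_iff[OF g(1)] by (simp add: germ_mult e(1))
    then have "\<forall>\<^sub>F x in near X P. g x = e x * r x" by eventually_elim simp
    then show ?thesis using r(1) by (rule bexI)
  qed
  have "x = \<zero>\<^bsub>stalk X P\<^esub>"
    if x: "x \<in> carrier (stalk X P)" "x \<otimes>\<^bsub>stalk X P\<^esub> germ_of X P e = \<zero>\<^bsub>stalk X P\<^esub>" for x
  proof -
    obtain g where g: "g \<in> regular_at X P" "x = germ_of X P g" using x(1) by (auto simp: carrier_stalk)
    have "germ_of X P (\<lambda>x. g x * e x) = germ_of X P (\<lambda>_. 0)"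
      using x(2) by (simp add: g germ_mult e(1) germ_const)
    then have "\<forall>\<^sub>F x in near X P. g x * e x = 0"
      by (rule germ_of_eq_iff[OF regular.mult[OF g(1) e(1)], THEN iffD1])
    then have "(\<forall>\<^sub>F x in near X P. g x = 0) \<or> (\<forall>\<^sub>F x in near X P. e x = 0)"
      by (rule irreducible_variety_regular_integral[OF X g(1) e(1)])
    moreover have "\<not> (\<forall>\<^sub>F x in near X P. e x = 0)"
      using f(2) germ_of_cong[of e "\<lambda>_. 0"] by (auto simp: e(2) germ_const)
    ultimately show ?thesis
      using germ_of_cong[of g "\<lambda>_. 0"] by (auto simp: g(2) germ_const)
  qed
  moreover have "hypersurface_point X P Y e"
    using P e(1) e_zero generates regular_at_inverse[OF pre]
    by unfold_locales blast+
  ultimately show ?thesis using f(3) that unfolding e(2) by blast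
qed

theorem mainTheorem1:
  fixes X :: "'p fun_space" and Y :: "'p set" and n :: nat and P :: 'p
  assumes "irreducible_variety X" and "smooth X"
    and "smooth_hypersurface X Y"
    and "n \<ge> 1"
    and "P \<in> Y"
  shows "(\<exists>\<sigma> \<in> calg_hom (hypersurface_stalk X Y P) (multiple_stalk X Y n P).
            \<forall>a \<in> carrier (hypersurface_stalk X Y P). restriction_map X Y P (\<sigma> a) = a)
       \<and> (\<exists>\<psi>. \<psi> \<in> calg_iso (multiple_stalk X Y n P)
                      (tensor_alg (hypersurface_stalk X Y P) (truncated_poly n)))"
proof -
  have Y: "hypersurface X Y" "smooth (induced X Y)"
    using assms(3) by (auto simp: smooth_hypersurface_def)
  obtain e where e: "hypersurface_point X P Y e"
    and I: "ideal_stalk X Y P = PIdl\<^bsub>stalk X P\<^esub> (germ_of X P e)"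
    and nonzerodivisor: "\<And>x. x \<in> carrier (stalk X P) \<Longrightarrow>
      x \<otimes>\<^bsub>stalk X P\<^esub> germ_of X P e = \<zero>\<^bsub>stalk X P\<^esub> \<Longrightarrow> x = \<zero>\<^bsub>stalk X P\<^esub>"
    using hypersurface_local_equation[OF assms(1) Y(1) assms(5)] by blast
  interpret hypersurface_point X P Y e by (rule e)
  have "smooth_at (induced X Y) P"
    using Y(2) point_in assms(5) by (simp add: smooth_def topspace_induced)
  from smooth_complement[OF this assms(4)] obtain S where S: "S \<subseteq> carrier (stalk X P)"
    "\<one>\<^bsub>stalk X P\<^esub> \<in> S"
    "\<forall>a\<in>S. \<forall>b\<in>S. a \<oplus>\<^bsub>stalk X P\<^esub> b \<in> S \<and> a \<otimes>\<^bsub>stalk X P\<^esub> b \<in> S"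
    "\<forall>c. \<forall>a\<in>S. c \<odot>\<^bsub>stalk X P\<^esub> a \<in> S"
    "\<forall>a\<in>carrier (stalk X P). \<exists>b\<in>S. \<exists>i\<in>ideal_stalk X Y P. a = i \<oplus>\<^bsub>stalk X P\<^esub> b"
    "S \<inter> ideal_stalk X Y P \<subseteq> PIdl\<^bsub>stalk X P\<^esub> (germ_of X P e [^]\<^bsub>stalk X P\<^esub> n)"
    by (elim exE conjE)
  interpret A: calg "stalk X P" by (rule calg.intro[OF stalk_algebra])
  \<comment> \<open>Only algebra in the stalk remains: the equation \<open>I\<close> replaces the
    ideal of \<open>Y\<close> by the one generated by the germ of \<open>e\<close>.\<close>
  interpret C: calg_complement "stalk X P" "germ_of X P e" S n
    using S(3-) nonzerodivisor assms(4) unfolding I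
    by unfold_locales (simp_all add: S(1,2) germ_of_closed equation_regular)
  have B: "hypersurface_stalk X Y P = C.B"
    by (simp add: hypersurface_stalk_def I)
  have D: "multiple_stalk X Y n P = C.D"
    by (simp add: multiple_stalk_def I A.ideal_pow_cgenideal germ_of_closed equation_regular)
  obtain \<sigma> where \<sigma>: "\<sigma> \<in> calg_hom C.B C.D" "\<And>s. s \<in> S \<Longrightarrow> \<sigma> (C.I +>\<^bsub>stalk X P\<^esub> s) = C.J +>\<^bsub>stalk X P\<^esub> s"
    using C.section_exists by blast
  have "restriction_map X Y P (\<sigma> b) = b" if b: "b \<in> carrier C.B" for b
  proof -
    obtain s where s: "s \<in> S" "b = C.I +>\<^bsub>stalk X P\<^esub> s" using C.S_coset[OF b] by blast
    then show ?thesis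
      using C.ideal_add_coset[OF C.S_closed[OF s(1)]] by (simp add: restriction_map_def I \<sigma>(2))
  qed
  then show ?thesis
    unfolding B D using \<sigma>(1) C.quotient_iso_tensor by blast
qed

end
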